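(* Let $F$ be a field of characteristic zero, let $m,n$ be positive integers, $f=x^m+y^n+z^2$ and $A=F[[x,y,z]]/(f)$. For all integers $k,l$ with $1\le k\le m$ and $1\le l\le n$, let $W=W(\phi,\psi)=A^4/\operatorname{im}\phi$, where $(\phi,\psi)$ is the matrix factorization of $f$ given in the context. Let $\delta_0,\delta_1,\delta_2,\delta_3\in\operatorname{Der}_F(A)$ be the generators of $\mathbf{V}_W=\operatorname{Der}_F(A)$ and $A_0,A_1,A_2,A_3$ the $4\times 4$ matrices given in the context. Then the formulas $$\overline{\nabla}_{\delta_i}(\overline{a})=\overline{(\delta_i+A_i)a}\qquad (i=0,1,2,3,\ a\in A^4),$$ where $\delta_i$ acts on $A^4$ coordinatewise and $\overline{a}$ denotes the class of $a$ in $W$, define a (well-defined) algebraic $\mathbf{V}_W$-connection $\overline{\nabla}^{\phi,\psi}:\mathbf{V}_W\to\operatorname{End}_F(W)$, i.e. an $A$-linear map satisfying $\overline{\nabla}_\delta(aw)=a\overline{\nabla}_\delta(w)+\delta(a)w$ for all $\delta\in\mathbf{V}_W$, $a\in A$, $w\in W$.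
   Context: Matrix factorization. For $1\le k\le m$ and $1\le l\le n$ put $$\phi=\begin{pmatrix} x^{m-k} & y^{n-l} & 0 & z \\ y^l & -x^k & z & 0 \\ z & 0 & -y^{n-l} & -x^k \\ 0 & z & x^{m-k} & -y^l\end{pmatrix},\qquad \psi=\begin{pmatrix} x^k & y^{n-l} & z & 0 \\ y^l & -x^{m-k} & 0 & z \\ 0 & z & -y^l & x^k \\ z & 0 & -x^{m-k} & -y^{n-l}\end{pmatrix}.$$ They satisfy $\phi\psi=\psi\phi=f\cdot I$, and $W(\phi,\psi)=A^4/\operatorname{im}\phi$ is a maximal Cohen-Macaulay $A$-module. Derivations. $\operatorname{Der}_F(A)$ is generated as an $A$-module by $$\delta_0=2nx\partial_x+2my\partial_y+mnz\partial_z,\quad \delta_1=mx^{m-1}\partial_y-ny^{n-1}\partial_x,\quad \delta_2=-2z\partial_x+mx^{m-1}\partial_z,\quad \delta_3=-2z\partial_y+ny^{n-1}\partial_z.$$ Linear Lie-Rinehart algebra. For an $A$-module $W$, $\mathbf{V}_W\subseteq\operatorname{Der}_F(A)$ is the kernel of the Kodaira-Spencer map $g:\operatorname{Der}_F(A)\to \operatorname{Ext}^1_A(W,W)=\operatorname{HH}^1(A,\operatorname{End}_F(W))$ sending $\delta$ to the class of the derivation $C(\delta)(a)(w)=\delta(a)w$ modulo the inner derivations $a\mapsto\varphi a-a\varphi$, $\varphi\in\operatorname{End}_F(W)$, where $(a\varphi)(w)=a\varphi(w)$ and $(\varphi a)(w)=\varphi(aw)$. For the modules $W=W(\phi,\psi)$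 the map $g$ is zero, so $\mathbf{V}_W=\operatorname{Der}_F(A)$. Matrices. $$A_0=\operatorname{diag}\left(nk+ml-\tfrac12 mn,\ \tfrac32 mn-ml-nk,\ \tfrac12 mn+ml-nk,\ \tfrac12 mn+nk-ml\right),$$ $$A_1=\begin{pmatrix}0&b_2&0&0\\ b_1&0&0&0\\0&0&0&b_4\\0&0&b_3&0\end{pmatrix},\quad A_2=\begin{pmatrix}0&0&c_3&0\\0&0&0&c_4\\c_1&0&0&0\\0&c_2&0&0\end{pmatrix},\quad A_3=\begin{pmatrix}0&0&0&d_4\\0&0&d_3&0\\0&d_2&0&0\\d_1&0&0&0\end{pmatrix},$$ where $b_1=\frac14(mn-2nk-2ml)x^{k-1}y^{l-1}$, $b_2=\frac14(3mn-2ml-2nk)x^{m-k-1}y^{n-l-1}$, $b_3=\frac14(2nk-mn-2ml)x^{m-k-1}y^{l-1}$, $b_4=\frac14(2nk-2ml+mn)x^{k-1}y^{n-l-1}$; $c_1=\frac1n(\frac12mn-ml-nk)x^{k-1}$, $c_2=\frac1n(\frac32mn-ml-nk)x^{m-k-1}$, $c_3=\frac1n(\frac12mn+ml-nk)x^{m-k-1}$, $c_4=\frac1n(ml-nk-\frac12mn)x^{k-1}$; $d_1=\frac1m(\frac12mn-ml-nk)y^{l-1}$, $d_2=\frac1m(ml+nk-\frac32mn)y^{n-l-1}$, $d_3=\frac1m(\frac12mn+ml-nk)y^{l-1}$, $d_4=\frac1m(\frac12mn-ml+nk)y^{n-l-1}$.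
   Formalization: When k=m or l=n the given matrices contain x^{-1} or y^{-1}, not in A; the formal theorem covers exactly the k,l for which all entries of A_0,...,A_3 lie in A, i.e. (k<m or n=2l) and (l<n or m=2k). *)

theory Defs
  imports
    "HOL-Algebra.QuotRing"
    "HOL-Algebra.Module"
    "HOL-Algebra.Algebraic_Closure_Type"
    "HOL-Computational_Algebra.Formal_Power_Series"
    "Jordan_Normal_Form.Matrix"
begin

no_notation fps_nth (infixl "$" 75)

section \<open>Modules, derivations and connections over a commutative ring\<close>

text \<open>
  Throughout, \<open>R\<close> is a commutative ring and \<open>K\<close> a set of elements of \<open>R\<close>, the image of the ground
  field; \<open>K\<close>-linearity is linearity for the scalars in \<open>K\<close>.  Maps are extensional (\<open>undefined\<close>
  off their domain), so that equality of functions is equality of maps.  The ring multiplication and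
  unit inherited by the record type \<open>module\<close> play no role and are left \<open>undefined\<close>.
\<close>

definition free_module :: "('r, 'x) ring_scheme \<Rightarrow> nat \<Rightarrow> ('r, 'r vec) module"
  where "free_module R n =
    \<lparr>carrier = {v \<in> carrier_vec n. \<forall>i<n. v $ i \<in> carrier R},
     monoid.mult = undefined, one = undefined,
     zero = vec n (\<lambda>i. \<zero>\<^bsub>R\<^esub>),
     add = (\<lambda>v w. vec n (\<lambda>i. v $ i \<oplus>\<^bsub>R\<^esub> w $ i)),
     module.smult = (\<lambda>a v. vec n (\<lambda>i. a \<otimes>\<^bsub>R\<^esub> v $ i))\<rparr>"

definition mat_apply :: "('r, 'x) ring_scheme \<Rightarrow> 'r mat \<Rightarrow> 'r vec \<Rightarrow> 'r vec"
  where "mat_apply R M v =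
    vec (dim_row M) (\<lambda>i. \<Oplus>\<^bsub>R\<^esub>j\<in>{..<dim_col M}. M $$ (i, j) \<otimes>\<^bsub>R\<^esub> v $ j)"

definition mat_image :: "('r, 'x) ring_scheme \<Rightarrow> 'r mat \<Rightarrow> 'r vec set"
  where "mat_image R M = mat_apply R M ` carrier (free_module R (dim_col M))"

definition quotient_module :: "('r, 'b, 'x) module_scheme \<Rightarrow> 'b set \<Rightarrow> ('r, 'b set) module"
  where "quotient_module M N =
    \<lparr>carrier = a_rcosets\<^bsub>M\<^esub> N,
     monoid.mult = undefined, one = undefined,
     zero = N,
     add = (\<lambda>S T. S <+>\<^bsub>M\<^esub> T),
     module.smult = (\<lambda>a S. \<Union>x\<in>S. N +>\<^bsub>M\<^esub> (a \<odot>\<^bsub>M\<^esub> x))\<rparr>"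

definition derivations :: "'r set \<Rightarrow> ('r, 'x) ring_scheme \<Rightarrow> ('r \<Rightarrow> 'r) set"
  where "derivations K R = {d \<in> carrier R \<rightarrow>\<^sub>E carrier R.
    (\<forall>a\<in>carrier R. \<forall>b\<in>carrier R. d (a \<oplus>\<^bsub>R\<^esub> b) = d a \<oplus>\<^bsub>R\<^esub> d b) \<and>
    (\<forall>c\<in>K. \<forall>a\<in>carrier R. d (c \<otimes>\<^bsub>R\<^esub> a) = c \<otimes>\<^bsub>R\<^esub> d a) \<and>
    (\<forall>a\<in>carrier R. \<forall>b\<in>carrier R. d (a \<otimes>\<^bsub>R\<^esub> b) = a \<otimes>\<^bsub>R\<^esub> d b \<oplus>\<^bsub>R\<^esub> b \<otimes>\<^bsub>R\<^esub> d a)}"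

definition Der :: "'r set \<Rightarrow> ('r, 'x) ring_scheme \<Rightarrow> ('r, 'r \<Rightarrow> 'r) module"
  where "Der K R =
    \<lparr>carrier = derivations K R,
     monoid.mult = undefined, one = undefined,
     zero = (\<lambda>x\<in>carrier R. \<zero>\<^bsub>R\<^esub>),
     add = (\<lambda>d e. \<lambda>x\<in>carrier R. d x \<oplus>\<^bsub>R\<^esub> e x),
     module.smult = (\<lambda>a d. \<lambda>x\<in>carrier R. a \<otimes>\<^bsub>R\<^esub> d x)\<rparr>"

text \<open>
  \<open>End_K(W)\<close> consists of the \<open>K\<close>-linear endomorphisms.  It is an \<open>R\<close>-bimodule: the left action is
  the scalar multiplication of the record, the right action is \<open>End_right\<close>.
\<close>

definition End :: "'r set \<Rightarrow> ('r, 'x) ring_scheme \<Rightarrow> ('r, 'w, 'y) module_scheme \<Rightarrow> ('r, 'w \<Rightarrow> 'w) module"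
  where "End K R W =
    \<lparr>carrier = {h \<in> carrier W \<rightarrow>\<^sub>E carrier W.
       (\<forall>v\<in>carrier W. \<forall>w\<in>carrier W. h (v \<oplus>\<^bsub>W\<^esub> w) = h v \<oplus>\<^bsub>W\<^esub> h w) \<and>
       (\<forall>c\<in>K. \<forall>w\<in>carrier W. h (c \<odot>\<^bsub>W\<^esub> w) = c \<odot>\<^bsub>W\<^esub> h w)},
     monoid.mult = undefined, one = undefined,
     zero = (\<lambda>w\<in>carrier W. \<zero>\<^bsub>W\<^esub>),
     add = (\<lambda>h h'. \<lambda>w\<in>carrier W. h w \<oplus>\<^bsub>W\<^esub> h' w),
     module.smult = (\<lambda>a h. \<lambda>w\<in>carrier W. a \<odot>\<^bsub>W\<^esub> h w)\<rparr>"

definition End_right :: "('r, 'w, 'y) module_scheme \<Rightarrow> ('w \<Rightarrow> 'w) \<Rightarrow> 'r \<Rightarrow> ('w \<Rightarrow> 'w)"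
  where "End_right W h a = (\<lambda>w\<in>carrier W. h (a \<odot>\<^bsub>W\<^esub> w))"

definition Der_End ::
    "'r set \<Rightarrow> ('r, 'x) ring_scheme \<Rightarrow> ('r, 'w, 'y) module_scheme \<Rightarrow> ('r, 'r \<Rightarrow> 'w \<Rightarrow> 'w) module"
  where "Der_End K R W = (let E = End K R W in
    \<lparr>carrier = {D \<in> carrier R \<rightarrow>\<^sub>E carrier E.
       (\<forall>a\<in>carrier R. \<forall>b\<in>carrier R. D (a \<oplus>\<^bsub>R\<^esub> b) = D a \<oplus>\<^bsub>E\<^esub> D b) \<and>
       (\<forall>c\<in>K. \<forall>a\<in>carrier R. D (c \<otimes>\<^bsub>R\<^esub> a) = c \<odot>\<^bsub>E\<^esub> D a) \<and>
       (\<forall>a\<in>carrier R. \<forall>b\<in>carrier R.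
          D (a \<otimes>\<^bsub>R\<^esub> b) = (a \<odot>\<^bsub>E\<^esub> D b) \<oplus>\<^bsub>E\<^esub> End_right W (D a) b)},
     monoid.mult = undefined, one = undefined,
     zero = (\<lambda>a\<in>carrier R. \<zero>\<^bsub>E\<^esub>),
     add = (\<lambda>D D'. \<lambda>a\<in>carrier R. D a \<oplus>\<^bsub>E\<^esub> D' a),
     module.smult = (\<lambda>a D. \<lambda>b\<in>carrier R. a \<odot>\<^bsub>E\<^esub> D b)\<rparr>)"

definition inner_derivations ::
    "'r set \<Rightarrow> ('r, 'x) ring_scheme \<Rightarrow> ('r, 'w, 'y) module_scheme \<Rightarrow> ('r \<Rightarrow> 'w \<Rightarrow> 'w) set"
  where "inner_derivations K R W =
    {(\<lambda>a\<in>carrier R. End_right W h a \<ominus>\<^bsub>End K R W\<^esub> (a \<odot>\<^bsub>End K R W\<^esub> h)) | h. h \<in> carrier (End K R W)}"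

text \<open>\<open>Ext^1_R(W, W)\<close>, identified with the Hochschild cohomology group \<open>HH^1(R, End_K(W))\<close>.\<close>

definition HH1 ::
    "'r set \<Rightarrow> ('r, 'x) ring_scheme \<Rightarrow> ('r, 'w, 'y) module_scheme \<Rightarrow> ('r, ('r \<Rightarrow> 'w \<Rightarrow> 'w) set) module"
  where "HH1 K R W = quotient_module (Der_End K R W) (inner_derivations K R W)"

definition Kodaira_Spencer ::
    "'r set \<Rightarrow> ('r, 'x) ring_scheme \<Rightarrow> ('r, 'w, 'y) module_scheme \<Rightarrow> ('r \<Rightarrow> 'r) \<Rightarrow> ('r \<Rightarrow> 'w \<Rightarrow> 'w) set"
  where "Kodaira_Spencer K R W d =
    inner_derivations K R W +>\<^bsub>Der_End K R W\<^esub> (\<lambda>a\<in>carrier R. \<lambda>w\<in>carrier W. d a \<odot>\<^bsub>W\<^esub> w)"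

definition linear_Lie_Rinehart ::
    "'r set \<Rightarrow> ('r, 'x) ring_scheme \<Rightarrow> ('r, 'w, 'y) module_scheme \<Rightarrow> ('r \<Rightarrow> 'r) set"
  where "linear_Lie_Rinehart K R W = a_kernel (Der K R) (HH1 K R W) (Kodaira_Spencer K R W)"

definition is_connection ::
    "'r set \<Rightarrow> ('r, 'x) ring_scheme \<Rightarrow> ('r, 'w, 'y) module_scheme \<Rightarrow> ('r \<Rightarrow> 'r) set \<Rightarrow>
     (('r \<Rightarrow> 'r) \<Rightarrow> 'w \<Rightarrow> 'w) \<Rightarrow> bool"
  where "is_connection K R W V conn \<longleftrightarrow>
    conn \<in> V \<rightarrow>\<^sub>E carrier (End K R W) \<and>
    (\<forall>d\<in>V. \<forall>e\<in>V. conn (d \<oplus>\<^bsub>Der K R\<^esub> e) = conn d \<oplus>\<^bsub>End K R W\<^esub> conn e) \<and>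
    (\<forall>a\<in>carrier R. \<forall>d\<in>V. conn (a \<odot>\<^bsub>Der K R\<^esub> d) = a \<odot>\<^bsub>End K R W\<^esub> conn d) \<and>
    (\<forall>d\<in>V. \<forall>a\<in>carrier R. \<forall>w\<in>carrier W.
       conn d (a \<odot>\<^bsub>W\<^esub> w) = (a \<odot>\<^bsub>W\<^esub> conn d w) \<oplus>\<^bsub>W\<^esub> (d a \<odot>\<^bsub>W\<^esub> w))"

section \<open>The hypersurface ring\<close>

text \<open>
  \<open>F[[x,y,z]]\<close> is realised as \<open>F[[x]][[y]][[z]]\<close>; the outermost variable is \<open>z\<close>.
\<close>

type_synonym 'a ps3 = "'a fps fps fps"

definition cst :: "'a \<Rightarrow> 'a::field_char_0 ps3"
  where "cst c = fps_const (fps_const (fps_const c))"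

definition vx :: "'a::field_char_0 ps3" where "vx = fps_const (fps_const fps_X)"
definition vy :: "'a::field_char_0 ps3" where "vy = fps_const fps_X"
definition vz :: "'a::field_char_0 ps3" where "vz = fps_X"

definition dx :: "'a::field_char_0 ps3 \<Rightarrow> 'a ps3"
  where "dx p = Abs_fps (\<lambda>i. Abs_fps (\<lambda>j. fps_deriv (fps_nth (fps_nth p i) j)))"

definition dy :: "'a::field_char_0 ps3 \<Rightarrow> 'a ps3"
  where "dy p = Abs_fps (\<lambda>i. fps_deriv (fps_nth p i))"

definition dz :: "'a::field_char_0 ps3 \<Rightarrow> 'a ps3"
  where "dz p = fps_deriv p"

definition hyp_eq :: "nat \<Rightarrow> nat \<Rightarrow> 'a::field_char_0 ps3"
  where "hyp_eq m n = vx ^ m + vy ^ n + vz ^ 2"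

definition hyp_ideal :: "nat \<Rightarrow> nat \<Rightarrow> 'a::field_char_0 ps3 set"
  where "hyp_ideal m n = PIdl\<^bsub>ring_of_type_algebra\<^esub> (hyp_eq m n)"

definition hyp_ring :: "nat \<Rightarrow> nat \<Rightarrow> 'a::field_char_0 ps3 set ring"
  where "hyp_ring m n = ring_of_type_algebra Quot hyp_ideal m n"

definition hyp_class :: "nat \<Rightarrow> nat \<Rightarrow> 'a::field_char_0 ps3 \<Rightarrow> 'a ps3 set"
  where "hyp_class m n p = hyp_ideal m n +>\<^bsub>ring_of_type_algebra\<^esub> p"

definition ground_field :: "nat \<Rightarrow> nat \<Rightarrow> 'a::field_char_0 ps3 set set"
  where "ground_field m n = range (\<lambda>c. hyp_class m n (cst c))"

section \<open>The derivations $\delta_0, \ldots, \delta_3$\<close>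

definition delta_lift :: "nat \<Rightarrow> nat \<Rightarrow> nat \<Rightarrow> 'a::field_char_0 ps3 \<Rightarrow> 'a ps3"
  where "delta_lift m n s p =
    [of_nat (2 * n) * vx * dx p + of_nat (2 * m) * vy * dy p + of_nat (m * n) * vz * dz p,
     of_nat m * vx ^ (m - 1) * dy p - of_nat n * vy ^ (n - 1) * dx p,
     - (2 * vz * dx p) + of_nat m * vx ^ (m - 1) * dz p,
     - (2 * vz * dy p) + of_nat n * vy ^ (n - 1) * dz p] ! s"

text \<open>
  The map induced on the quotient; \<open>the_elem\<close> yields the common class of the images of all
  representatives.
\<close>

definition delta :: "nat \<Rightarrow> nat \<Rightarrow> nat \<Rightarrow> 'a::field_char_0 ps3 set \<Rightarrow> 'a ps3 set"
  where "delta m n s = (\<lambda>a\<in>carrier (hyp_ring m n).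
    the_elem ((\<lambda>p. hyp_class m n (delta_lift m n s p)) ` a))"

section \<open>The matrix factorization and its module\<close>

definition mf_phi :: "nat \<Rightarrow> nat \<Rightarrow> nat \<Rightarrow> nat \<Rightarrow> 'a::field_char_0 ps3 mat"
  where "mf_phi m n k l = mat_of_rows_list 4
    [[vx ^ (m - k), vy ^ (n - l), 0, vz],
     [vy ^ l, - (vx ^ k), vz, 0],
     [vz, 0, - (vy ^ (n - l)), - (vx ^ k)],
     [0, vz, vx ^ (m - k), - (vy ^ l)]]"

definition mf_psi :: "nat \<Rightarrow> nat \<Rightarrow> nat \<Rightarrow> nat \<Rightarrow> 'a::field_char_0 ps3 mat"
  where "mf_psi m n k l = mat_of_rows_list 4
    [[vx ^ k, vy ^ (n - l), vz, 0],
     [vy ^ l, - (vx ^ (m - k)), 0, vz],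
     [0, vz, - (vy ^ l), vx ^ k],
     [vz, 0, - (vx ^ (m - k)), - (vy ^ (n - l))]]"

lemma matrix_factorization:
  fixes m n k l :: nat
  assumes "k \<le> m" "l \<le> n"
  shows "mf_phi m n k l * mf_psi m n k l = hyp_eq m n \<cdot>\<^sub>m (1\<^sub>m 4 :: 'a::field_char_0 ps3 mat)"
    and "mf_psi m n k l * mf_phi m n k l = hyp_eq m n \<cdot>\<^sub>m (1\<^sub>m 4 :: 'a::field_char_0 ps3 mat)"
proof -
  have x: "vx ^ m = (vx ^ k * vx ^ (m - k) :: 'a ps3)" and y: "vy ^ n = (vy ^ l * vy ^ (n - l) :: 'a ps3)"
    using assms by (simp_all flip: power_add)
  have four: "i = 0 \<or> i = 1 \<or> i = 2 \<or> i = 3" if "i < 4" for i :: nat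
    using that by linarith
  have up4: "{0..<4} = {0, 1, 2, 3 :: nat}"
    by auto
  have entries: "(P * Q) $$ (i, j) = (\<Sum>r\<in>{0, 1, 2, 3}. P $$ (i, r) * Q $$ (r, j))"
    if "dim_row P = 4" "dim_col P = 4" "dim_row Q = 4" "dim_col Q = 4" "i < 4" "j < 4"
    for P Q :: "'a ps3 mat" and i j
    using that by (simp add: scalar_prod_def up4)
  have dims: "dim_row (mf_phi m n k l :: 'a ps3 mat) = 4" "dim_col (mf_phi m n k l :: 'a ps3 mat) = 4"
    "dim_row (mf_psi m n k l :: 'a ps3 mat) = 4" "dim_col (mf_psi m n k l :: 'a ps3 mat) = 4"
    by (simp_all add: mf_phi_def mf_psi_def mat_of_rows_list_def)
  show "mf_phi m n k l * mf_psi m n k l = hyp_eq m n \<cdot>\<^sub>m (1\<^sub>m 4 :: 'a ps3 mat)"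
  proof (rule eq_matI)
    fix i j
    assume "i < dim_row (hyp_eq m n \<cdot>\<^sub>m (1\<^sub>m 4 :: 'a ps3 mat))"
      and "j < dim_col (hyp_eq m n \<cdot>\<^sub>m (1\<^sub>m 4 :: 'a ps3 mat))"
    then have ij: "i < 4" "j < 4" by simp_all
    show "(mf_phi m n k l * mf_psi m n k l) $$ (i, j) = (hyp_eq m n \<cdot>\<^sub>m (1\<^sub>m 4 :: 'a ps3 mat)) $$ (i, j)"
      unfolding entries[OF dims ij] using four[OF ij(1)] four[OF ij(2)]
      by (elim disjE) (simp_all add: mf_phi_def mf_psi_def mat_of_rows_list_def hyp_eq_def x y
        power2_eq_square mult.commute)
  qed (simp_all add: dims)
  show "mf_psi m n k l * mf_phi m n k l = hyp_eq m n \<cdot>\<^sub>m (1\<^sub>m 4 :: 'a ps3 mat)"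
  proof (rule eq_matI)
    fix i j
    assume "i < dim_row (hyp_eq m n \<cdot>\<^sub>m (1\<^sub>m 4 :: 'a ps3 mat))"
      and "j < dim_col (hyp_eq m n \<cdot>\<^sub>m (1\<^sub>m 4 :: 'a ps3 mat))"
    then have ij: "i < 4" "j < 4" by simp_all
    show "(mf_psi m n k l * mf_phi m n k l) $$ (i, j) = (hyp_eq m n \<cdot>\<^sub>m (1\<^sub>m 4 :: 'a ps3 mat)) $$ (i, j)"
      unfolding entries[OF dims(3,4,1,2) ij] using four[OF ij(1)] four[OF ij(2)]
      by (elim disjE) (simp_all add: mf_phi_def mf_psi_def mat_of_rows_list_def hyp_eq_def x y
        power2_eq_square mult.commute)
  qed (simp_all add: dims)
qed

definition mf_submodule :: "nat \<Rightarrow> nat \<Rightarrow> nat \<Rightarrow> nat \<Rightarrow> 'a::field_char_0 ps3 set vec set"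
  where "mf_submodule m n k l =
    mat_image (hyp_ring m n) (map_mat (hyp_class m n) (mf_phi m n k l))"

definition mf_module :: "nat \<Rightarrow> nat \<Rightarrow> nat \<Rightarrow> nat \<Rightarrow> ('a::field_char_0 ps3 set, 'a ps3 set vec set) module"
  where "mf_module m n k l =
    quotient_module (free_module (hyp_ring m n) 4) (mf_submodule m n k l)"

section \<open>The matrices $A_0, \ldots, A_3$\<close>

text \<open>
  All entries of \<open>A_0, \<dots>, A_3\<close> are of the form \<open>c x^i y^j\<close> with \<open>c\<close> in \<open>F\<close> and integers \<open>i, j\<close>,
  recorded as \<open>(c, i, j)\<close>.  For \<open>k = m\<close> or \<open>l = n\<close> exponents \<open>-1\<close> occur, and the entry is an element
  of the ring only if its coefficient vanishes; \<open>no_pole\<close> expresses this.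
\<close>

type_synonym 'a laurent_term = "'a \<times> int \<times> int"

fun no_pole :: "'a::field_char_0 laurent_term \<Rightarrow> bool"
  where "no_pole (c, i, j) \<longleftrightarrow> c = 0 \<or> (0 \<le> i \<and> 0 \<le> j)"

fun series_of_term :: "'a::field_char_0 laurent_term \<Rightarrow> 'a ps3"
  where "series_of_term (c, i, j) = cst c * vx ^ nat i * vy ^ nat j"

definition conn_terms :: "nat \<Rightarrow> nat \<Rightarrow> nat \<Rightarrow> nat \<Rightarrow> nat \<Rightarrow> 'a::field_char_0 laurent_term mat"
  where "conn_terms m n k l s = (let
      mn = of_nat (m * n) :: 'a; nk = of_nat (n * k) :: 'a; ml = of_nat (m * l) :: 'a;
      N = of_nat n :: 'a; M = of_nat m :: 'a;
      p = int k - 1; p' = int m - int k - 1;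
      q = int l - 1; q' = int n - int l - 1;
      u = (0, 0, 0);
      b1 = (1/4 * (mn - 2 * nk - 2 * ml), p, q);
      b2 = (1/4 * (3 * mn - 2 * ml - 2 * nk), p', q');
      b3 = (1/4 * (2 * nk - mn - 2 * ml), p', q);
      b4 = (1/4 * (2 * nk - 2 * ml + mn), p, q');
      c1 = (1/N * (1/2 * mn - ml - nk), p, 0);
      c2 = (1/N * (3/2 * mn - ml - nk), p', 0);
      c3 = (1/N * (1/2 * mn + ml - nk), p', 0);
      c4 = (1/N * (ml - nk - 1/2 * mn), p, 0);
      d1 = (1/M * (1/2 * mn - ml - nk), 0, q);
      d2 = (1/M * (ml + nk - 3/2 * mn), 0, q');
      d3 = (1/M * (1/2 * mn + ml - nk), 0, q);
      d4 = (1/M * (1/2 * mn - ml + nk), 0, q')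
    in mat_of_rows_list 4 (
      [[[(nk + ml - 1/2 * mn, 0, 0), u, u, u],
        [u, (3/2 * mn - ml - nk, 0, 0), u, u],
        [u, u, (1/2 * mn + ml - nk, 0, 0), u],
        [u, u, u, (1/2 * mn + nk - ml, 0, 0)]],
       [[u, b2, u, u],
        [b1, u, u, u],
        [u, u, u, b4],
        [u, u, b3, u]],
       [[u, u, c3, u],
        [u, u, u, c4],
        [c1, u, u, u],
        [u, c2, u, u]],
       [[u, u, u, d4],
        [u, u, d3, u],
        [u, d2, u, u],
        [d1, u, u, u]]] ! s))"

definition conn_matrix :: "nat \<Rightarrow> nat \<Rightarrow> nat \<Rightarrow> nat \<Rightarrow> nat \<Rightarrow> 'a::field_char_0 ps3 set mat"
  where "conn_matrix m n k l s =
    map_mat (\<lambda>t. hyp_class m n (series_of_term t)) (conn_terms m n k l s)"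

definition conn_entries_regular :: "'a::field_char_0 itself \<Rightarrow> nat \<Rightarrow> nat \<Rightarrow> nat \<Rightarrow> nat \<Rightarrow> bool"
  where "conn_entries_regular _ m n k l \<longleftrightarrow>
    (\<forall>s<4. \<forall>i<4. \<forall>j<4. no_pole (conn_terms m n k l s $$ (i, j) :: 'a laurent_term))"

text \<open>In particular the condition is vacuous for \<open>k < m\<close> and \<open>l < n\<close>.\<close>

lemma conn_entries_regular_iff:
  fixes m n k l :: nat
  assumes "1 \<le> k" "k \<le> m" "1 \<le> l" "l \<le> n"
  shows "conn_entries_regular TYPE('a::field_char_0) m n k l \<longleftrightarrow>
    (k < m \<or> n = 2 * l) \<and> (l < n \<or> m = 2 * k)"
proof -
  have less4: "(\<forall>i<4. P i) \<longleftrightarrow> P 0 \<and> P 1 \<and> P 2 \<and> P 3" for P :: "nat \<Rightarrow> bool"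
  proof -
    have "{..<4} = {0, 1, 2, 3 :: nat}"
      by auto
    then have "(\<forall>i\<in>{..<4}. P i) \<longleftrightarrow> P 0 \<and> P 1 \<and> P 2 \<and> P 3"
      by simp
    then show ?thesis
      unfolding Ball_def lessThan_iff .
  qed
  have pos: "(of_nat m :: 'a) \<noteq> 0" "(of_nat n :: 'a) \<noteq> 0"
    using assms by simp_all
  have half_l: "of_nat n = (2 * of_nat l :: 'a) \<longleftrightarrow> n = 2 * l"
    using of_nat_eq_iff[of n "2 * l", where 'a = 'a] by simp
  have half_k: "of_nat m = (2 * of_nat k :: 'a) \<longleftrightarrow> m = 2 * k"
    using of_nat_eq_iff[of m "2 * k", where 'a = 'a] by simp
  show ?thesis
  proof (cases "k = m"; cases "l = n")
    assume kl: "k = m" "l = n"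
    have "\<not> no_pole (conn_terms m n k l 1 $$ (0, 1) :: 'a laurent_term)"
      using kl pos by (simp add: conn_terms_def Let_def mat_of_rows_list_def algebra_simps)
    then have "\<not> conn_entries_regular TYPE('a) m n k l"
      unfolding conn_entries_regular_def by (metis one_less_numeral_iff semiring_norm(76) zero_less_numeral)
    then show ?thesis
      using kl assms by auto
  next
    show ?thesis if "k = m" "l \<noteq> n"
    proof
      assume "conn_entries_regular TYPE('a) m n k l"
      then have "no_pole (conn_terms m n k l 2 $$ (3, 1) :: 'a laurent_term)"
        unfolding conn_entries_regular_def by simp
      then have "3/2 * (of_nat m * of_nat n) - of_nat m * of_nat l - of_nat n * of_nat m = (0::'a)"
        using that pos by (simp add: conn_terms_def Let_def mat_of_rows_list_def)
      then have "of_nat m * (of_nat n - 2 * of_nat l) = (0::'a)"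
        by (auto simp: field_simps)
      then have "n = 2 * l"
        using pos half_l by simp
      then show "(k < m \<or> n = 2 * l) \<and> (l < n \<or> m = 2 * k)"
        using that assms by simp
    next
      assume "(k < m \<or> n = 2 * l) \<and> (l < n \<or> m = 2 * k)"
      then have "n = 2 * l"
        using that by simp
      then show "conn_entries_regular TYPE('a) m n k l"
        using that assms
        by (auto simp: conn_entries_regular_def less4 conn_terms_def Let_def mat_of_rows_list_def
          algebra_simps)
    qed
  next
    show ?thesis if "k \<noteq> m" "l = n"
    proof
      assume "conn_entries_regular TYPE('a) m n k l"
      then have "no_pole (conn_terms m n k l 3 $$ (2, 1) :: 'a laurent_term)"
        unfolding conn_entries_regular_def by simp
      then have "of_nat m * of_nat n + of_nat n * of_nat k - 3/2 * (of_nat m * of_nat n) = (0::'a)"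
        using that pos by (simp add: conn_terms_def Let_def mat_of_rows_list_def)
      then have "of_nat n * (of_nat m - 2 * of_nat k) = (0::'a)"
        by (auto simp: field_simps)
      then have "m = 2 * k"
        using pos half_k by simp
      then show "(k < m \<or> n = 2 * l) \<and> (l < n \<or> m = 2 * k)"
        using that assms by simp
    next
      assume "(k < m \<or> n = 2 * l) \<and> (l < n \<or> m = 2 * k)"
      then have "m = 2 * k"
        using that by simp
      then show "conn_entries_regular TYPE('a) m n k l"
        using that assms
        by (auto simp: conn_entries_regular_def less4 conn_terms_def Let_def mat_of_rows_list_def
          algebra_simps)
    qed
  next
    show ?thesis if "k \<noteq> m" "l \<noteq> n"
      using that assms
      by (auto simp: conn_entries_regular_def less4 conn_terms_def Let_def mat_of_rows_list_def)
  qed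
qed

end

theory Submission
  imports Defs
begin

text \<open>
  Write \<open>P = F[[x,y,z]]\<close>.  Since \<open>\<phi>\<psi> = f\<close>, the submodule \<open>f P^4\<close> lies in \<open>\<phi> P^4\<close>, hence
  \<open>W = A^4/\<phi> A^4\<close> is also \<open>P^4/\<phi> P^4\<close>.  The whole argument takes place over \<open>P\<close>, where the relevant
  identities hold exactly and not only modulo \<open>f\<close>; it has four parts.

  \<^bold>\<open>Derivations.\<close>  A derivation of \<open>A\<close> that kills the constants and \<open>x, y, z\<close> is zero: peeling off
  one coefficient after the other shows that its values on \<open>F[[x]]\<close> are divisible by all powers of
  \<open>x\<close>, hence zero, and the variables \<open>y\<close> and \<open>z\<close> are then added in the same way (\<open>derivation_mod_eq_0\<close>).  So a derivation is known from
  lifts \<open>a, b, c\<close> of its values on \<open>x, y, z\<close>, which satisfy \<open>f_x a + f_y b + f_z c = f h\<close>.  The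
  Euler relation \<open>\<delta>_0 f = 2mn f\<close> allows one to subtract a multiple of \<open>\<delta>_0\<close> so that the right-hand
  side becomes \<open>0\<close>, and exactness of the Koszul complex of the regular sequence
  \<open>x^(m-1), y^(n-1), z\<close> writes what remains as a combination of \<open>\<delta>_1, \<delta>_2, \<delta>_3\<close>
  (\<open>derivation_mod_hyp_eq\<close>).  The same two ingredients show that the relations between the \<open>\<delta>_s\<close>
  are generated by the Koszul relation \<open>f_z \<delta>_1 - f_y \<delta>_2 + f_x \<delta>_3 = 0\<close> and the three relations
  that express \<open>f_x \<delta>_0, f_y \<delta>_0, f_z \<delta>_0\<close> modulo \<open>f\<close> by the other fields (\<open>delta_comb_syzygy\<close>).

  \<^bold>\<open>The operators descend.\<close>  For each \<open>s\<close> there is a matrix \<open>C\<close> with \<open>\<delta>_s(\<phi>) + A_s \<phi> = \<phi> C\<close>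
  (\<open>connection_compatible\<close>).  Then \<open>(\<delta>_s + A_s)(\<phi> u) = \<phi> (C u + \<delta>_s u)\<close>, so \<open>\<delta>_s + A_s\<close> acts
  on \<open>W\<close>.

  \<^bold>\<open>Linearity in the derivation.\<close>  If \<open>\<Sum> c_s \<delta>_s = 0\<close> on \<open>A\<close>, the operator
  \<open>\<Sum> c_s (\<delta>_s + A_s)\<close> must vanish on \<open>W\<close>.  It suffices to look at the four generating relations,
  and for each of them \<open>\<Sum> c_s A_s\<close> is \<open>\<phi>\<close> times a matrix (\<open>syzygies_im\<close>).  Hence
  \<open>\<Sum> c_s \<delta>_s \<mapsto> \<Sum> c_s (\<delta>_s + A_s)\<close> is a well-defined connection on all of \<open>Der_F(A)\<close>
  (\<open>mf_connection_is_connection\<close>), and the only one with the prescribed values, because the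
  \<open>\<delta>_s\<close> generate (\<open>mf_connection_unique\<close>).

  \<^bold>\<open>The domain.\<close>  If an endomorphism \<open>h\<close> of \<open>W\<close> satisfies the Leibniz rule for \<open>d\<close>, then
  \<open>a \<mapsto> h a - a h\<close> is the derivation that represents the Kodaira-Spencer class of \<open>d\<close>; so that
  class is zero (\<open>Kodaira_Spencer_eq_zero\<close>).  The connection provides such an \<open>h\<close> for every \<open>d\<close>,
  which gives \<open>V_W = Der_F(A)\<close>.

  All matrix identities become transparent in terms of the halves \<open>a, b, g, e\<close> of the diagonal entries
  of \<open>A_0\<close>: one has \<open>nk = a + e\<close>, \<open>ml = a + g\<close>, \<open>n(m-k) = b + g\<close>, \<open>m(n-l) = b + e\<close> and
  \<open>a + b = g + e = mn/2\<close>, and every entry of \<open>A_1\<close>, \<open>n A_2\<close>, \<open>m A_3\<close> is, up to a factor \<open>1, -1, 2, -2\<close>,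
  one of these numbers times a monomial.
\<close>

section \<open>Constants and variables\<close>

lemma cst_simps [simp]:
  "cst (a + b) = (cst a + cst b :: 'a::field_char_0 ps3)"
  "cst (a - b) = (cst a - cst b :: 'a ps3)"
  "cst (- a) = (- cst a :: 'a ps3)"
  "cst (a * b) = (cst a * cst b :: 'a ps3)"
  "cst 0 = (0 :: 'a ps3)" "cst 1 = (1 :: 'a ps3)"
  by (simp_all add: cst_def)

lemma cst_of_nat [simp]: "cst (of_nat n) = (of_nat n :: 'a::field_char_0 ps3)"
  by (induction n) simp_all

lemma cst_numeral [simp]: "cst (numeral n) = (numeral n :: 'a::field_char_0 ps3)"
  using cst_of_nat[of "numeral n"] by simp

lemma cst_inverse: "x \<noteq> 0 \<Longrightarrow> cst x * cst (inverse x) = (1 :: 'a::field_char_0 ps3)"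
  by (simp flip: cst_simps(4))

lemma cst_cancel: "i \<noteq> 0 \<Longrightarrow> of_nat i * cst (c / of_nat i) = (cst c :: 'a::field_char_0 ps3)"
  by (simp flip: cst_of_nat cst_simps(4))

lemma of_nat_inverse_ps3:
  assumes "0 < k"
  obtains c :: "'a::field_char_0 ps3" where "of_nat k * c = 1"
proof
  have "cst (of_nat k) * cst (inverse (of_nat k)) = (1 :: 'a ps3)"
    using assms by (intro cst_inverse) simp
  then show "of_nat k * cst (inverse (of_nat k)) = (1 :: 'a ps3)"
    by simp
qed

lemma variables_nonzero [simp]: "(vx :: 'a::field_char_0 ps3) \<noteq> 0" "(vy :: 'a ps3) \<noteq> 0" "(vz
    :: 'a ps3) \<noteq> 0"
  by (simp_all add: vx_def vy_def vz_def)

section \<open>Adic completeness and derivations\<close>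

text \<open>
  The equations \<open>B i = \<beta> i + v * B (Suc i)\<close> say that \<open>B i\<close> is the \<open>v\<close>-adic series
  \<open>\<Sum>j. v ^ j * \<beta> (i + j)\<close>.  Existence of a solution is completeness, its uniqueness is separatedness.
  In this form the property passes from coefficients to power series without any mention of
  limits or topologies.
\<close>

definition adically_complete :: "'r::comm_ring_1 \<Rightarrow> bool"
  where "adically_complete v \<longleftrightarrow> (\<forall>\<beta>. \<exists>!B. \<forall>i. B i = \<beta> i + v * B (Suc i))"

lemma adically_complete_fps_X: "adically_complete (fps_X :: 'r::comm_ring_1 fps)"
  unfolding adically_complete_def
proof (intro allI ex1I)
  fix \<beta> :: "nat \<Rightarrow> 'r fps" and i
  let ?B = "\<lambda>i. Abs_fps (\<lambda>n. \<Sum>j\<le>n. fps_nth (\<beta> (i + j)) (n - j))"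
  show "?B i = \<beta> i + fps_X * ?B (Suc i)"
  proof (rule fps_ext)
    fix n show "fps_nth (?B i) n = fps_nth (\<beta> i + fps_X * ?B (Suc i)) n"
      by (cases n) (simp_all add: sum.atMost_Suc_shift del: sum.atMost_Suc)
  qed
next
  fix \<beta> B :: "nat \<Rightarrow> 'r fps"
  let ?B = "\<lambda>i. Abs_fps (\<lambda>n. \<Sum>j\<le>n. fps_nth (\<beta> (i + j)) (n - j))"
  assume B: "\<forall>i. B i = \<beta> i + fps_X * B (Suc i)"
  have "fps_nth (B i) n = fps_nth (?B i) n" for n i
  proof (induction n arbitrary: i)
    case 0
    have "fps_nth (B i) 0 = fps_nth (\<beta> i + fps_X * B (Suc i)) 0" using B by metis
    then show ?case by simp
  next
    case (Suc n)
    have "fps_nth (B i) (Suc n) = fps_nth (\<beta> i + fps_X * B (Suc i)) (Suc n)" using B by metis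
    also have "\<dots> = fps_nth (?B i) (Suc n)"
      using Suc.IH[of "Suc i"] by (simp add: sum.atMost_Suc_shift del: sum.atMost_Suc)
    finally show ?case .
  qed
  then show "B = ?B" by (intro ext fps_ext)
qed

lemma adically_complete_unique:
  assumes "adically_complete v"
    and B: "\<And>i. B i = \<beta> i + v * B (Suc i)" and C: "\<And>i. C i = \<beta> i + v * C (Suc i)"
  shows "B = C"
proof -
  have "\<exists>!B. \<forall>i. B i = \<beta> i + v * B (Suc i)"
    using assms(1) unfolding adically_complete_def by (rule spec)
  note eq = the1_equality[OF this]
  have "(THE B. \<forall>i. B i = \<beta> i + v * B (Suc i)) = B"
    by (rule eq, rule allI, rule B)
  moreover have "(THE B. \<forall>i. B i = \<beta> i + v * B (Suc i)) = C"
    by (rule eq, rule allI, rule C)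
  ultimately show ?thesis by simp
qed

text \<open>
  The equations split into one system for each coefficient.
\<close>

lemma adically_complete_fps_const:
  assumes complete: "adically_complete v"
  shows "adically_complete (fps_const v)"
  unfolding adically_complete_def
proof (intro allI)
  fix \<beta> :: "nat \<Rightarrow> 'a fps"
  have "\<exists>C. \<forall>i. C i = fps_nth (\<beta> i) n + v * C (Suc i)" for n
    by (rule ex1_implies_ex, rule spec[OF complete[unfolded adically_complete_def]])
  then obtain C where C: "\<And>n i. C n i = fps_nth (\<beta> i) n + v * C n (Suc i)"
    by metis
  show "\<exists>!B. \<forall>i. B i = \<beta> i + fps_const v * B (Suc i)"
  proof (rule ex1I, rule allI)
    show "Abs_fps (\<lambda>n. C n i) = \<beta> i + fps_const v * Abs_fps (\<lambda>n. C n (Suc i))" for i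
    proof (rule fps_ext)
      show "fps_nth (Abs_fps (\<lambda>n. C n i)) n
          = fps_nth (\<beta> i + fps_const v * Abs_fps (\<lambda>n. C n (Suc i))) n" for n
        using C[of n i] by simp
    qed
    fix B assume B: "\<forall>i. B i = \<beta> i + fps_const v * B (Suc i)"
    have coeff: "fps_nth (B i) n = fps_nth (\<beta> i) n + v * fps_nth (B (Suc i)) n" for i n
      using arg_cong[OF spec[OF B, of i], of "\<lambda>p. fps_nth p n"] by simp
    have "(\<lambda>i. fps_nth (B i) n) = C n" for n
      by (rule adically_complete_unique[where \<beta> = "\<lambda>i. fps_nth (\<beta> i) n", OF complete])
        (rule coeff, rule C)
    then have "fps_nth (B i) n = C n i" for i n
      by (rule fun_cong)
    then show "B = (\<lambda>i. Abs_fps (\<lambda>n. C n i))"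
      by (simp add: fun_eq_iff fps_eq_iff)
  qed
qed

text \<open>
  Principal ideals are closed.  The quotients of \<open>a i - v * a (Suc i)\<close> by \<open>f\<close> form a series whose
  \<open>v\<close>-adic sum, multiplied by \<open>f\<close>, solves the same equations as \<open>a\<close>.  In other words,
  an element of the quotient by \<open>f\<close> that can be divided by \<open>v\<close> again and again is zero.
\<close>

lemma adically_complete_dvd:
  assumes complete: "adically_complete v" and "\<And>i. f dvd a i - v * a (Suc i)"
  shows "f dvd a 0"
proof -
  from assms(2) have "\<forall>i. \<exists>c. a i - v * a (Suc i) = f * c"
    by (simp add: dvd_def)
  then obtain \<beta> where \<beta>: "\<And>i. a i - v * a (Suc i) = f * \<beta> i"
    by metis
  have "\<exists>B. \<forall>i. B i = \<beta> i + v * B (Suc i)"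
    by (rule ex1_implies_ex, rule spec[OF complete[unfolded adically_complete_def]])
  then obtain B where B: "\<And>i. B i = \<beta> i + v * B (Suc i)"
    by blast
  have "a = (\<lambda>i. f * B i)"
  proof (rule adically_complete_unique[where \<beta> = "\<lambda>i. f * \<beta> i", OF complete])
    show "a i = f * \<beta> i + v * a (Suc i)" for i
      using \<beta>[of i] by (simp add: algebra_simps)
    show "f * B i = f * \<beta> i + v * (f * B (Suc i))" for i
      by (subst B) (simp add: algebra_simps)
  qed
  then have "a 0 = f * B 0"
    by (rule fun_cong)
  then show ?thesis by simp
qed

lemma adically_complete_variables:
  "adically_complete (vx :: 'a::field_char_0 ps3)"
  "adically_complete (vy :: 'a::field_char_0 ps3)"
  "adically_complete (vz :: 'a::field_char_0 ps3)"
  unfolding vx_def vy_def vz_def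
  by (intro adically_complete_fps_const adically_complete_fps_X)+

text \<open>
  Modulo \<open>f\<close>, the value at \<open>p\<close> is \<open>v\<close> times the value at the shifted series, and so on for ever.
\<close>

lemma dvd_fps_map_from_coeffs:
  fixes D :: "'r::comm_ring_1 fps \<Rightarrow> 's::comm_ring_1"
  assumes complete: "adically_complete v"
    and add: "\<And>p q. f dvd D (p + q) - (D p + D q)"
    and shift: "\<And>p. f dvd D (fps_X * p) - v * D p"
    and const: "\<And>c. f dvd D (fps_const c)"
  shows "f dvd D p"
proof -
  have "f dvd D (fps_shift i p) - v * D (fps_shift (Suc i) p)" for i
  proof -
    have split: "fps_shift i p = fps_const (fps_nth p i) + fps_X * fps_shift (Suc i) p"
      by (rule fps_ext) (simp add: fps_X_mult_nth)
    have "D (fps_shift i p) - v * D (fps_shift (Suc i) p) =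
        (D (fps_shift i p) - (D (fps_const (fps_nth p i)) + D (fps_X * fps_shift (Suc i) p)))
        + D (fps_const (fps_nth p i))
        + (D (fps_X * fps_shift (Suc i) p) - v * D (fps_shift (Suc i) p))"
      by simp
    moreover have "f dvd \<dots>"
      using add[of "fps_const (fps_nth p i)" "fps_X * fps_shift (Suc i) p", folded split]
      by (intro dvd_add const shift)
    ultimately show ?thesis by simp
  qed
  from adically_complete_dvd[OF complete, of f "\<lambda>i. D (fps_shift i p)", OF this]
  show ?thesis by simp
qed

text \<open>
  A lift to power series of a derivation of the quotient by \<open>f\<close>; the defining laws hold only up to
  multiples of \<open>f\<close>, since the lift is chosen value by value.
\<close>

definition derivation_mod :: "'a::field_char_0 ps3 \<Rightarrow> ('a ps3 \<Rightarrow> 'a ps3) \<Rightarrow> bool"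
  where "derivation_mod f D \<longleftrightarrow>
    (\<forall>p q. f dvd D (p + q) - (D p + D q)) \<and>
    (\<forall>p q. f dvd D (p * q) - (p * D q + q * D p)) \<and>
    (\<forall>c. f dvd D (cst c))"

text \<open>
  The one-variable step shows in turn that \<open>D\<close> vanishes modulo \<open>f\<close> on \<open>F[[x]]\<close>, on \<open>F[[x]][[y]]\<close>,
  and on \<open>F[[x]][[y]][[z]]\<close>: each time the constant terms are covered by the previous case.
\<close>

lemma derivation_mod_eq_0:
  fixes f :: "'a::field_char_0 ps3"
  assumes "derivation_mod f D" and "f dvd D vx" "f dvd D vy" "f dvd D vz"
  shows "f dvd D p"
proof -
  have add: "f dvd D (p + q) - (D p + D q)" and cst: "f dvd D (cst c)"
    and mult: "f dvd D (p * q) - (p * D q + q * D p)" for p q c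
    using assms(1) by (auto simp: derivation_mod_def)
  have shift: "f dvd D (v * q) - v * D q" if "f dvd D v" for v q
  proof -
    have "D (v * q) - v * D q = (D (v * q) - (v * D q + q * D v)) + q * D v"
      by simp
    with mult[of v q] that show ?thesis
      by (metis dvd_add dvd_mult)
  qed
  have x: "f dvd D (fps_const (fps_const p))" for p
  proof (rule dvd_fps_map_from_coeffs[where v = vx and D = "\<lambda>p. D (fps_const (fps_const p))"])
    show "f dvd D (fps_const (fps_const (p + q)))
        - (D (fps_const (fps_const p)) + D (fps_const (fps_const q)))" for p q
      using add[of "fps_const (fps_const p)" "fps_const (fps_const q)"] by simp
    show "f dvd D (fps_const (fps_const (fps_X * p))) - vx * D (fps_const (fps_const p))" for p
      using shift[OF assms(2), of "fps_const (fps_const p)"] by (simp add: vx_def)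
    show "f dvd D (fps_const (fps_const (fps_const c)))" for c
      using cst[of c] by (simp add: cst_def)
  qed (rule adically_complete_variables)
  have y: "f dvd D (fps_const p)" for p
  proof (rule dvd_fps_map_from_coeffs[where v = vy and D = "\<lambda>p. D (fps_const p)"])
    show "f dvd D (fps_const (p + q)) - (D (fps_const p) + D (fps_const q))" for p q
      using add[of "fps_const p" "fps_const q"] by simp
    show "f dvd D (fps_const (fps_X * p)) - vy * D (fps_const p)" for p
      using shift[OF assms(3), of "fps_const p"] by (simp add: vy_def)
  qed (rule adically_complete_variables x)+
  show ?thesis
    by (rule dvd_fps_map_from_coeffs[where v = vz])
      (use add y shift[OF assms(4)] adically_complete_variables in \<open>simp_all add: vz_def\<close>)
qed

section \<open>Partial derivatives\<close>

lemma partial_add: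
  "dx (p + q) = dx p + dx q" "dy (p + q) = dy p + dy q" "dz (p + q) = dz p + dz q"
  by (simp_all add: dx_def dy_def dz_def fps_eq_iff)

text \<open>
  The derivatives in the inner variables act on the coefficients of the outer ones.
\<close>

lemma coefficientwise_derivation:
  assumes "\<And>a b. d (a + b) = d a + d b"
    and "d 0 = 0" and "\<And>a b. d (a * b) = a * d b + b * (d a :: 'r::comm_ring_1)"
  shows "Abs_fps (\<lambda>i. d (fps_nth (p * q) i)) =
    p * Abs_fps (\<lambda>i. d (fps_nth q i)) + q * Abs_fps (\<lambda>i. d (fps_nth p i))"
proof (rule fps_ext)
  fix n
  have dsum: "d (sum g S) = (\<Sum>i\<in>S. d (g i))" if "finite S" for g and S :: "nat set"
    using that by (induction S) (simp_all add: assms)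
  have "fps_nth (q * Abs_fps (\<lambda>i. d (fps_nth p i))) n =
      (\<Sum>i=0..n. fps_nth q (n - i) * d (fps_nth p i))"
    by (subst mult.commute, simp add: fps_mult_nth, simp add: mult.commute)
  then show "fps_nth (Abs_fps (\<lambda>i. d (fps_nth (p * q) i))) n =
      fps_nth (p * Abs_fps (\<lambda>i. d (fps_nth q i)) + q * Abs_fps (\<lambda>i. d (fps_nth p i))) n"
    by (simp add: fps_mult_nth dsum assms(3) sum.distrib)
qed

lemma partial_mult:
  "dx (p * q) = p * dx q + q * dx p" "dy (p * q) = p * dy q + q * dy p"
  "dz (p * q) = p * dz q + q * dz p"
proof -
  have deriv: "fps_deriv (a * b) = a * fps_deriv b + b * fps_deriv a" for a b
      :: "'b::field_char_0 fps"
    by (simp add: algebra_simps)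
  have deriv2: "fps_deriv (a * b) = a * fps_deriv b + b * fps_deriv a" for a b :: "'a fps fps"
    by (simp add: algebra_simps)
  show "dz (p * q) = p * dz q + q * dz p"
    by (simp add: dz_def algebra_simps)
  show "dy (p * q) = p * dy q + q * dy p"
    unfolding dy_def by (rule coefficientwise_derivation) (simp_all add: deriv2)
  have inner: "Abs_fps (\<lambda>j. fps_deriv (fps_nth (a * b) j)) =
      a * Abs_fps (\<lambda>j. fps_deriv (fps_nth b j)) + b * Abs_fps (\<lambda>j. fps_deriv (fps_nth a j))"
    for a b :: "'a fps fps"
    by (rule coefficientwise_derivation) (simp_all add: deriv)
  show "dx (p * q) = p * dx q + q * dx p"
    unfolding dx_def
    by (rule coefficientwise_derivation[where d = "\<lambda>a. Abs_fps (\<lambda>j. fps_deriv (fps_nth a j))"])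
      (simp_all add: inner fps_eq_iff)
qed

lemma partial_variables [simp]:
  "dx vx = 1" "dx vy = 0" "dx vz = 0"
  "dy vx = 0" "dy vy = 1" "dy vz = 0"
  "dz vx = 0" "dz vy = 0" "dz vz = 1"
  "dx (cst c) = 0" "dy (cst c) = 0" "dz (cst c) = 0"
  by (auto simp: dx_def dy_def dz_def vx_def vy_def vz_def cst_def fps_eq_iff fps_X_def)

lemma derivation_power:
  fixes d :: "'r::comm_ring_1 \<Rightarrow> 'r"
  assumes "\<And>a b. d (a * b) = a * d b + b * d a"
  shows "d (a ^ k) = of_nat k * a ^ (k - 1) * d a"
proof (induction k)
  case 0
  show ?case using assms[of 1 1] by simp
next
  case (Suc k)
  have "of_nat k * a ^ k = a * (of_nat k * a ^ (k - 1))"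
    by (cases k) (simp_all add: algebra_simps)
  with Suc show ?case by (simp add: assms algebra_simps)
qed

lemma partial_power:
  "dx (vx ^ i) = of_nat i * vx ^ (i - 1)" "dy (vx ^ i) = 0" "dz (vx ^ i) = 0"
  "dx (vy ^ i) = 0" "dy (vy ^ i) = of_nat i * vy ^ (i - 1)" "dz (vy ^ i) = 0"
  by (simp_all add: derivation_power[of dx, OF partial_mult(1)]
    derivation_power[of dy, OF partial_mult(2)] derivation_power[of dz, OF partial_mult(3)])

lemma partial_uminus: "dx (- p) = - dx p" "dy (- p) = - dy p" "dz (- p) = - dz p"
  by (simp_all add: dx_def dy_def dz_def fps_eq_iff)

lemma partial_zero: "dx 0 = 0" "dy 0 = 0" "dz 0 = 0"
  by (simp_all add: dx_def dy_def dz_def fps_eq_iff)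

lemma euler_power: "vx * (of_nat i * vx ^ (i - 1)) = of_nat i * (vx ^ i :: 'a::field_char_0 ps3)"
  "vy * (of_nat i * vy ^ (i - 1)) = of_nat i * (vy ^ i :: 'a ps3)"
  by (cases i; simp add: algebra_simps)+

section \<open>Koszul relations\<close>

text \<open>
  \<open>x^i\<close> is a nonzero divisor modulo \<open>y^j\<close>, so \<open>y^j\<close> divides \<open>a\<close>.
\<close>

lemma koszul_two:
  fixes a b :: "'a::field_char_0 fps fps"
  assumes "fps_const fps_X ^ i * a + fps_X ^ j * b = 0"
  obtains s where "a = - (fps_X ^ j * s)" "b = fps_const fps_X ^ i * s"
proof -
  have eq: "fps_const (fps_X ^ i) * a = - (fps_X ^ j * b)"
    using assms by (simp add: eq_neg_iff_add_eq_0 fps_const_power)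
  have "fps_X ^ i * fps_nth a n = 0" if "n < j" for n
  proof -
    have "fps_nth (fps_const (fps_X ^ i) * a) n = 0"
      unfolding eq using that by (simp add: fps_X_power_mult_nth)
    then show ?thesis by simp
  qed
  then have low: "fps_nth a n = 0" if "n < j" for n
    using that by (metis mult_eq_0_iff fps_X_neq_zero power_not_zero)
  define s where "s = - fps_shift j a"
  have a: "a = - (fps_X ^ j * s)"
    by (rule fps_ext) (simp add: s_def fps_X_power_mult_nth low)
  moreover have "fps_X ^ j * (fps_const fps_X ^ i * s) = fps_X ^ j * b"
    using assms unfolding a by (simp add: algebra_simps eq_neg_iff_add_eq_0)
  then have "b = fps_const fps_X ^ i * s"
    by (metis mult_left_cancel fps_X_neq_zero power_not_zero)
  ultimately show ?thesis by (rule that)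
qed

text \<open>
  Exactness in the middle of the Koszul complex of \<open>x^i, y^j, z\<close>: reduce modulo \<open>z\<close>, use the
  case of two elements, and cancel \<open>z\<close> from the remainder.
\<close>

lemma koszul_three:
  fixes a b c :: "'a::field_char_0 ps3"
  assumes "vx ^ i * a + vy ^ j * b + vz * c = 0"
  obtains s t r where "a = - (vy ^ j * s) - vz * t" "b = vx ^ i * s - vz * r"
    "c = vx ^ i * t + vy ^ j * r"
proof -
  have split: "u = fps_const (fps_nth u 0) + vz * fps_shift 1 u" for u :: "'a ps3"
    by (rule fps_ext) (simp add: vz_def fps_X_mult_nth)
  define a0 b0 a1 b1 where "a0 = fps_nth a 0" "b0 = fps_nth b 0" "a1 = fps_shift 1 a" "b1 =
      fps_shift 1 b"
  have "fps_nth (vx ^ i * a + vy ^ j * b + vz * c) 0 = 0"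
    using assms by simp
  then have "fps_const fps_X ^ i * a0 + fps_X ^ j * b0 = 0"
    by (simp add: a0_b0_a1_b1_def vx_def vy_def vz_def fps_const_power)
  then obtain s where s: "a0 = - (fps_X ^ j * s)" "b0 = fps_const fps_X ^ i * s"
    by (rule koszul_two)
  have a: "a = - (vy ^ j * fps_const s) - vz * (- a1)"
    by (subst split[of a], fold a0_b0_a1_b1_def) (simp add: s vy_def fps_const_power
        flip: fps_const_neg fps_const_mult)
  have b: "b = vx ^ i * fps_const s - vz * (- b1)"
    by (subst split[of b], fold a0_b0_a1_b1_def) (simp add: s vx_def fps_const_power
        flip: fps_const_mult)
  have "vz * (vx ^ i * a1 + vy ^ j * b1 + c) = vx ^ i * a + vy ^ j * b + vz * c"
    unfolding a b by (simp add: algebra_simps)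
  then have "vx ^ i * a1 + vy ^ j * b1 + c = 0"
    using assms by (simp add: vz_def)
  moreover have "c = (vx ^ i * a1 + vy ^ j * b1 + c) + (vx ^ i * (- a1) + vy ^ j * (- b1))"
    by simp
  ultimately have "c = vx ^ i * (- a1) + vy ^ j * (- b1)"
    by simp
  with a b show ?thesis by (rule that)
qed

lemma vz_dvd_cancel_vy_power:
  fixes b :: "'a::field_char_0 ps3"
  assumes "vz * a = vy ^ j * b"
  obtains t where "b = vz * t"
proof -
  have "fps_nth (vy ^ j * b) 0 = 0"
    by (simp add: vz_def flip: assms)
  then have "fps_nth b 0 = 0"
    by (simp add: vy_def fps_const_power)
  then have "b = vz * fps_shift 1 b"
    by (intro fps_ext) (simp add: vz_def)
  then show ?thesis by (rule that)
qed

section \<open>Vector fields tangent to the hypersurface\<close>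

definition delta_comb :: "nat \<Rightarrow> nat \<Rightarrow> (nat \<Rightarrow> 'a::field_char_0 ps3) \<Rightarrow> 'a ps3 \<Rightarrow> 'a ps3"
  where "delta_comb m n c p = (\<Sum>s<4. c s * delta_lift m n s p)"

lemma sum_less_4: "(\<Sum>s<4. g s) = g 0 + g 1 + g 2 + g (3::nat)" for g :: "nat \<Rightarrow> 'b::comm_monoid_add"
  by (simp add: eval_nat_numeral add.assoc)

lemma less_4_cases: "s < 4 \<Longrightarrow> s = 0 \<or> s = 1 \<or> s = 2 \<or> s = (3::nat)"
  by linarith

lemma delta_comb_eq:
  "delta_comb m n c p =
    (of_nat (2 * n) * vx * c 0 - of_nat n * vy ^ (n - 1) * c 1 - 2 * vz * c 2) * dx p +
    (of_nat (2 * m) * vy * c 0 + of_nat m * vx ^ (m - 1) * c 1 - 2 * vz * c 3) * dy p +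
    (of_nat (m * n) * vz * c 0 + of_nat m * vx ^ (m - 1) * c 2 + of_nat n * vy ^ (n - 1) * c 3) *
        dz p"
  unfolding delta_comb_def sum_less_4 delta_lift_def
  by (simp add: algebra_simps)

lemma delta_comb_add: "delta_comb m n c (p + q) = delta_comb m n c p + delta_comb m n c q"
  by (simp add: delta_comb_eq partial_add algebra_simps)

lemma delta_comb_mult: "delta_comb m n c (p * q) = p * delta_comb m n c q + q * delta_comb m n c p"
  by (simp add: delta_comb_eq partial_mult algebra_simps)

lemma delta_comb_cst [simp]: "delta_comb m n c (cst a) = 0"
  by (simp add: delta_comb_eq)

lemma delta_comb_0 [simp]: "delta_comb m n c 0 = 0"
  using delta_comb_cst[of m n c 0] by simp

lemma delta_comb_diff: "delta_comb m n c (p - q) = delta_comb m n c p - delta_comb m n c q"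
  using delta_comb_add[of m n c "p - q" q] by simp

lemma power_pred: "0 < k \<Longrightarrow> (a::'b::comm_ring_1) ^ k = a * a ^ (k - 1)"
  by (cases k) simp_all

text \<open>
  Only \<open>\<delta>_0\<close> moves the equation: it is the Euler field, with eigenvalue \<open>2mn\<close>, whereas the other three
  fields are Koszul relations between the partial derivatives.
\<close>

lemma delta_comb_hyp_eq:
  assumes "0 < m" "0 < n"
  shows "delta_comb m n c (hyp_eq m n :: 'a::field_char_0 ps3) = hyp_eq m n * (of_nat (2 * m * n)
      * c 0)"
proof -
  have partials: "dx (hyp_eq m n :: 'a ps3) = of_nat m * vx ^ (m - 1)" "dy (hyp_eq m n :: 'a ps3)
      = of_nat n * vy ^ (n - 1)"
    "dz (hyp_eq m n :: 'a ps3) = 2 * vz"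
    unfolding hyp_eq_def partial_add
    by (simp_all add: partial_power derivation_power[of dx, OF partial_mult(1)]
      derivation_power[of dy, OF partial_mult(2)] derivation_power[of dz, OF partial_mult(3)])
  show ?thesis
    using power_pred[OF assms(1), of "vx :: 'a ps3"] power_pred[OF assms(2), of "vy :: 'a ps3"]
    unfolding delta_comb_eq partials by (simp add: hyp_eq_def algebra_simps power2_eq_square)
qed

lemma delta_comb_respects:
  assumes "0 < m" "0 < n" and "hyp_eq m n dvd p - q"
  shows "hyp_eq m n dvd delta_comb m n c p - delta_comb m n c q"
proof -
  obtain h where h: "p - q = hyp_eq m n * h" using assms(3) by (rule dvdE)
  show ?thesis
    unfolding delta_comb_diff[symmetric] h delta_comb_mult delta_comb_hyp_eq[OF assms(1,2)]
    by simp
qed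

lemma derivation_mod_power:
  assumes "derivation_mod f D"
  shows "f dvd D (p ^ k) - of_nat k * p ^ (k - 1) * D p"
proof (induction k)
  case 0
  show ?case using assms by (simp add: derivation_mod_def flip: cst_simps(6))
next
  case (Suc k)
  have pow: "of_nat k * p ^ k = p * (of_nat k * p ^ (k - 1))"
    by (cases k) (simp_all add: algebra_simps)
  have "f dvd D (p * p ^ k) - (p * D (p ^ k) + p ^ k * D p)"
    using assms by (simp add: derivation_mod_def)
  moreover have "f dvd p * (D (p ^ k) - of_nat k * p ^ (k - 1) * D p)"
    using Suc by simp
  ultimately have "f dvd (D (p * p ^ k) - (p * D (p ^ k) + p ^ k * D p))
      + p * (D (p ^ k) - of_nat k * p ^ (k - 1) * D p)"
    by (rule dvd_add)
  also have "\<dots> = D (p ^ Suc k) - of_nat (Suc k) * p ^ (Suc k - 1) * D p"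
    using pow by (simp add: algebra_simps)
  finally show ?case .
qed

text \<open>
  Generation of the derivations by \<open>\<delta>_0, \<dots>, \<delta>_3\<close>, at the level of lifts.
\<close>

lemma derivation_mod_hyp_eq:
  fixes D :: "'a::field_char_0 ps3 \<Rightarrow> 'a ps3"
  assumes "0 < m" "0 < n" and D: "derivation_mod (hyp_eq m n) D"
    and D0: "hyp_eq m n dvd D (hyp_eq m n)"
  obtains c where "\<And>p. hyp_eq m n dvd D p - delta_comb m n c p"
proof -
  let ?f = "hyp_eq m n :: 'a ps3"
  define a b e where abe: "a = D vx" "b = D vy" "e = D vz"
  have add: "?f dvd D (p + q) - (D p + D q)" for p q
    using D by (simp add: derivation_mod_def)
  note pow = derivation_mod_power[OF D]
  let ?G = "of_nat m * vx ^ (m - 1) * a + of_nat n * vy ^ (n - 1) * b + 2 * vz * e"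
  have G: "?G = D ?f - (D ?f - (D (vx ^ m + vy ^ n) + D (vz ^ 2)))
      - (D (vx ^ m + vy ^ n) - (D (vx ^ m) + D (vy ^ n)))
      - (D (vx ^ m) - of_nat m * vx ^ (m - 1) * a)
      - (D (vy ^ n) - of_nat n * vy ^ (n - 1) * b)
      - (D (vz ^ 2) - of_nat 2 * vz ^ (2 - 1) * e)"
    by simp
  have "?f dvd ?G"
    unfolding G unfolding abe
    by (rule dvd_diff[OF dvd_diff[OF dvd_diff[OF dvd_diff[OF dvd_diff[OF D0
      add[of "vx ^ m + vy ^ n" "vz ^ 2", folded hyp_eq_def]] add] pow] pow] pow])
  then obtain h where h: "?G = ?f * h" by (rule dvdE)
  obtain M N H :: "'a ps3" where inv: "of_nat m * M = 1" "of_nat n * N = 1" "2 * H = 1"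
    using of_nat_inverse_ps3[OF assms(1)] of_nat_inverse_ps3[OF assms(2)] of_nat_inverse_ps3[of 2]
    by (metis of_nat_numeral zero_less_numeral)
  \<comment> \<open>\<open>H, M, N\<close> invert \<open>2, m, n\<close>, so \<open>\<kappa>\<close> is \<open>h\<close> divided by \<open>2mn\<close>, the coefficient of \<open>\<delta>_0\<close>.\<close>
  define \<kappa> where "\<kappa> = H * M * N * h"
  have \<kappa>: "2 * (of_nat m * (of_nat n * \<kappa>)) = h"
  proof -
    have "2 * (of_nat m * (of_nat n * \<kappa>)) = (2 * H) * (of_nat m * M) * (of_nat n * N) * h"
      by (simp add: \<kappa>_def algebra_simps)
    then show ?thesis by (simp add: inv)
  qed
  \<comment> \<open>Subtracting \<open>\<kappa> \<delta>_0\<close>, and scaling so that the coefficients of the relation become pure powers.\<close>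
  define a' where "a' = of_nat m * (a - of_nat (2 * n) * vx * \<kappa>)"
  define b' where "b' = of_nat n * (b - of_nat (2 * m) * vy * \<kappa>)"
  define e' where "e' = 2 * (e - of_nat (m * n) * vz * \<kappa>)"
  have "vx ^ (m - 1) * a' + vy ^ (n - 1) * b' + vz * e' =
      ?G - 2 * (of_nat m * (of_nat n * \<kappa>)) * ?f"
    using power_pred[OF assms(1), of "vx :: 'a ps3"] power_pred[OF assms(2), of "vy :: 'a ps3"]
    by (simp add: a'_def b'_def e'_def hyp_eq_def algebra_simps power2_eq_square)
  also have "\<dots> = 0"
    unfolding h \<kappa> by simp
  finally obtain s t r where str: "a' = - (vy ^ (n - 1) * s) - vz * t"
    "b' = vx ^ (m - 1) * s - vz * r" "e' = vx ^ (m - 1) * t + vy ^ (n - 1) * r"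
    by (rule koszul_three)
  define c where "c = (\<lambda>i::nat. [\<kappa>, M * N * s, H * M * t, H * N * r] ! i)"
  have c: "c 0 = \<kappa>" "c 1 = M * N * s" "c 2 = H * M * t" "c 3 = H * N * r"
    by (simp_all add: c_def)
  have inv': "M * (of_nat m * u) = u" "N * (of_nat n * u) = u" "H * (2 * u) = u" for u
    using inv by (metis mult.assoc mult.commute mult_1_left)+
  have cancel: "u * y * (U * V * s) = V * (y * s)" "u * y * (V * U * s) = V * (y * s)"
    if "u * U = 1" for u U V y s :: "'a ps3"
  proof -
    have "u * y * (U * V * s) = (u * U) * (V * (y * s))" "u * y * (V * U * s) = (u * U) * (V * (y
        * s))"
      by (simp_all only: ac_simps)
    then show "u * y * (U * V * s) = V * (y * s)" "u * y * (V * U * s) = V * (y * s)"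
      by (simp_all only: that mult_1_left)
  qed
  have "a = of_nat (2 * n) * vx * \<kappa> + M * a'"
    unfolding a'_def inv'(1) by simp
  also have "\<dots> = delta_comb m n c vx"
    unfolding delta_comb_eq c str partial_variables
    by (simp only: cancel[OF inv(1)] cancel[OF inv(2)] cancel[OF inv(3)]) (simp add: algebra_simps)
  finally have 1: "D vx - delta_comb m n c vx = 0"
    by (simp add: abe)
  have "b = of_nat (2 * m) * vy * \<kappa> + N * b'"
    unfolding b'_def inv'(2) by simp
  also have "\<dots> = delta_comb m n c vy"
    unfolding delta_comb_eq c str partial_variables
    by (simp only: cancel[OF inv(1)] cancel[OF inv(2)] cancel[OF inv(3)]) (simp add: algebra_simps)
  finally have 2: "D vy - delta_comb m n c vy = 0"
    by (simp add: abe)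
  have "e = of_nat (m * n) * vz * \<kappa> + H * e'"
    unfolding e'_def inv'(3) by simp
  also have "\<dots> = delta_comb m n c vz"
    unfolding delta_comb_eq c str partial_variables
    by (simp only: cancel[OF inv(1)] cancel[OF inv(2)] cancel[OF inv(3)]) (simp add: algebra_simps)
  finally have 3: "D vz - delta_comb m n c vz = 0"
    by (simp add: abe)
  have "derivation_mod ?f (\<lambda>p. D p - delta_comb m n c p)"
    unfolding derivation_mod_def
  proof (intro conjI allI)
    fix p q c'
    have "D (p + q) - delta_comb m n c (p + q) - (D p - delta_comb m n c p + (D q - delta_comb m
        n c q))
        = D (p + q) - (D p + D q)"
      by (simp add: delta_comb_add)
    then show "?f dvd D (p + q) - delta_comb m n c (p + q)
        - (D p - delta_comb m n c p + (D q - delta_comb m n c q))"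
      by (simp only: add)
    have "D (p * q) - delta_comb m n c (p * q)
        - (p * (D q - delta_comb m n c q) + q * (D p - delta_comb m n c p))
        = D (p * q) - (p * D q + q * D p)"
      by (simp add: delta_comb_mult algebra_simps)
    then show "?f dvd D (p * q) - delta_comb m n c (p * q)
        - (p * (D q - delta_comb m n c q) + q * (D p - delta_comb m n c p))"
      using D by (simp only: derivation_mod_def)
    show "?f dvd D (cst c') - delta_comb m n c (cst c')"
      using D by (simp add: derivation_mod_def)
  qed
  from derivation_mod_eq_0[OF this] show ?thesis
    using 1 2 3 by (intro that) simp
qed

text \<open>
  The right-hand sides are the general combination, with coefficients \<open>u, v, w, t\<close>, of the three
  relations for \<open>f_x \<delta>_0\<close>, \<open>f_y \<delta>_0\<close>, \<open>f_z \<delta>_0\<close> and of the Koszul relation.  If the field with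
  coefficients \<open>c\<close> has values \<open>f U, f V, f W\<close> on the variables, then applying it to \<open>f\<close> gives
  \<open>2mn c_0 = f_x U + f_y V + f_z W\<close>.  So the first three relations with coefficients
  \<open>U, V, W\<close> divided by \<open>2mn\<close> account for \<open>c_0\<close> and reduce to \<open>c_0 = 0\<close> and values exactly \<open>0\<close>.
  Then \<open>z\<close> divides \<open>c_1\<close>, and the rest follows by cancellation.
\<close>

lemma delta_comb_syzygy:
  fixes c :: "nat \<Rightarrow> 'a::field_char_0 ps3"
  assumes "0 < m" "0 < n" and dvd: "\<And>p. hyp_eq m n dvd delta_comb m n c p"
  obtains u v w t where
    "c 0 = of_nat m * vx ^ (m - 1) * u + of_nat n * vy ^ (n - 1) * v + 2 * vz * w"
    "c 1 = - (of_nat (2 * m) * vy * u) + of_nat (2 * n) * vx * v + 2 * vz * t"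
    "c 2 = - (of_nat (m * n) * vz * u) + of_nat (2 * n) * vx * w - of_nat n * vy ^ (n - 1) * t"
    "c 3 = - (of_nat (m * n) * vz * v) + of_nat (2 * m) * vy * w + of_nat m * vx ^ (m - 1) * t"
proof -
  let ?f = "hyp_eq m n :: 'a ps3"
  define fx fy :: "'a ps3" where f: "fx = of_nat m * vx ^ (m - 1)" "fy = of_nat n * vy ^ (n - 1)"
  define K where "K = (of_nat (2 * m * n) :: 'a ps3)"
  obtain k where k: "K * k = 1"
    using of_nat_inverse_ps3[of "2 * m * n"] assms(1,2) by (auto simp: K_def)
  obtain U V W where UVW: "delta_comb m n c vx = ?f * U" "delta_comb m n c vy = ?f * V"
    "delta_comb m n c vz = ?f * W"
    using dvd by (meson dvdE)
  define u v w where uvw: "u = k * U" "v = k * V" "w = k * W"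
  have K: "K * u = U" "K * v = V" "K * w = W"
    using k by (simp_all add: uvw flip: mult.assoc)
  have X: "of_nat (2 * n) * vx * c 0 - fy * c 1 - 2 * vz * c 2 = ?f * (K * u)"
    and Y: "of_nat (2 * m) * vy * c 0 + fx * c 1 - 2 * vz * c 3 = ?f * (K * v)"
    and Z: "of_nat (m * n) * vz * c 0 + fx * c 2 + fy * c 3 = ?f * (K * w)"
    using UVW unfolding K by (simp_all add: delta_comb_eq f)
  have Kf: "K * ?f = of_nat (2 * n) * vx * fx + of_nat (2 * m) * vy * fy + of_nat (m * n) * vz *
      (2 * vz)"
    using power_pred[OF assms(1), of "vx :: 'a ps3"] power_pred[OF assms(2), of "vy :: 'a ps3"]
    by (simp add: K_def f hyp_eq_def algebra_simps power2_eq_square)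
  have "(K * ?f) * c 0 = (K * ?f) * (fx * u + fy * v + 2 * vz * w)"
  proof -
    have "(K * ?f) * c 0 = fx * (of_nat (2 * n) * vx * c 0 - fy * c 1 - 2 * vz * c 2) +
      fy * (of_nat (2 * m) * vy * c 0 + fx * c 1 - 2 * vz * c 3) +
      2 * vz * (of_nat (m * n) * vz * c 0 + fx * c 2 + fy * c 3)"
      unfolding Kf by (simp add: algebra_simps)
    then show ?thesis unfolding X Y Z by (simp add: algebra_simps)
  qed
  moreover have "K * ?f \<noteq> 0"
  proof -
    have "fps_nth (?f) 2 = 1"
      by (simp add: hyp_eq_def vx_def vy_def vz_def fps_const_power fps_X_power_iff)
    then show ?thesis using assms(1,2) by (auto simp: K_def)
  qed
  ultimately have c0: "c 0 = fx * u + fy * v + 2 * vz * w"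
    by simp
  \<comment> \<open>What remains of \<open>c\<close> after removing the three relations that involve \<open>\<delta>_0\<close>.\<close>
  define c1 where "c1 = c 1 + of_nat (2 * m) * vy * u - of_nat (2 * n) * vx * v"
  define c2 where "c2 = c 2 + of_nat (m * n) * vz * u - of_nat (2 * n) * vx * w"
  define c3 where "c3 = c 3 + of_nat (m * n) * vz * v - of_nat (2 * m) * vy * w"
  have "fy * c1 + 2 * vz * c2 = (K * ?f) * u - ?f * (K * u)"
    unfolding X[symmetric] Kf c1_def c2_def c0 by (simp add: algebra_simps)
  then have r1: "2 * vz * c2 = - (fy * c1)"
    by (simp add: algebra_simps eq_neg_iff_add_eq_0)
  have "2 * vz * c3 - fx * c1 = (K * ?f) * v - ?f * (K * v)"
    unfolding Y[symmetric] Kf c1_def c3_def c0 by (simp add: algebra_simps)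
  then have r2: "2 * vz * c3 = fx * c1"
    by (simp add: algebra_simps)
  obtain N H :: "'a ps3" where NH: "of_nat n * N = 1" "2 * H = 1"
    using of_nat_inverse_ps3[OF assms(2)] of_nat_inverse_ps3[of 2]
    by (metis of_nat_numeral zero_less_numeral)
  have "vz * (- (N * (2 * c2))) = - (N * (2 * vz * c2))"
    by (simp add: algebra_simps)
  also have "\<dots> = (of_nat n * N) * (vy ^ (n - 1) * c1)"
    unfolding r1 by (simp add: f algebra_simps)
  finally have "vz * (- (N * (2 * c2))) = vy ^ (n - 1) * c1"
    by (simp add: NH)
  then obtain t' where t': "c1 = vz * t'" by (rule vz_dvd_cancel_vy_power)
  define t where "t = H * t'"
  have t: "c1 = 2 * vz * t"
  proof -
    have "2 * vz * t = (2 * H) * (vz * t')" by (simp add: t_def algebra_simps)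
    then show ?thesis by (simp add: NH t')
  qed
  have "2 * vz * c2 = 2 * vz * (- (fy * t))" "2 * vz * c3 = 2 * vz * (fx * t)"
    unfolding r1 r2 t by (simp_all add: algebra_simps)
  moreover have "2 * vz \<noteq> (0 :: 'a ps3)"
    by simp
  ultimately have "c2 = - (fy * t)" "c3 = fx * t"
    by (metis mult_left_cancel)+
  with t c0 show ?thesis
    by (intro that[of u v w t]) (simp_all add: c1_def c2_def c3_def f algebra_simps)
qed

section \<open>Endomorphisms and the Kodaira-Spencer class\<close>

context module
begin

lemma End_restrict_closed:
  assumes "\<And>w. w \<in> carrier M \<Longrightarrow> h w \<in> carrier M"
    and "\<And>v w. v \<in> carrier M \<Longrightarrow> w \<in> carrier M \<Longrightarrow> h (v \<oplus>\<^bsub>M\<^esub> w) = h v \<oplus>\<^bsub>M\<^esub> h w"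
    and "\<And>c w. c \<in> K \<Longrightarrow> w \<in> carrier M \<Longrightarrow> h (c \<odot>\<^bsub>M\<^esub> w) = c \<odot>\<^bsub>M\<^esub> h w"
    and "K \<subseteq> carrier R"
  shows "(\<lambda>w\<in>carrier M. h w) \<in> carrier (End K R M)"
  using assms by (auto simp: End_def subset_eq)

lemma End_apply_closed: "h \<in> carrier (End K R M) \<Longrightarrow> w \<in> carrier M \<Longrightarrow> h w \<in> carrier M"
  and End_apply_add: "h \<in> carrier (End K R M) \<Longrightarrow> v \<in> carrier M \<Longrightarrow> w \<in> carrier M \<Longrightarrow>
    h (v \<oplus>\<^bsub>M\<^esub> w) = h v \<oplus>\<^bsub>M\<^esub> h w"
  and End_apply_smult: "h \<in> carrier (End K R M) \<Longrightarrow> c \<in> K \<Longrightarrow> w \<in> carrier M \<Longrightarrow>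
    h (c \<odot>\<^bsub>M\<^esub> w) = c \<odot>\<^bsub>M\<^esub> h w"
  by (auto simp: End_def)

lemma smult_left_commute:
  "a \<in> carrier R \<Longrightarrow> b \<in> carrier R \<Longrightarrow> w \<in> carrier M \<Longrightarrow>
    a \<odot>\<^bsub>M\<^esub> (b \<odot>\<^bsub>M\<^esub> w) = b \<odot>\<^bsub>M\<^esub> (a \<odot>\<^bsub>M\<^esub> w)"
  by (simp add: R.m_comm flip: smult_assoc1)

context
  fixes K assumes K: "K \<subseteq> carrier R"
begin

lemma End_add_closed:
  assumes g: "g \<in> carrier (End K R M)" and h: "h \<in> carrier (End K R M)"
  shows "g \<oplus>\<^bsub>End K R M\<^esub> h \<in> carrier (End K R M)"
proof -
  have "(\<lambda>w\<in>carrier M. g w \<oplus>\<^bsub>M\<^esub> h w) \<in> carrier (End K R M)"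
    using K End_apply_closed[OF g] End_apply_closed[OF h]
    by (intro End_restrict_closed)
      (simp_all add: End_apply_add[OF g] End_apply_add[OF h] End_apply_smult[OF g]
        End_apply_smult[OF h] M.a_ac smult_r_distr subsetD)
  then show ?thesis by (simp add: End_def)
qed

lemma End_smult_closed:
  assumes a: "a \<in> carrier R" and h: "h \<in> carrier (End K R M)"
  shows "a \<odot>\<^bsub>End K R M\<^esub> h \<in> carrier (End K R M)"
proof -
  have "(\<lambda>w\<in>carrier M. a \<odot>\<^bsub>M\<^esub> h w) \<in> carrier (End K R M)"
  proof (rule End_restrict_closed[OF _ _ _ K])
    show "a \<odot>\<^bsub>M\<^esub> h (c \<odot>\<^bsub>M\<^esub> w) = c \<odot>\<^bsub>M\<^esub> (a \<odot>\<^bsub>M\<^esub> h w)" if "c \<in> K" "w \<in> carrier M" for c w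
      using that K a End_apply_closed[OF h]
      by (simp add: End_apply_smult[OF h] smult_left_commute[of a c] subsetD)
  qed (use a End_apply_closed[OF h] in \<open>simp_all add: End_apply_add[OF h] smult_r_distr\<close>)
  then show ?thesis by (simp add: End_def)
qed

lemma End_right_closed:
  assumes a: "a \<in> carrier R" and h: "h \<in> carrier (End K R M)"
  shows "End_right M h a \<in> carrier (End K R M)"
  unfolding End_right_def
proof (rule End_restrict_closed[OF _ _ _ K])
  show "h (a \<odot>\<^bsub>M\<^esub> (c \<odot>\<^bsub>M\<^esub> w)) = c \<odot>\<^bsub>M\<^esub> h (a \<odot>\<^bsub>M\<^esub> w)" if "c \<in> K" "w \<in> carrier M" for c w
    using that K a by (simp add: End_apply_smult[OF h] smult_left_commute[of a c] subsetD)
qed (use a in \<open>simp_all add: End_apply_closed[OF h] End_apply_add[OF h] smult_r_distr\<close>)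

lemma End_uminus_closed:
  assumes h: "h \<in> carrier (End K R M)"
  shows "(\<lambda>w\<in>carrier M. \<ominus>\<^bsub>M\<^esub> h w) \<in> carrier (End K R M)"
  using K End_apply_closed[OF h]
  by (intro End_restrict_closed)
    (simp_all add: End_apply_add[OF h] End_apply_smult[OF h] smult_r_minus M.minus_add subsetD)

lemma End_abelian_group: "abelian_group (End K R M)"
proof (rule abelian_groupI)
  fix g h i
  assume g: "g \<in> carrier (End K R M)" and h: "h \<in> carrier (End K R M)"
    and i: "i \<in> carrier (End K R M)"
  note cl = End_apply_closed[OF g] End_apply_closed[OF h] End_apply_closed[OF i]
  show "g \<oplus>\<^bsub>End K R M\<^esub> h \<in> carrier (End K R M)"
    by (rule End_add_closed[OF g h])
  show "g \<oplus>\<^bsub>End K R M\<^esub> h \<oplus>\<^bsub>End K R M\<^esub> i = g \<oplus>\<^bsub>End K R M\<^esub> (h \<oplus>\<^bsub>End K R M\<^esub> i)"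
    using cl by (simp add: End_def M.a_assoc cong: restrict_cong)
  show "g \<oplus>\<^bsub>End K R M\<^esub> h = h \<oplus>\<^bsub>End K R M\<^esub> g"
    using cl by (simp add: End_def M.a_comm cong: restrict_cong)
next
  show "\<zero>\<^bsub>End K R M\<^esub> \<in> carrier (End K R M)"
    using End_restrict_closed[of "\<lambda>w. \<zero>\<^bsub>M\<^esub>" K] K by (simp add: End_def subsetD)
next
  fix h assume h: "h \<in> carrier (End K R M)"
  have ext: "h \<in> extensional (carrier M)"
    using h by (simp add: End_def PiE_def)
  show "\<zero>\<^bsub>End K R M\<^esub> \<oplus>\<^bsub>End K R M\<^esub> h = h"
    using End_apply_closed[OF h] ext
    by (simp add: End_def extensional_restrict cong: restrict_cong)
  show "\<exists>g\<in>carrier (End K R M). g \<oplus>\<^bsub>End K R M\<^esub> h = \<zero>\<^bsub>End K R M\<^esub>"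
  proof
    show "(\<lambda>w\<in>carrier M. \<ominus>\<^bsub>M\<^esub> h w) \<oplus>\<^bsub>End K R M\<^esub> h = \<zero>\<^bsub>End K R M\<^esub>"
      using End_apply_closed[OF h] by (simp add: End_def M.l_neg cong: restrict_cong)
  qed (rule End_uminus_closed[OF h])
qed

lemma End_minus_apply:
  assumes g: "g \<in> carrier (End K R M)" and h: "h \<in> carrier (End K R M)"
  shows "g \<ominus>\<^bsub>End K R M\<^esub> h = (\<lambda>w\<in>carrier M. g w \<ominus>\<^bsub>M\<^esub> h w)"
proof -
  interpret E: abelian_group "End K R M"
    by (rule End_abelian_group)
  have "(\<lambda>w\<in>carrier M. \<ominus>\<^bsub>M\<^esub> h w) \<oplus>\<^bsub>End K R M\<^esub> h = \<zero>\<^bsub>End K R M\<^esub>"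
    using End_apply_closed[OF h] by (simp add: End_def M.l_neg cong: restrict_cong)
  then have "\<ominus>\<^bsub>End K R M\<^esub> h = (\<lambda>w\<in>carrier M. \<ominus>\<^bsub>M\<^esub> h w)"
    by (rule E.minus_equality[OF _ h End_uminus_closed[OF h]])
  then show ?thesis
    by (simp add: a_minus_def End_def cong: restrict_cong)
qed

lemma inner_derivations_eq:
  "inner_derivations K R M =
    {(\<lambda>a\<in>carrier R. \<lambda>w\<in>carrier M. h (a \<odot>\<^bsub>M\<^esub> w) \<ominus>\<^bsub>M\<^esub> a \<odot>\<^bsub>M\<^esub> h w) | h. h \<in> carrier (End K R M)}"
proof -
  have "(\<lambda>a\<in>carrier R. End_right M h a \<ominus>\<^bsub>End K R M\<^esub> (a \<odot>\<^bsub>End K R M\<^esub> h)) =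
      (\<lambda>a\<in>carrier R. \<lambda>w\<in>carrier M. h (a \<odot>\<^bsub>M\<^esub> w) \<ominus>\<^bsub>M\<^esub> a \<odot>\<^bsub>M\<^esub> h w)"
    if "h \<in> carrier (End K R M)" for h
  proof (rule restrict_ext)
    fix a assume a: "a \<in> carrier R"
    show "End_right M h a \<ominus>\<^bsub>End K R M\<^esub> (a \<odot>\<^bsub>End K R M\<^esub> h) =
        (\<lambda>w\<in>carrier M. h (a \<odot>\<^bsub>M\<^esub> w) \<ominus>\<^bsub>M\<^esub> a \<odot>\<^bsub>M\<^esub> h w)"
      unfolding End_minus_apply[OF End_right_closed[OF a that] End_smult_closed[OF a that]]
      by (rule restrict_ext) (simp add: End_right_def End_def)
  qed
  then show ?thesis
    unfolding inner_derivations_def Setcompr_eq_image by (intro image_cong) simp_all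
qed

text \<open>
  The hypothesis on \<open>h\<close> says that the inner derivation defined by \<open>h\<close> is the representative of the
  class of \<open>d\<close>.  The coset of an element of \<open>inner_derivations\<close> is \<open>inner_derivations\<close> itself,
  because \<open>h \<mapsto> [h, -]\<close> is additive and \<open>End\<close> is a group.
\<close>

lemma Kodaira_Spencer_eq_zero:
  assumes d: "d \<in> carrier R \<rightarrow> carrier R"
    and h: "h \<in> carrier (End K R M)"
    and leibniz: "\<And>a w. a \<in> carrier R \<Longrightarrow> w \<in> carrier M \<Longrightarrow>
      h (a \<odot>\<^bsub>M\<^esub> w) = (a \<odot>\<^bsub>M\<^esub> h w) \<oplus>\<^bsub>M\<^esub> (d a \<odot>\<^bsub>M\<^esub> w)"
  shows "Kodaira_Spencer K R M d = \<zero>\<^bsub>HH1 K R M\<^esub>"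
proof -
  let ?E = "End K R M"
  let ?C = "\<lambda>a\<in>carrier R. \<lambda>w\<in>carrier M. d a \<odot>\<^bsub>M\<^esub> w"
  let ?I = "\<lambda>h. \<lambda>a\<in>carrier R. \<lambda>w\<in>carrier M. h (a \<odot>\<^bsub>M\<^esub> w) \<ominus>\<^bsub>M\<^esub> a \<odot>\<^bsub>M\<^esub> h w"
  have "h (a \<odot>\<^bsub>M\<^esub> w) \<ominus>\<^bsub>M\<^esub> a \<odot>\<^bsub>M\<^esub> h w = d a \<odot>\<^bsub>M\<^esub> w" if "a \<in> carrier R" "w \<in> carrier M" for a w
  proof -
    have "h w \<in> carrier M" "d a \<in> carrier R"
      using End_apply_closed[OF h] d that by auto
    moreover have "(u \<oplus>\<^bsub>M\<^esub> v) \<ominus>\<^bsub>M\<^esub> u = v" if "u \<in> carrier M" "v \<in> carrier M" for u v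
      using that by (simp add: M.a_comm[of u v] a_minus_def M.a_assoc M.r_neg)
    ultimately show ?thesis
      using that by (simp add: leibniz)
  qed
  then have C: "?C = ?I h"
    by (intro restrict_ext) simp
  have add: "?I g \<oplus>\<^bsub>Der_End K R M\<^esub> ?I h = ?I (g \<oplus>\<^bsub>?E\<^esub> h)"
    if g: "g \<in> carrier ?E" and h: "h \<in> carrier ?E" for g h
  proof -
    have "(g v \<ominus>\<^bsub>M\<^esub> a \<odot>\<^bsub>M\<^esub> g w) \<oplus>\<^bsub>M\<^esub> (h v \<ominus>\<^bsub>M\<^esub> a \<odot>\<^bsub>M\<^esub> h w) =
        (g v \<oplus>\<^bsub>M\<^esub> h v) \<ominus>\<^bsub>M\<^esub> a \<odot>\<^bsub>M\<^esub> (g w \<oplus>\<^bsub>M\<^esub> h w)"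
      if "a \<in> carrier R" "v \<in> carrier M" "w \<in> carrier M" for a v w
      using that End_apply_closed[OF g] End_apply_closed[OF h]
      by (simp add: a_minus_def smult_r_distr M.minus_add M.a_ac)
    then show ?thesis
      by (simp add: Der_End_def Let_def End_def cong: restrict_cong)
  qed
  have inner: "inner_derivations K R M = ?I ` carrier ?E"
    unfolding inner_derivations_eq Setcompr_eq_image by simp
  have "inner_derivations K R M +>\<^bsub>Der_End K R M\<^esub> ?I h = (\<lambda>g. ?I (g \<oplus>\<^bsub>?E\<^esub> h)) ` carrier ?E"
    unfolding inner a_r_coset_def' UNION_singleton_eq_range image_image
    by (rule image_cong[OF refl]) (rule add[OF _ h])
  also have "\<dots> = ?I ` ((\<lambda>g. g \<oplus>\<^bsub>?E\<^esub> h) ` carrier ?E)"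
    by (rule image_image[symmetric])
  also have "(\<lambda>g. g \<oplus>\<^bsub>?E\<^esub> h) ` carrier ?E = carrier ?E"
  proof (intro equalityI subsetI)
    interpret E: abelian_group ?E by (rule End_abelian_group)
    fix g assume g: "g \<in> carrier ?E"
    have "g = (g \<ominus>\<^bsub>?E\<^esub> h) \<oplus>\<^bsub>?E\<^esub> h"
      using g h by (simp add: a_minus_def E.a_assoc E.l_neg)
    then show "g \<in> (\<lambda>g. g \<oplus>\<^bsub>?E\<^esub> h) ` carrier ?E"
      using E.minus_closed[OF g h] by (rule image_eqI)
  qed (use End_add_closed[OF _ h] in auto)
  finally have "inner_derivations K R M +>\<^bsub>Der_End K R M\<^esub> ?I h = inner_derivations K R M"
    unfolding inner .
  then show ?thesis
    unfolding Kodaira_Spencer_def C HH1_def by (simp add: quotient_module_def)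
qed

lemma linear_Lie_Rinehart_eq_derivations:
  assumes "\<And>d. d \<in> derivations K R \<Longrightarrow> \<exists>h\<in>carrier (End K R M). \<forall>a\<in>carrier R. \<forall>w\<in>carrier M.
      h (a \<odot>\<^bsub>M\<^esub> w) = (a \<odot>\<^bsub>M\<^esub> h w) \<oplus>\<^bsub>M\<^esub> (d a \<odot>\<^bsub>M\<^esub> w)"
  shows "linear_Lie_Rinehart K R M = derivations K R"
proof -
  have "Kodaira_Spencer K R M d = \<zero>\<^bsub>HH1 K R M\<^esub>" if d: "d \<in> derivations K R" for d
  proof -
    obtain h where "h \<in> carrier (End K R M)" "\<forall>a\<in>carrier R. \<forall>w\<in>carrier M.
        h (a \<odot>\<^bsub>M\<^esub> w) = (a \<odot>\<^bsub>M\<^esub> h w) \<oplus>\<^bsub>M\<^esub> (d a \<odot>\<^bsub>M\<^esub> w)"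
      using assms[OF d] by blast
    moreover have "d \<in> carrier R \<rightarrow> carrier R"
      using d by (auto simp: derivations_def)
    ultimately show ?thesis
      by (intro Kodaira_Spencer_eq_zero) auto
  qed
  then show ?thesis
    by (auto simp: linear_Lie_Rinehart_def a_kernel_def' Der_def)
qed

end

end

section \<open>The hypersurface ring and its free modules\<close>

lemma ring_of_type_algebra_simps [simp]:
  "carrier (ring_of_type_algebra :: 'b::comm_ring_1 ring) = UNIV"
  "x \<oplus>\<^bsub>ring_of_type_algebra\<^esub> y = (x + y :: 'b)"
  "x \<otimes>\<^bsub>ring_of_type_algebra\<^esub> y = (x * y :: 'b)"
  "\<zero>\<^bsub>ring_of_type_algebra\<^esub> = (0 :: 'b)"
  "\<one>\<^bsub>ring_of_type_algebra\<^esub> = (1 :: 'b)"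
  by (simp_all add: ring_of_type_algebra_def)

lemma hyp_ideal_ideal: "ideal (hyp_ideal m n :: 'a::field_char_0 ps3 set) ring_of_type_algebra"
  unfolding hyp_ideal_def
  by (intro cring.cgenideal_ideal cring_from_type_algebra) simp

lemma hyp_class_eq: "hyp_class m n p = {q. hyp_eq m n dvd q - p}"
proof -
  have "q \<in> hyp_class m n p \<longleftrightarrow> hyp_eq m n dvd q - p" for q
  proof
    assume "q \<in> hyp_class m n p"
    then show "hyp_eq m n dvd q - p"
      by (auto simp: hyp_class_def hyp_ideal_def cgenideal_def a_r_coset_def')
  next
    assume "hyp_eq m n dvd q - p"
    then obtain h where "q = h * hyp_eq m n + p"
      by (metis diff_add_cancel dvdE mult.commute)
    then show "q \<in> hyp_class m n p"
      by (auto simp: hyp_class_def hyp_ideal_def cgenideal_def a_r_coset_def')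
  qed
  then show ?thesis by auto
qed

lemma hyp_class_eq_iff: "hyp_class m n p = hyp_class m n q \<longleftrightarrow> hyp_eq m n dvd p - q"
proof
  assume "hyp_class m n p = hyp_class m n q"
  then have "p \<in> hyp_class m n q"
    by (metis (mono_tags) diff_self dvd_0_right hyp_class_eq mem_Collect_eq)
  then show "hyp_eq m n dvd p - q"
    by (simp add: hyp_class_eq)
next
  assume pq: "hyp_eq m n dvd p - q"
  have "hyp_eq m n dvd r - p \<longleftrightarrow> hyp_eq m n dvd r - q" for r
    using dvd_add_left_iff[OF pq, of "r - p"] by simp
  then show "hyp_class m n p = hyp_class m n q"
    by (simp add: hyp_class_eq)
qed

lemma hyp_ring_cring: "cring (hyp_ring m n :: 'a::field_char_0 ps3 set ring)"
  unfolding hyp_ring_def by (intro ideal.quotient_is_cring hyp_ideal_ideal cring_from_type_algebra)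

lemma hyp_ring_carrier: "carrier (hyp_ring m n) = range (hyp_class m n)"
  by (auto simp: hyp_ring_def FactRing_def A_RCOSETS_def' hyp_class_def)

lemma hyp_class_closed [simp]: "hyp_class m n p \<in> carrier (hyp_ring m n)"
  by (simp add: hyp_ring_carrier)

lemma hyp_class_hom: "hyp_class m n \<in> Ring.ring_hom ring_of_type_algebra (hyp_ring m n)"
  using ideal.rcos_ring_hom[OF hyp_ideal_ideal] unfolding hyp_class_def[abs_def] hyp_ring_def .

lemma hyp_class_add [simp]: "hyp_class m n p \<oplus>\<^bsub>hyp_ring m n\<^esub> hyp_class m n q = hyp_class m n (p +
    q)"
  using Ring.ring_hom_add[OF hyp_class_hom[of m n], of p q] by simp

lemma hyp_class_mult [simp]: "hyp_class m n p \<otimes>\<^bsub>hyp_ring m n\<^esub> hyp_class m n q = hyp_class m n (p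
    * q)"
  using Ring.ring_hom_mult[OF hyp_class_hom[of m n], of p q] by simp

lemma hyp_class_one: "\<one>\<^bsub>hyp_ring m n\<^esub> = hyp_class m n 1"
  using Ring.ring_hom_one[OF hyp_class_hom[of m n]] unfolding ring_of_type_algebra_simps by (rule
      sym)

lemma hyp_class_zero: "\<zero>\<^bsub>hyp_ring m n\<^esub> = hyp_class m n 0"
  using Ring.ring_hom_zero[OF hyp_class_hom[of m n] ring_from_type_algebra cring.axioms(1)[OF
      hyp_ring_cring]]
  unfolding ring_of_type_algebra_simps by (rule sym)

lemma hyp_class_finsum:
  fixes g :: "'i \<Rightarrow> 'b::field_char_0 ps3"
  shows
  "finite S \<Longrightarrow> (\<Oplus>\<^bsub>hyp_ring m n\<^esub>i\<in>S. hyp_class m n (g i)) = hyp_class m n (sum g S)"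
proof (induction S rule: finite_induct)
  case empty
  interpret A: cring "hyp_ring m n :: 'b ps3 set ring" by (rule hyp_ring_cring)
  show ?case by (simp add: hyp_class_zero)
next
  case (insert i S)
  interpret A: cring "hyp_ring m n :: 'b ps3 set ring" by (rule hyp_ring_cring)
  show ?case
    using insert by (subst A.finsum_insert) auto
qed

lemma hyp_ring_carrierE:
  assumes "a \<in> carrier (hyp_ring m n)" obtains p where "a = hyp_class m n p"
  using assms by (auto simp: hyp_ring_carrier)

abbreviation vec_class :: "nat \<Rightarrow> nat \<Rightarrow> 'a::field_char_0 ps3 vec \<Rightarrow> 'a ps3 set vec"
  where "vec_class m n \<equiv> map_vec (hyp_class m n)"

lemma free_module_carrier:
  "carrier (free_module (hyp_ring m n) r) = vec_class m n ` carrier_vec r"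
proof (intro Set.set_eqI iffI)
  fix a assume "a \<in> carrier (free_module (hyp_ring m n) r)"
  then have a: "a \<in> carrier_vec r" "\<forall>i<r. \<exists>p. a $ i = hyp_class m n p"
    by (auto simp: free_module_def hyp_ring_carrier)
  then obtain g where g: "\<And>i. i < r \<Longrightarrow> a $ i = hyp_class m n (g i)"
    by metis
  have "a = vec_class m n (vec r g)"
    using a g by (intro eq_vecI) auto
  then show "a \<in> vec_class m n ` carrier_vec r"
    by (metis imageI vec_carrier)
qed (auto simp: free_module_def)

lemma free_module_ops:
  assumes "v \<in> carrier_vec r"
  shows "w \<in> carrier_vec r \<Longrightarrow> vec_class m n v \<oplus>\<^bsub>free_module (hyp_ring m n) r\<^esub> vec_class m n w =
      vec_class m n (v + w)"
    and "hyp_class m n p \<odot>\<^bsub>free_module (hyp_ring m n) r\<^esub> vec_class m n v = vec_class m n (p \<cdot>\<^sub>v v)"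
  using assms by (auto simp: free_module_def intro!: eq_vecI)

lemma mat_apply_class:
  assumes "v \<in> carrier_vec (dim_col B)"
  shows "mat_apply (hyp_ring m n) (map_mat (hyp_class m n) B) (vec_class m n v) = vec_class m n
      (B *\<^sub>v v)"
proof (rule eq_vecI)
  fix i assume "i < dim_vec (vec_class m n (B *\<^sub>v v))"
  then have i: "i < dim_row B" by simp
  interpret A: cring "hyp_ring m n :: 'a ps3 set ring" by (rule hyp_ring_cring)
  have "(\<Oplus>\<^bsub>hyp_ring m n\<^esub>j\<in>{..<dim_col B}. map_mat (hyp_class m n) B $$ (i, j) \<otimes>\<^bsub>hyp_ring m n\<^esub>
      vec_class m n v $ j)
     = (\<Oplus>\<^bsub>hyp_ring m n\<^esub>j\<in>{..<dim_col B}. hyp_class m n (B $$ (i, j) * v $ j))"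
    using i assms by (intro A.finsum_cong') auto
  also have "\<dots> = hyp_class m n ((B *\<^sub>v v) $ i)"
    using i assms by (simp add: hyp_class_finsum scalar_prod_def lessThan_atLeast0)
  finally show "mat_apply (hyp_ring m n) (map_mat (hyp_class m n) B) (vec_class m n v) $ i =
      vec_class m n (B *\<^sub>v v) $ i"
    using i by (simp add: mat_apply_def)
qed (simp add: mat_apply_def)

section \<open>Derivations of the hypersurface ring\<close>

abbreviation unit_coeff :: "nat \<Rightarrow> nat \<Rightarrow> 'a::field_char_0 ps3"
  where "unit_coeff s i \<equiv> of_bool (i = s)"

lemma delta_comb_unit: "s < 4 \<Longrightarrow> delta_comb m n (unit_coeff s) p = delta_lift m n s p"
  unfolding delta_comb_def by (simp add: of_bool_def mult_delta_left)

lemma delta_comb_coeff_add: "delta_comb m n (\<lambda>i. c i + c' i) p = delta_comb m n c p + delta_comb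
    m n c' p"
  unfolding delta_comb_def by (simp add: algebra_simps sum.distrib)

lemma delta_comb_coeff_diff: "delta_comb m n (\<lambda>i. c i - c' i) p = delta_comb m n c p - delta_comb
    m n c' p"
  unfolding delta_comb_def by (simp add: algebra_simps sum_subtractf)

lemma delta_comb_coeff_mult: "delta_comb m n (\<lambda>i. q * c i) p = q * delta_comb m n c p"
  unfolding delta_comb_def by (simp add: sum_distrib_left mult.assoc)

text \<open>
  The derivation of \<open>A\<close> induced by \<open>\<Sum> c_s \<delta>_s\<close>; written in the same way as \<open>delta\<close>.
\<close>

definition delta_class :: "nat \<Rightarrow> nat \<Rightarrow> (nat \<Rightarrow> 'a::field_char_0 ps3) \<Rightarrow> 'a ps3 set \<Rightarrow> 'a ps3 set"
  where "delta_class m n c = (\<lambda>a\<in>carrier (hyp_ring m n). the_elem ((\<lambda>p. hyp_class m n (delta_comb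
      m n c p)) ` a))"

context
  fixes m n :: nat
  assumes m: "0 < m" and n: "0 < n"
begin

lemma delta_class_apply [simp]:
  "delta_class m n c (hyp_class m n p) = hyp_class m n (delta_comb m n c p)"
proof -
  have "hyp_class m n (delta_comb m n c q) = hyp_class m n (delta_comb m n c p)" if "q \<in>
      hyp_class m n p" for q
  proof -
    have "hyp_eq m n dvd q - p"
      using that by (simp add: hyp_class_eq)
    then show ?thesis
      unfolding hyp_class_eq_iff by (rule delta_comb_respects[OF m n])
  qed
  then have "(\<lambda>p. hyp_class m n (delta_comb m n c p)) ` hyp_class m n p =
      (\<lambda>_. hyp_class m n (delta_comb m n c p)) ` hyp_class m n p"
    by (rule image_cong[OF refl])
  also have "\<dots> = {hyp_class m n (delta_comb m n c p)}"
    by (rule image_constant[of p]) (simp add: hyp_class_eq)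
  finally show ?thesis
    by (simp add: delta_class_def)
qed

lemma hyp_ring_map_eqI:
  assumes "f \<in> extensional (carrier (hyp_ring m n))" "g \<in> extensional (carrier (hyp_ring m n))"
    and "\<And>p. f (hyp_class m n p) = g (hyp_class m n p)"
  shows "f = g"
  using assms(1,2) by (rule extensionalityI) (auto elim!: hyp_ring_carrierE simp: assms(3))

lemma delta_class_extensional: "delta_class m n c \<in> extensional (carrier (hyp_ring m n))"
  by (simp add: delta_class_def)

lemma delta_class_eq_iff:
  "delta_class m n c = delta_class m n c' \<longleftrightarrow> (\<forall>p. hyp_eq m n dvd delta_comb m n (\<lambda>i. c i - c' i) p)"
proof
  assume "delta_class m n c = delta_class m n c'"
  then have "delta_class m n c (hyp_class m n p) = delta_class m n c' (hyp_class m n p)" for p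
    by simp
  then show "\<forall>p. hyp_eq m n dvd delta_comb m n (\<lambda>i. c i - c' i) p"
    by (simp add: hyp_class_eq_iff delta_comb_coeff_diff)
next
  assume "\<forall>p. hyp_eq m n dvd delta_comb m n (\<lambda>i. c i - c' i) p"
  then show "delta_class m n c = delta_class m n c'"
    by (intro hyp_ring_map_eqI delta_class_extensional) (simp add: hyp_class_eq_iff
        delta_comb_coeff_diff)
qed

lemma delta_class_cong: "(\<And>s. s < 4 \<Longrightarrow> c s = c' s) \<Longrightarrow> delta_class m n c = delta_class m n c'"
  unfolding delta_class_eq_iff delta_comb_def by simp

lemma delta_eq_delta_class: "s < 4 \<Longrightarrow> delta m n s = delta_class m n (unit_coeff s)"
  unfolding delta_def delta_class_def by (simp add: delta_comb_unit)

lemma ground_field_subset: "ground_field m n \<subseteq> carrier (hyp_ring m n)"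
  by (auto simp: ground_field_def)

lemma delta_class_derivation: "delta_class m n c \<in> derivations (ground_field m n) (hyp_ring m n)"
proof -
  have "delta_class m n c \<in> carrier (hyp_ring m n) \<rightarrow>\<^sub>E carrier (hyp_ring m n)"
    using delta_class_extensional by (auto simp: PiE_def elim!: hyp_ring_carrierE)
  then show ?thesis
    unfolding derivations_def
    by (auto elim!: hyp_ring_carrierE simp: ground_field_def delta_comb_add delta_comb_mult)
qed

text \<open>
  Choose a lift of the derivation value by value; it is a derivation modulo \<open>f\<close>.
\<close>

lemma derivation_eq_delta_class:
  fixes d :: "'a::field_char_0 ps3 set \<Rightarrow> 'a ps3 set"
  assumes d: "d \<in> derivations (ground_field m n) (hyp_ring m n)"
  obtains c where "d = delta_class m n c"
proof -
  let ?A = "hyp_ring m n :: 'a ps3 set ring"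
  interpret A: cring ?A by (rule hyp_ring_cring)
  have ext: "d \<in> extensional (carrier ?A)" and closed: "\<And>a. a \<in> carrier ?A \<Longrightarrow> d a \<in> carrier ?A"
    and add: "\<And>a b. a \<in> carrier ?A \<Longrightarrow> b \<in> carrier ?A \<Longrightarrow> d (a \<oplus>\<^bsub>?A\<^esub> b) = d a \<oplus>\<^bsub>?A\<^esub> d b"
    and lin: "\<And>c a. c \<in> ground_field m n \<Longrightarrow> a \<in> carrier ?A \<Longrightarrow> d (c \<otimes>\<^bsub>?A\<^esub> a) = c \<otimes>\<^bsub>?A\<^esub> d a"
    and leibniz: "\<And>a b. a \<in> carrier ?A \<Longrightarrow> b \<in> carrier ?A \<Longrightarrow> d (a \<otimes>\<^bsub>?A\<^esub> b) = a \<otimes>\<^bsub>?A\<^esub> d b \<oplus>\<^bsub>?A\<^esub> b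
        \<otimes>\<^bsub>?A\<^esub> d a"
    using d by (auto simp: derivations_def PiE_def)
  have "\<forall>p. \<exists>q. d (hyp_class m n p) = hyp_class m n q"
    using closed[OF hyp_class_closed] by (auto simp: hyp_ring_carrier)
  then obtain D where D: "\<And>p. d (hyp_class m n p) = hyp_class m n (D p)"
    by metis
  have D_add: "hyp_eq m n dvd D (p + q) - (D p + D q)" for p q
    using add[of "hyp_class m n p" "hyp_class m n q"] by (simp add: D flip: hyp_class_eq_iff)
  have D_mult: "hyp_eq m n dvd D (p * q) - (p * D q + q * D p)" for p q
    using leibniz[of "hyp_class m n p" "hyp_class m n q"] by (simp add: D flip: hyp_class_eq_iff)
  have "hyp_eq m n dvd D (cst c)" for c
  proof -
    have "hyp_class m n (cst c) \<in> ground_field m n"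
      by (simp add: ground_field_def)
    then have "hyp_class m n (D (cst c * 1)) = hyp_class m n (cst c * D 1)"
      using lin[of "hyp_class m n (cst c)" "hyp_class m n 1"] by (simp add: D)
    then have "hyp_eq m n dvd D (cst c) - cst c * D 1"
      by (simp add: hyp_class_eq_iff)
    moreover have "hyp_eq m n dvd cst c * D 1"
      using D_mult[of 1 1] by simp
    ultimately have "hyp_eq m n dvd (D (cst c) - cst c * D 1) + cst c * D 1"
      by (rule dvd_add)
    then show ?thesis by simp
  qed
  with D_add D_mult have der: "derivation_mod (hyp_eq m n) D"
    by (simp add: derivation_mod_def)
  have zero: "hyp_eq m n dvd D 0"
    using D_add[of 0 0] by simp
  have "hyp_class m n (hyp_eq m n :: 'a ps3) = hyp_class m n 0"
    by (simp add: hyp_class_eq_iff)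
  then have "hyp_class m n (D (hyp_eq m n)) = hyp_class m n (D 0)"
    by (simp flip: D)
  then have "hyp_eq m n dvd D (hyp_eq m n)"
    using dvd_add[OF _ zero, of "D (hyp_eq m n) - D 0"] by (simp add: hyp_class_eq_iff)
  then obtain c where "\<And>p. hyp_eq m n dvd D p - delta_comb m n c p"
    using derivation_mod_hyp_eq[OF m n der] by blast
  then have "d = delta_class m n c"
    by (intro hyp_ring_map_eqI ext delta_class_extensional) (simp add: D hyp_class_eq_iff)
  then show ?thesis by (rule that)
qed

lemma derivations_eq: "derivations (ground_field m n) (hyp_ring m n) = range (delta_class m n)"
  by (auto intro: delta_class_derivation elim: derivation_eq_delta_class)

abbreviation (input) "Der_A \<equiv> Der (ground_field m n) (hyp_ring m n)"

lemma Der_ops: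
  "carrier Der_A = range (delta_class m n)"
  "\<zero>\<^bsub>Der_A\<^esub> = delta_class m n (\<lambda>_. 0)"
  "delta_class m n c \<oplus>\<^bsub>Der_A\<^esub> delta_class m n c' = delta_class m n (\<lambda>i. c i + c' i)"
  "hyp_class m n p \<odot>\<^bsub>Der_A\<^esub> delta_class m n c = delta_class m n (\<lambda>i. p * c i)"
proof -
  show "carrier Der_A = range (delta_class m n)"
    by (simp add: Der_def derivations_eq)
  show "\<zero>\<^bsub>Der_A\<^esub> = delta_class m n (\<lambda>_. 0)"
    by (rule hyp_ring_map_eqI[OF _ delta_class_extensional])
      (simp_all add: Der_def hyp_class_zero delta_comb_def)
  show "delta_class m n c \<oplus>\<^bsub>Der_A\<^esub> delta_class m n c' = delta_class m n (\<lambda>i. c i + c' i)"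
    by (rule hyp_ring_map_eqI[OF _ delta_class_extensional])
      (simp_all add: Der_def delta_comb_coeff_add)
  show "hyp_class m n p \<odot>\<^bsub>Der_A\<^esub> delta_class m n c = delta_class m n (\<lambda>i. p * c i)"
    by (rule hyp_ring_map_eqI[OF _ delta_class_extensional])
      (simp_all add: Der_def delta_comb_coeff_mult)
qed

lemma Der_abelian_monoid: "abelian_monoid Der_A"
  by (rule abelian_monoidI) (auto simp: Der_ops ac_simps)

lemma Der_finsum:
  "finite S \<Longrightarrow> (\<Oplus>\<^bsub>Der_A\<^esub>s\<in>S. delta_class m n (g s)) = delta_class m n (\<lambda>i. \<Sum>s\<in>S. g s i)"
proof (induction S rule: finite_induct)
  case empty
  interpret D: abelian_monoid Der_A by (rule Der_abelian_monoid)
  show ?case by (simp add: Der_ops)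
next
  case (insert s S)
  interpret D: abelian_monoid Der_A by (rule Der_abelian_monoid)
  show ?case
    using insert by (subst D.finsum_insert) (auto simp: Der_ops)
qed

lemma delta_class_expand:
  "delta_class m n c = (\<Oplus>\<^bsub>Der_A\<^esub>s\<in>{..<4}. hyp_class m n (c s) \<odot>\<^bsub>Der_A\<^esub> delta m n s)"
proof -
  interpret D: abelian_monoid Der_A by (rule Der_abelian_monoid)
  have "(\<Oplus>\<^bsub>Der_A\<^esub>s\<in>{..<4}. hyp_class m n (c s) \<odot>\<^bsub>Der_A\<^esub> delta m n s) =
      (\<Oplus>\<^bsub>Der_A\<^esub>s\<in>{..<4}. delta_class m n (\<lambda>i. c s * unit_coeff s i))"
    by (rule D.finsum_cong') (auto simp: delta_eq_delta_class Der_ops)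
  also have "\<dots> = delta_class m n (\<lambda>i. \<Sum>s<4. c s * unit_coeff s i)"
    by (rule Der_finsum) simp
  also have "\<dots> = delta_class m n c"
    by (rule delta_class_cong) (simp add: of_bool_def mult_delta_right)
  finally show ?thesis ..
qed

end

section \<open>The module of the matrix factorization\<close>

lemma mf_carrier [simp]:
  "mf_phi m n k l \<in> carrier_mat 4 4" "mf_psi m n k l \<in> carrier_mat 4 4"
  by (intro carrier_matI; simp add: mf_phi_def mf_psi_def mat_of_rows_list_def)+

lemma mf_dim [simp]:
  "dim_row (mf_phi m n k l) = 4" "dim_col (mf_phi m n k l) = 4"
  "dim_row (mf_psi m n k l) = 4" "dim_col (mf_psi m n k l) = 4"
  by (simp_all only: carrier_matD[OF mf_carrier(1)] carrier_matD[OF mf_carrier(2)])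

definition mf_im :: "nat \<Rightarrow> nat \<Rightarrow> nat \<Rightarrow> nat \<Rightarrow> 'a::field_char_0 ps3 vec set"
  where "mf_im m n k l = (\<lambda>u. mf_phi m n k l *\<^sub>v u) ` carrier_vec 4"

lemma mf_im_carrier: "u \<in> mf_im m n k l \<Longrightarrow> u \<in> carrier_vec 4"
  using mult_mat_vec_carrier[OF mf_carrier(1)] by (auto simp: mf_im_def)

lemma mf_im_zero: "0\<^sub>v 4 \<in> mf_im m n k l"
proof -
  have "mf_phi m n k l *\<^sub>v 0\<^sub>v 4 = (0\<^sub>v 4 :: 'a ps3 vec)"
    by (intro eq_vecI) (auto simp: scalar_prod_def)
  then show ?thesis unfolding mf_im_def by (metis image_eqI zero_carrier_vec)
qed

lemma mf_im_add: "v \<in> mf_im m n k l \<Longrightarrow> w \<in> mf_im m n k l \<Longrightarrow> v + w \<in> mf_im m n k l"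
  unfolding mf_im_def
  by (auto simp flip: mult_add_distrib_mat_vec[OF mf_carrier(1)])

lemma mf_im_smult:
  fixes v :: "'a::field_char_0 ps3 vec"
  shows "v \<in> mf_im m n k l \<Longrightarrow> p \<cdot>\<^sub>v v \<in> mf_im m n k l"
  unfolding mf_im_def
proof (elim imageE)
  fix u :: "'a ps3 vec" assume u: "v = mf_phi m n k l *\<^sub>v u" "u \<in> carrier_vec 4"
  have "p \<cdot>\<^sub>v v = mf_phi m n k l *\<^sub>v (p \<cdot>\<^sub>v u)"
    using u by (intro eq_vecI) (auto simp: scalar_prod_def sum_distrib_left ac_simps)
  then show "p \<cdot>\<^sub>v v \<in> (\<lambda>u. mf_phi m n k l *\<^sub>v u) ` carrier_vec 4"
    using u by auto
qed

lemma mf_im_uminus: "v \<in> mf_im m n k l \<Longrightarrow> - v \<in> mf_im m n k l"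
proof -
  assume v: "v \<in> mf_im m n k l"
  have "- v = (- 1) \<cdot>\<^sub>v v"
    by (intro eq_vecI) simp_all
  then show "- v \<in> mf_im m n k l"
    using mf_im_smult[OF v] by simp
qed

text \<open>
  This is where \<open>\<phi>\<psi> = f\<close> enters: it makes the cokernel over \<open>P\<close> a module over the quotient by \<open>f\<close>.
\<close>

lemma mf_im_hyp_eq:
  assumes "k \<le> m" "l \<le> n" and v: "v \<in> carrier_vec 4"
  shows "hyp_eq m n \<cdot>\<^sub>v v \<in> mf_im m n k l"
proof -
  have "mf_phi m n k l *\<^sub>v (mf_psi m n k l *\<^sub>v v) = (hyp_eq m n \<cdot>\<^sub>m 1\<^sub>m 4) *\<^sub>v v"
    unfolding matrix_factorization(1)[OF assms(1,2), symmetric]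
    by (rule assoc_mult_mat_vec[symmetric, OF mf_carrier v])
  also have "\<dots> = hyp_eq m n \<cdot>\<^sub>v v"
    using v by (intro eq_vecI) (auto simp: scalar_prod_def mult_delta_left mult_delta_right)
  finally show ?thesis
    unfolding mf_im_def using mult_mat_vec_carrier[OF mf_carrier(2) v] by (metis imageI)
qed

lemma mf_im_dvd:
  assumes "k \<le> m" "l \<le> n" and v: "v \<in> carrier_vec 4" and "\<And>i. i < 4 \<Longrightarrow> hyp_eq m n dvd v $ i"
  shows "v \<in> mf_im m n k l"
proof -
  have "\<forall>i. \<exists>h. i < 4 \<longrightarrow> v $ i = hyp_eq m n * h"
    using assms(4) unfolding dvd_def by blast
  then obtain g where g: "\<And>i. i < 4 \<Longrightarrow> v $ i = hyp_eq m n * g i"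
    by metis
  then have "v = hyp_eq m n \<cdot>\<^sub>v vec 4 g"
    using v by (intro eq_vecI) auto
  then show ?thesis
    using mf_im_hyp_eq[OF assms(1,2) vec_carrier] by metis
qed

definition coker_class :: "nat \<Rightarrow> nat \<Rightarrow> nat \<Rightarrow> nat \<Rightarrow> 'a::field_char_0 ps3 vec \<Rightarrow> 'a ps3 set vec set"
  where "coker_class m n k l v = mf_submodule m n k l +>\<^bsub>free_module (hyp_ring m n) 4\<^esub> vec_class
      m n v"

lemma mf_submodule_eq: "mf_submodule m n k l = vec_class m n ` mf_im m n k l"
  unfolding mf_submodule_def mat_image_def mf_im_def
  by (simp add: free_module_carrier image_image mat_apply_class cong: image_cong)

lemma coker_class_eq:
  assumes "v \<in> carrier_vec 4"
  shows "coker_class m n k l v = (\<lambda>y. vec_class m n (y + v)) ` mf_im m n k l"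
  unfolding coker_class_def a_r_coset_def' mf_submodule_eq UNION_singleton_eq_range image_image
  using assms by (intro image_cong refl) (simp add: free_module_ops mf_im_carrier)

text \<open>
  The isomorphism of \<open>A^4/\<phi> A^4\<close> with \<open>P^4/\<phi> P^4\<close>; the correction by multiples of \<open>f\<close> in the equality of
  the classes in \<open>A^4\<close> is absorbed by the image of \<open>\<phi>\<close>.
\<close>

lemma coker_class_eq_iff:
  assumes kl: "k \<le> m" "l \<le> n" and v: "v \<in> carrier_vec 4" and w: "w \<in> carrier_vec 4"
  shows "coker_class m n k l v = coker_class m n k l w \<longleftrightarrow> v - w \<in> mf_im m n k l"
proof
  assume eq: "coker_class m n k l v = coker_class m n k l w"
  have "vec_class m n (0\<^sub>v 4 + v) \<in> coker_class m n k l v"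
    unfolding coker_class_eq[OF v] by (intro imageI mf_im_zero)
  then obtain y where y: "y \<in> mf_im m n k l" "vec_class m n (0\<^sub>v 4 + v) = vec_class m n (y + w)"
    unfolding eq coker_class_eq[OF w] by (rule imageE)
  note yc = mf_im_carrier[OF y(1)]
  have "hyp_eq m n dvd (v - w - y) $ i" if "i < 4" for i
  proof -
    have "hyp_class m n ((0\<^sub>v 4 + v) $ i) = hyp_class m n ((y + w) $ i)"
      using arg_cong[OF y(2), of "\<lambda>a. a $ i"] that v w yc by simp
    then show ?thesis
      using that v w yc by (simp add: hyp_class_eq_iff algebra_simps)
  qed
  then have "v - w - y \<in> mf_im m n k l"
    using v w yc by (intro mf_im_dvd[OF kl]) auto
  then have "v - w - y + y \<in> mf_im m n k l"
    using y(1) by (rule mf_im_add)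
  also have "v - w - y + y = v - w"
    using v w yc by (intro eq_vecI) auto
  finally show "v - w \<in> mf_im m n k l" .
next
  have sub: "coker_class m n k l a \<subseteq> coker_class m n k l b"
    if a: "a \<in> carrier_vec 4" and b: "b \<in> carrier_vec 4" and ab: "a - b \<in> mf_im m n k l" for a b
        :: "'a ps3 vec"
    unfolding coker_class_eq[OF a] coker_class_eq[OF b]
  proof (rule image_subsetI)
    fix y :: "'a ps3 vec" assume y: "y \<in> mf_im m n k l"
    have "y + a = y + (a - b) + b"
      using mf_im_carrier[OF y] a b by (intro eq_vecI) auto
    then show "vec_class m n (y + a) \<in> (\<lambda>y. vec_class m n (y + b)) ` mf_im m n k l"
      using mf_im_add[OF y ab] by (metis imageI)
  qed
  assume vw: "v - w \<in> mf_im m n k l"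
  have "- (v - w) = w - v"
    using v w by (intro eq_vecI) auto
  with mf_im_uminus[OF vw] have "w - v \<in> mf_im m n k l"
    by simp
  with vw show "coker_class m n k l v = coker_class m n k l w"
    using sub[OF v w] sub[OF w v] by blast
qed

lemma mf_module_carrier: "carrier (mf_module m n k l) = coker_class m n k l ` carrier_vec 4"
  by (auto simp: mf_module_def quotient_module_def A_RCOSETS_def' coker_class_def
      free_module_carrier)

lemma coker_class_closed [simp]: "v \<in> carrier_vec 4 \<Longrightarrow> coker_class m n k l v \<in> carrier (mf_module
    m n k l)"
  by (simp add: mf_module_carrier)

lemma mf_module_zero: "\<zero>\<^bsub>mf_module m n k l\<^esub> = coker_class m n k l (0\<^sub>v 4)"
  unfolding coker_class_eq[OF zero_carrier_vec] mf_module_def quotient_module_def mf_submodule_eq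
  by (simp add: mf_im_carrier cong: image_cong)

lemma coker_class_add [simp]:
  assumes v: "v \<in> carrier_vec 4" and w: "w \<in> carrier_vec 4"
  shows "coker_class m n k l v \<oplus>\<^bsub>mf_module m n k l\<^esub> coker_class m n k l w = coker_class m n k l
      (v + w)"
proof -
  let ?F = "free_module (hyp_ring m n) 4 :: ('a ps3 set, 'a ps3 set vec) module"
  have op: "coker_class m n k l v \<oplus>\<^bsub>mf_module m n k l\<^esub> coker_class m n k l w =
      coker_class m n k l v <+>\<^bsub>?F\<^esub> coker_class m n k l w"
    by (simp add: mf_module_def quotient_module_def)
  have sum: "vec_class m n (y + v) \<oplus>\<^bsub>?F\<^esub> vec_class m n (y' + w) = vec_class m n (y + y' + (v + w))"
    if "y \<in> mf_im m n k l" "y' \<in> mf_im m n k l" for y y' :: "'a ps3 vec"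
  proof -
    note yc = that[THEN mf_im_carrier]
    have "y + v + (y' + w) = y + y' + (v + w)"
      using yc v w by (intro eq_vecI) auto
    then show ?thesis
      using yc v w by (simp add: free_module_ops)
  qed
  show ?thesis
    unfolding op unfolding coker_class_eq[OF v] coker_class_eq[OF w] coker_class_eq[OF
        add_carrier_vec[OF v w]]
  proof (intro equalityI subsetI)
    fix c assume "c \<in> (\<lambda>y. vec_class m n (y + v)) ` mf_im m n k l <+>\<^bsub>?F\<^esub>
      (\<lambda>y. vec_class m n (y + w)) ` mf_im m n k l"
    then obtain y y' where "y \<in> mf_im m n k l" "y' \<in> mf_im m n k l" "c = vec_class m n (y + y' +
        (v + w))"
      unfolding set_add_def' by (auto simp: sum)
    then show "c \<in> (\<lambda>y. vec_class m n (y + (v + w))) ` mf_im m n k l"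
      by (auto intro: mf_im_add)
  next
    fix c assume "c \<in> (\<lambda>y. vec_class m n (y + (v + w))) ` mf_im m n k l"
    then obtain y where y: "y \<in> mf_im m n k l" "c = vec_class m n (y + (v + w))"
      by blast
    have "c = vec_class m n (y + v) \<oplus>\<^bsub>?F\<^esub> vec_class m n (0\<^sub>v 4 + w)"
      using y mf_im_carrier[OF y(1)] by (simp add: sum[OF y(1) mf_im_zero])
    then show "c \<in> (\<lambda>y. vec_class m n (y + v)) ` mf_im m n k l <+>\<^bsub>?F\<^esub>
      (\<lambda>y. vec_class m n (y + w)) ` mf_im m n k l"
      unfolding set_add_def'
      by (intro UN_I[OF imageI[OF y(1)]] UN_I[OF imageI[OF mf_im_zero]]) simp
  qed
qed

lemma coker_class_smult [simp]:
  assumes kl: "k \<le> m" "l \<le> n" and v: "v \<in> carrier_vec 4"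
  shows "hyp_class m n p \<odot>\<^bsub>mf_module m n k l\<^esub> coker_class m n k l v = coker_class m n k l (p \<cdot>\<^sub>v v)"
proof -
  let ?F = "free_module (hyp_ring m n) 4 :: ('a ps3 set, 'a ps3 set vec) module"
  have "mf_submodule m n k l +>\<^bsub>?F\<^esub> (hyp_class m n p \<odot>\<^bsub>?F\<^esub> x) = coker_class m n k l (p \<cdot>\<^sub>v v)"
    if "x \<in> coker_class m n k l v" for x
  proof -
    obtain y where y: "y \<in> mf_im m n k l" "x = vec_class m n (y + v)"
      using \<open>x \<in> coker_class m n k l v\<close> unfolding coker_class_eq[OF v] by (elim imageE) auto
    note yc = mf_im_carrier[OF y(1)]
    have "p \<cdot>\<^sub>v (y + v) - p \<cdot>\<^sub>v v = p \<cdot>\<^sub>v y"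
      using v yc by (intro eq_vecI) (auto simp: algebra_simps)
    then have "coker_class m n k l (p \<cdot>\<^sub>v (y + v)) = coker_class m n k l (p \<cdot>\<^sub>v v)"
      using mf_im_smult[OF y(1)] v yc by (subst coker_class_eq_iff[OF kl]) auto
    then show ?thesis
      using v yc unfolding y(2) coker_class_def by (simp add: free_module_ops)
  qed
  moreover have "coker_class m n k l v \<noteq> {}"
    unfolding coker_class_eq[OF v] using mf_im_zero by blast
  ultimately show ?thesis
    by (simp add: mf_module_def quotient_module_def)
qed

lemma mf_module_carrierE:
  assumes "w \<in> carrier (mf_module m n k l)"
  obtains v where "v \<in> carrier_vec 4" "w = coker_class m n k l v"
  using assms by (auto simp: mf_module_carrier)

lemma mf_module_module:
  assumes kl: "k \<le> m" "l \<le> n"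
  shows "Module.module (hyp_ring m n) (mf_module m n k l :: ('a::field_char_0 ps3 set, _) module)"
proof (rule moduleI)
  show "cring (hyp_ring m n :: 'a ps3 set ring)" by (rule hyp_ring_cring)
  show "abelian_group (mf_module m n k l :: ('a ps3 set, _) module)"
  proof (rule abelian_groupI)
    fix x y z :: "'a ps3 set vec set"
    assume "x \<in> carrier (mf_module m n k l)" "y \<in> carrier (mf_module m n k l)" "z \<in> carrier
        (mf_module m n k l)"
    then show "x \<oplus>\<^bsub>mf_module m n k l\<^esub> y \<oplus>\<^bsub>mf_module m n k l\<^esub> z = x \<oplus>\<^bsub>mf_module m n k l\<^esub> (y
        \<oplus>\<^bsub>mf_module m n k l\<^esub> z)"
      by (elim mf_module_carrierE) (simp add: assoc_add_vec[where n = 4])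
  next
    fix x y :: "'a ps3 set vec set"
    assume "x \<in> carrier (mf_module m n k l)" "y \<in> carrier (mf_module m n k l)"
    then show "x \<oplus>\<^bsub>mf_module m n k l\<^esub> y \<in> carrier (mf_module m n k l)"
      and "x \<oplus>\<^bsub>mf_module m n k l\<^esub> y = y \<oplus>\<^bsub>mf_module m n k l\<^esub> x"
      by (auto elim!: mf_module_carrierE simp: comm_add_vec[where n = 4])
  next
    fix x :: "'a ps3 set vec set"
    assume "x \<in> carrier (mf_module m n k l)"
    then obtain v where v: "v \<in> carrier_vec 4" "x = coker_class m n k l v"
      by (rule mf_module_carrierE)
    show "\<zero>\<^bsub>mf_module m n k l\<^esub> \<oplus>\<^bsub>mf_module m n k l\<^esub> x = x"
      using v by (simp add: mf_module_zero)
    have "- v + v = 0\<^sub>v 4" using v(1) by (intro eq_vecI) auto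
    then show "\<exists>y\<in>carrier (mf_module m n k l). y \<oplus>\<^bsub>mf_module m n k l\<^esub> x = \<zero>\<^bsub>mf_module m n k l\<^esub>"
      using v by (intro bexI[of _ "coker_class m n k l (- v)"]) (auto simp: mf_module_zero)
  qed (simp add: mf_module_zero)
next
  fix a :: "'a ps3 set" and x :: "'a ps3 set vec set"
  assume "a \<in> carrier (hyp_ring m n)" "x \<in> carrier (mf_module m n k l)"
  then show "a \<odot>\<^bsub>mf_module m n k l\<^esub> x \<in> carrier (mf_module m n k l)"
    using kl by (auto elim!: mf_module_carrierE hyp_ring_carrierE)
next
  fix a b :: "'a ps3 set" and x :: "'a ps3 set vec set"
  assume "a \<in> carrier (hyp_ring m n)" "b \<in> carrier (hyp_ring m n)" "x \<in> carrier (mf_module m n k l)"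
  then show "(a \<oplus>\<^bsub>hyp_ring m n\<^esub> b) \<odot>\<^bsub>mf_module m n k l\<^esub> x =
      a \<odot>\<^bsub>mf_module m n k l\<^esub> x \<oplus>\<^bsub>mf_module m n k l\<^esub> b \<odot>\<^bsub>mf_module m n k l\<^esub> x"
    and "(a \<otimes>\<^bsub>hyp_ring m n\<^esub> b) \<odot>\<^bsub>mf_module m n k l\<^esub> x =
      a \<odot>\<^bsub>mf_module m n k l\<^esub> (b \<odot>\<^bsub>mf_module m n k l\<^esub> x)"
    using kl by (auto elim!: mf_module_carrierE hyp_ring_carrierE
        simp: add_smult_distrib_vec smult_smult_assoc)
next
  fix a :: "'a ps3 set" and x y :: "'a ps3 set vec set"
  assume "a \<in> carrier (hyp_ring m n)" "x \<in> carrier (mf_module m n k l)" "y \<in> carrier (mf_module m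
      n k l)"
  then show "a \<odot>\<^bsub>mf_module m n k l\<^esub> (x \<oplus>\<^bsub>mf_module m n k l\<^esub> y) =
      a \<odot>\<^bsub>mf_module m n k l\<^esub> x \<oplus>\<^bsub>mf_module m n k l\<^esub> a \<odot>\<^bsub>mf_module m n k l\<^esub> y"
    using kl by (auto elim!: mf_module_carrierE hyp_ring_carrierE
        simp: smult_add_distrib_vec[where n = 4])
next
  fix x :: "'a ps3 set vec set"
  assume "x \<in> carrier (mf_module m n k l)"
  then show "\<one>\<^bsub>hyp_ring m n\<^esub> \<odot>\<^bsub>mf_module m n k l\<^esub> x = x"
    using kl by (auto elim!: mf_module_carrierE simp: hyp_class_one)
qed

section \<open>Identities between matrices of size four\<close>

lemma mat4_eq_iff:
  "mat_of_rows_list 4 [[a00,a01,a02,a03],[a10,a11,a12,a13],[a20,a21,a22,a23],[a30,a31,a32,a33]] =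
   mat_of_rows_list 4 [[b00,b01,b02,b03],[b10,b11,b12,b13],[b20,b21,b22,b23],[b30,b31,b32,b33]] \<longleftrightarrow>
   (a00 = b00 \<and> a01 = b01 \<and> a02 = b02 \<and> a03 = b03) \<and> (a10 = b10 \<and> a11 = b11 \<and> a12 = b12 \<and> a13 =
       b13) \<and>
   (a20 = b20 \<and> a21 = b21 \<and> a22 = b22 \<and> a23 = b23) \<and> (a30 = b30 \<and> a31 = b31 \<and> a32 = b32 \<and> a33 =
       b33)"
  (is "?A = ?B \<longleftrightarrow> ?R")
proof
  assume "?A = ?B"
  then have "?A $$ (i, j) = ?B $$ (i, j)" for i j by simp
  from this[of 0 0] this[of 0 1] this[of 0 2] this[of 0 3]
    this[of 1 0] this[of 1 1] this[of 1 2] this[of 1 3]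
    this[of 2 0] this[of 2 1] this[of 2 2] this[of 2 3]
    this[of 3 0] this[of 3 1] this[of 3 2] this[of 3 3]
  show ?R by (simp add: mat_of_rows_list_def)
qed simp

lemma mat4_eqI:
  assumes "A \<in> carrier_mat 4 4" and "B \<in> carrier_mat 4 4"
    and "\<And>i j. i \<in> {0, 1, 2, 3} \<Longrightarrow> j \<in> {0, 1, 2, 3} \<Longrightarrow> A $$ (i, j) = B $$ (i, j)"
  shows "A = B"
proof (rule eq_matI)
  fix i j assume "i < dim_row B" "j < dim_col B"
  then have "i < 4" "j < 4" using assms(2) by auto
  then have "i \<in> {0, 1, 2, 3}" "j \<in> {0, 1, 2, 3}" by auto
  then show "A $$ (i, j) = B $$ (i, j)" by (rule assms(3))
qed (use assms(1,2) in auto)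

lemma mat4_carrier [simp]: "mat_of_rows_list 4 [r0, r1, r2, r3] \<in> carrier_mat 4 4"
  by (rule carrier_matI) (simp_all add: mat_of_rows_list_def)

lemma mat4_mult:
  fixes a00 :: "'r::comm_ring_1"
  shows "mat_of_rows_list 4
      [[a00,a01,a02,a03],[a10,a11,a12,a13],[a20,a21,a22,a23],[a30,a31,a32,a33]] *
   mat_of_rows_list 4 [[b00,b01,b02,b03],[b10,b11,b12,b13],[b20,b21,b22,b23],[b30,b31,b32,b33]] =
   mat_of_rows_list 4
    [[a00*b00+a01*b10+a02*b20+a03*b30, a00*b01+a01*b11+a02*b21+a03*b31,
        a00*b02+a01*b12+a02*b22+a03*b32, a00*b03+a01*b13+a02*b23+a03*b33],
     [a10*b00+a11*b10+a12*b20+a13*b30, a10*b01+a11*b11+a12*b21+a13*b31,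
         a10*b02+a11*b12+a12*b22+a13*b32, a10*b03+a11*b13+a12*b23+a13*b33],
     [a20*b00+a21*b10+a22*b20+a23*b30, a20*b01+a21*b11+a22*b21+a23*b31,
         a20*b02+a21*b12+a22*b22+a23*b32, a20*b03+a21*b13+a22*b23+a23*b33],
     [a30*b00+a31*b10+a32*b20+a33*b30, a30*b01+a31*b11+a32*b21+a33*b31,
         a30*b02+a31*b12+a32*b22+a33*b32, a30*b03+a31*b13+a32*b23+a33*b33]]"
    (is "?A * ?B = ?C")
proof (rule mat4_eqI)
  fix i j :: nat assume ij: "i \<in> {0, 1, 2, 3}" "j \<in> {0, 1, 2, 3}"
  have up4: "{0..<4} = {0, 1, 2, 3 :: nat}" by auto
  have "(?A * ?B) $$ (i, j) = (\<Sum>r\<in>{0, 1, 2, 3}. ?A $$ (i, r) * ?B $$ (r, j))"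
    using ij by (auto simp: scalar_prod_def up4 mat_of_rows_list_def)
  then show "(?A * ?B) $$ (i, j) = ?C $$ (i, j)"
    using ij by (elim insertE emptyE) (simp_all add: mat_of_rows_list_def add.assoc)
qed (simp_all add: mult_carrier_mat[OF mat4_carrier mat4_carrier])

lemma mat4_add:
  fixes a00 :: "'r::comm_ring_1"
  shows "mat_of_rows_list 4
      [[a00,a01,a02,a03],[a10,a11,a12,a13],[a20,a21,a22,a23],[a30,a31,a32,a33]] +
   mat_of_rows_list 4 [[b00,b01,b02,b03],[b10,b11,b12,b13],[b20,b21,b22,b23],[b30,b31,b32,b33]] =
   mat_of_rows_list 4
    [[a00+b00,a01+b01,a02+b02,a03+b03],[a10+b10,a11+b11,a12+b12,a13+b13],
     [a20+b20,a21+b21,a22+b22,a23+b23],[a30+b30,a31+b31,a32+b32,a33+b33]]"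
  by (rule mat4_eqI) (auto simp: mat_of_rows_list_def)

lemma mat4_smult:
  fixes a00 :: "'r::comm_ring_1"
  shows "c \<cdot>\<^sub>m mat_of_rows_list 4
      [[a00,a01,a02,a03],[a10,a11,a12,a13],[a20,a21,a22,a23],[a30,a31,a32,a33]] =
   mat_of_rows_list 4
    [[c*a00,c*a01,c*a02,c*a03],[c*a10,c*a11,c*a12,c*a13],[c*a20,c*a21,c*a22,c*a23],[c*a30,c*a31,c*a32,c*a33]]"
  by (rule mat4_eqI) (auto simp: mat_of_rows_list_def)

lemma mat4_map:
  "map_mat h (mat_of_rows_list 4
      [[a00,a01,a02,a03],[a10,a11,a12,a13],[a20,a21,a22,a23],[a30,a31,a32,a33]]) =
   mat_of_rows_list 4
    [[h a00,h a01,h a02,h a03],[h a10,h a11,h a12,h a13],[h a20,h a21,h a22,h a23],[h a30,h a31,h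
        a32,h a33]]"
  by (rule mat4_eqI) (auto simp: mat_of_rows_list_def)

lemmas mat4_simps = mat4_mult mat4_add mat4_smult mat4_eq_iff

text \<open>
  In the application \<open>P, P', Q, Q'\<close> are \<open>x^(k-1), x^(m-k-1), y^(l-1), y^(n-l-1)\<close> and \<open>U, U', T, T'\<close> are
  \<open>x^k, x^(m-k), y^l, y^(n-l)\<close>.  For \<open>k = m\<close> the exponent \<open>m-k-1\<close> is truncated and \<open>U' = x * P'\<close>
  fails, but regularity of the entries then forces \<open>b = g = 0\<close>; likewise \<open>b = e = 0\<close> for \<open>l = n\<close>.
  The identities use \<open>U' = x * P'\<close> only after multiplication with \<open>b\<close> or \<open>g\<close>, and \<open>T' = y * Q'\<close>
  only with \<open>b\<close> or \<open>e\<close>, so that the hypotheses below cover all cases at once.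

  The matrices \<open>conn4_0, \<dots>, conn4_3\<close> are \<open>A_0, A_1, n A_2, m A_3\<close>; the factors clear the denominators.
\<close>

context
  fixes a b g e x y z P P' Q Q' U U' T T' :: "'r::idom"
  assumes bX: "b * U' = b * (x * P')" and gX: "g * U' = g * (x * P')"
    and bY: "b * T' = b * (y * Q')" and eY: "e * T' = e * (y * Q')"
    and sum_eq: "a + b = g + e" and U: "U = x * P" and T: "T = y * Q"
begin

abbreviation "phi4 \<equiv> mat_of_rows_list 4
    [[U', T', 0, z], [T, - U, z, 0], [z, 0, - T', - U], [0, z, U', - T]]"
abbreviation "conn4_0 \<equiv> mat_of_rows_list 4
    [[2*a, 0, 0, 0], [0, 2*b, 0, 0], [0, 0, 2*g, 0], [0, 0, 0, 2*e]]"
abbreviation "conn4_1 \<equiv> mat_of_rows_list 4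
    [[0, b*P'*Q', 0, 0], [- (a*P*Q), 0, 0, 0], [0, 0, 0, e*P*Q'], [0, 0, - (g*P'*Q), 0]]"
abbreviation "conn4_2 \<equiv> mat_of_rows_list 4
    [[0, 0, 2*g*P', 0], [0, 0, 0, - (2*e*P)], [- (2*a*P), 0, 0, 0], [0, 2*b*P', 0, 0]]"
abbreviation "conn4_3 \<equiv> mat_of_rows_list 4
    [[0, 0, 0, 2*e*Q'], [0, 0, 2*g*Q, 0], [0, - (2*b*Q'), 0, 0], [- (2*a*Q), 0, 0, 0]]"

abbreviation "phi4_deriv X1 X2 Y1 Y2 Z1 \<equiv> mat_of_rows_list 4
    [[X2, Y2, 0, Z1], [Y1, - X1, Z1, 0], [Z1, 0, - Y2, - X1], [0, Z1, X2, - Y1]]"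

text \<open>
  In each of the next four identities the first summand is the result of applying \<open>\<delta>_s\<close> to the entries
  of \<open>\<phi>\<close>, multiplied by \<open>n\<close> for \<open>s = 2\<close> and by \<open>m\<close> for \<open>s = 3\<close>.  The last factor on the right is
  \<open>\<psi>\<close> times the left-hand side, divided by \<open>f\<close>.
\<close>

lemma matrix_compat_0:
  "phi4_deriv (2*(a+e)*U) (2*(b+g)*U') (2*(a+g)*T) (2*(b+e)*T') ((a+b+g+e)*z) + conn4_0 * phi4 =
   phi4 * mat_of_rows_list 4
       [[a+b+3*g+e,0,0,0],[0,a+b+g+3*e,0,0],[0,0,a+3*b+g+e,0],[0,0,0,3*a+b+g+e]]"
  unfolding mat4_simps
  \<comment> \<open>Entries that vanish on both sides need the first alternative: with hypotheses, the method fails on trivial goals.\<close>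
  by (intro conjI; (Groebner_Basis.algebra | use sum_eq in Groebner_Basis.algebra))

lemma matrix_compat_1:
  "phi4_deriv (- ((a+e)*Q*T'*P)) (- ((b+g)*Q*T'*P')) ((a+g)*P*U'*Q) ((b+e)*P*U'*Q') 0 + conn4_1 *
      phi4 =
   phi4 * mat_of_rows_list 4 [[0,e*P*Q',0,0],[- (g*P'*Q),0,0,0],[0,0,0,- (a*P*Q)],[0,0,b*P'*Q',0]]"
  unfolding mat4_simps
  by (intro conjI; (Groebner_Basis.algebra | use sum_eq bX gX bY eY U T in Groebner_Basis.algebra))

lemma matrix_compat_2:
  "phi4_deriv (- (2*z*(a+e)*P)) (- (2*z*(b+g)*P')) 0 0 ((a+b+g+e)*P*U') + conn4_2 * phi4 =
   phi4 * mat_of_rows_list 4 [[0,0,0,2*e*P],[0,0,-(2*g*P'),0],[0,2*a*P,0,0],[-(2*b*P'),0,0,0]]"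
  unfolding mat4_simps
  by (intro conjI; (Groebner_Basis.algebra | use sum_eq bX gX bY eY U T in Groebner_Basis.algebra))

lemma matrix_compat_3:
  "phi4_deriv 0 0 (- (2*z*(a+g)*Q)) (- (2*z*(b+e)*Q')) ((a+b+g+e)*Q*T') + conn4_3 * phi4 =
   phi4 * mat_of_rows_list 4 [[0,0,2*e*Q',0],[0,0,0,2*g*Q],[-(2*a*Q),0,0,0],[0,-(2*b*Q'),0,0]]"
  unfolding mat4_simps
  by (intro conjI; (Groebner_Basis.algebra | use sum_eq bX gX bY eY U T in Groebner_Basis.algebra))

text \<open>
  The combinations of the connection matrices along the four generating relations of the \<open>\<delta>_s\<close>, divided
  by \<open>1, m, n, 2\<close> in this order.
\<close>

lemma matrix_syzygy_koszul:
  "(2*z) \<cdot>\<^sub>m conn4_1 + (- (Q*T')) \<cdot>\<^sub>m conn4_2 + (P*U') \<cdot>\<^sub>m conn4_3 =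
   phi4 * mat_of_rows_list 4
       [[0,0,0,2*e*P*Q'],[0,0,-(2*g*P'*Q),0],[-(2*a*P*Q),0,0,0],[0,2*b*P'*Q',0,0]]"
  unfolding mat4_simps
  by (intro conjI; (Groebner_Basis.algebra | use sum_eq bX gX bY eY U T in Groebner_Basis.algebra))

lemma matrix_syzygy_x:
  "(P*U') \<cdot>\<^sub>m conn4_0 + (- (2*y)) \<cdot>\<^sub>m conn4_1 + (- z) \<cdot>\<^sub>m conn4_2 =
   phi4 * mat_of_rows_list 4 [[2*a*P,0,0,0],[0,-(2*b*P'),0,0],[0,0,0,2*e*P],[0,0,-(2*g*P'),0]]"
  unfolding mat4_simps
  by (intro conjI; (Groebner_Basis.algebra | use sum_eq bX gX bY eY U T in Groebner_Basis.algebra))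

lemma matrix_syzygy_y:
  "(Q*T') \<cdot>\<^sub>m conn4_0 + (2*x) \<cdot>\<^sub>m conn4_1 + (- z) \<cdot>\<^sub>m conn4_3 =
   phi4 * mat_of_rows_list 4 [[0,2*b*Q',0,0],[2*a*Q,0,0,0],[0,0,-(2*g*Q),0],[0,0,0,-(2*e*Q')]]"
  unfolding mat4_simps
  by (intro conjI; (Groebner_Basis.algebra | use sum_eq bX gX bY eY U T in Groebner_Basis.algebra))

lemma matrix_syzygy_z:
  "z \<cdot>\<^sub>m conn4_0 + x \<cdot>\<^sub>m conn4_2 + y \<cdot>\<^sub>m conn4_3 =
   phi4 * mat_of_rows_list 4 [[0,0,2*g,0],[0,0,0,2*e],[0,2*b,0,0],[2*a,0,0,0]]"
  unfolding mat4_simps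
  by (intro conjI; (Groebner_Basis.algebra | use sum_eq bX gX bY eY U T in Groebner_Basis.algebra))

end

section \<open>The connection matrices\<close>

definition conn_lift :: "nat \<Rightarrow> nat \<Rightarrow> nat \<Rightarrow> nat \<Rightarrow> nat \<Rightarrow> 'a::field_char_0 ps3 mat"
  where "conn_lift m n k l s = map_mat series_of_term (conn_terms m n k l s)"

lemma conn_matrix_eq: "conn_matrix m n k l s = map_mat (hyp_class m n) (conn_lift m n k l s)"
  by (auto simp: conn_matrix_def conn_lift_def)

lemma conn_lift_carrier: "s < 4 \<Longrightarrow> conn_lift m n k l s \<in> carrier_mat 4 4"
  by (drule less_4_cases, elim disjE) (simp_all add: conn_lift_def conn_terms_def Let_def)

lemma nat_exponent: "nat (int i - 1) = i - 1" "nat (int j - int i - 1) = j - i - 1"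
  by simp_all

lemma unscale_multiple_of_phi:
  fixes B B' :: "'a::field_char_0 ps3 mat"
  assumes "0 < i" and "B \<in> carrier_mat 4 4" and "of_nat i \<cdot>\<^sub>m B = mf_phi m n k l * B'" and "B' \<in>
      carrier_mat 4 4"
  shows "\<exists>C\<in>carrier_mat 4 4. B = mf_phi m n k l * C"
proof -
  obtain c :: "'a ps3" where c: "of_nat i * c = 1"
    by (rule of_nat_inverse_ps3[OF assms(1)])
  have "c \<cdot>\<^sub>m (of_nat i \<cdot>\<^sub>m B) = B"
  proof (rule eq_matI)
    fix r s assume "r < dim_row B" "s < dim_col B"
    then have "(c \<cdot>\<^sub>m (of_nat i \<cdot>\<^sub>m B)) $$ (r, s) = (of_nat i * c) * B $$ (r, s)"
      by (simp add: ac_simps)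
    then show "(c \<cdot>\<^sub>m (of_nat i \<cdot>\<^sub>m B)) $$ (r, s) = B $$ (r, s)"
      by (simp add: c)
  qed simp_all
  then have "B = mf_phi m n k l * (c \<cdot>\<^sub>m B')"
    using mult_smult_distrib[OF mf_carrier(1) assms(4)] unfolding assms(3) by simp
  then show ?thesis
    by (rule bexI) (simp add: assms(4))
qed

lemma multiple_of_phi_im:
  assumes "B = mf_phi m n k l * C" and "C \<in> carrier_mat 4 4" and "v \<in> carrier_vec 4"
  shows "B *\<^sub>v v \<in> mf_im m n k l"
  unfolding assms(1) mf_im_def assoc_mult_mat_vec[OF mf_carrier(1) assms(2,3)]
  using mult_mat_vec_carrier[OF assms(2,3)] by (rule imageI)

lemma delta_lift_simps:
  "delta_lift m n 0 p = of_nat (2 * n) * vx * dx p + of_nat (2 * m) * vy * dy p + of_nat (m * n)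
      * vz * dz p"
  "delta_lift m n 1 p = of_nat m * vx ^ (m - 1) * dy p - of_nat n * vy ^ (n - 1) * dx p"
  "delta_lift m n 2 p = - (2 * vz * dx p) + of_nat m * vx ^ (m - 1) * dz p"
  "delta_lift m n 3 p = - (2 * vz * dy p) + of_nat n * vy ^ (n - 1) * dz p"
  by (simp_all add: delta_lift_def)

text \<open>
  The halves of the diagonal entries of \<open>A_0\<close>.
\<close>

definition coeff_a :: "nat \<Rightarrow> nat \<Rightarrow> nat \<Rightarrow> nat \<Rightarrow> 'a::field_char_0"
  where "coeff_a m n k l = 1/2 * (of_nat (n * k) + of_nat (m * l) - 1/2 * of_nat (m * n))"
definition coeff_b :: "nat \<Rightarrow> nat \<Rightarrow> nat \<Rightarrow> nat \<Rightarrow> 'a::field_char_0"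
  where "coeff_b m n k l = 1/2 * (3/2 * of_nat (m * n) - of_nat (m * l) - of_nat (n * k))"
definition coeff_g :: "nat \<Rightarrow> nat \<Rightarrow> nat \<Rightarrow> nat \<Rightarrow> 'a::field_char_0"
  where "coeff_g m n k l = 1/2 * (1/2 * of_nat (m * n) + of_nat (m * l) - of_nat (n * k))"
definition coeff_e :: "nat \<Rightarrow> nat \<Rightarrow> nat \<Rightarrow> nat \<Rightarrow> 'a::field_char_0"
  where "coeff_e m n k l = 1/2 * (1/2 * of_nat (m * n) + of_nat (n * k) - of_nat (m * l))"

lemmas coeff_defs = coeff_a_def coeff_b_def coeff_g_def coeff_e_def

context
  fixes m n k l :: nat
  assumes m: "0 < m" and n: "0 < n" and k: "1 \<le> k" "k \<le> m" and l: "1 \<le> l" "l \<le> n"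
begin

abbreviation "ca \<equiv> cst (coeff_a m n k l)"
abbreviation "cb \<equiv> cst (coeff_b m n k l)"
abbreviation "cg \<equiv> cst (coeff_g m n k l)"
abbreviation "ce \<equiv> cst (coeff_e m n k l)"

lemma of_nat_coeff:
  "of_nat (n * k) = (ca + ce :: 'a::field_char_0 ps3)"
  "of_nat (m * l) = (ca + cg :: 'a ps3)"
  "of_nat (n * (m - k)) = (cb + cg :: 'a ps3)"
  "of_nat (m * (n - l)) = (cb + ce :: 'a ps3)"
  "of_nat (m * n) = (ca + cb + cg + ce :: 'a ps3)"
  "ca + cb = (cg + ce :: 'a ps3)"
  unfolding cst_of_nat[symmetric] cst_simps(1)[symmetric]
  by (rule arg_cong[where f = cst], use k l in \<open>simp add: coeff_defs of_nat_diff field_simps\<close>)+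

lemma conn_lift_0: "conn_lift m n k l 0 = (conn4_0 ca cb cg ce :: 'a::field_char_0 ps3 mat)"
proof -
  have c: "of_nat (n * k) + of_nat (m * l) - 1/2 * of_nat (m * n) = (2 * coeff_a m n k l :: 'a)"
    "3/2 * of_nat (m * n) - of_nat (m * l) - of_nat (n * k) = (2 * coeff_b m n k l :: 'a)"
    "1/2 * of_nat (m * n) + of_nat (m * l) - of_nat (n * k) = (2 * coeff_g m n k l :: 'a)"
    "1/2 * of_nat (m * n) + of_nat (n * k) - of_nat (m * l) = (2 * coeff_e m n k l :: 'a)"
    by (simp_all add: coeff_defs field_simps)
  show ?thesis
    unfolding conn_lift_def conn_terms_def Let_def c
    by (simp add: mat4_map mat4_eq_iff)
qed

lemma conn_lift_1:
  "conn_lift m n k l 1 = (conn4_1 ca cb cg ce (vx ^ (k - 1)) (vx ^ (m - k - 1)) (vy ^ (l - 1))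
      (vy ^ (n - l - 1)) :: 'a::field_char_0 ps3 mat)"
proof -
  have c: "1/4 * (of_nat (m * n) - 2 * of_nat (n * k) - 2 * of_nat (m * l)) = (- coeff_a m n k l
      :: 'a)"
    "1/4 * (3 * of_nat (m * n) - 2 * of_nat (m * l) - 2 * of_nat (n * k)) = (coeff_b m n k l :: 'a)"
    "1/4 * (2 * of_nat (n * k) - of_nat (m * n) - 2 * of_nat (m * l)) = (- coeff_g m n k l :: 'a)"
    "1/4 * (2 * of_nat (n * k) - 2 * of_nat (m * l) + of_nat (m * n)) = (coeff_e m n k l :: 'a)"
    by (simp_all add: coeff_defs field_simps)
  show ?thesis
    unfolding conn_lift_def conn_terms_def Let_def c
    by (simp add: mat4_map mat4_eq_iff nat_exponent)
qed

lemma conn_lift_2: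
  "of_nat n \<cdot>\<^sub>m conn_lift m n k l 2 = (conn4_2 ca cb cg ce (vx ^ (k - 1)) (vx ^ (m - k - 1))
      :: 'a::field_char_0 ps3 mat)"
proof -
  have c: "1/2 * of_nat (m * n) - of_nat (m * l) - of_nat (n * k) = (- (2 * coeff_a m n k l) :: 'a)"
    "3/2 * of_nat (m * n) - of_nat (m * l) - of_nat (n * k) = (2 * coeff_b m n k l :: 'a)"
    "1/2 * of_nat (m * n) + of_nat (m * l) - of_nat (n * k) = (2 * coeff_g m n k l :: 'a)"
    "of_nat (m * l) - of_nat (n * k) - 1/2 * of_nat (m * n) = (- (2 * coeff_e m n k l) :: 'a)"
    by (simp_all add: coeff_defs field_simps)
  show ?thesis
    unfolding conn_lift_def conn_terms_def Let_def c
    using n by (simp add: mat4_map mat4_smult mat4_eq_iff nat_exponent cst_cancel flip: mult.assoc)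
qed

lemma conn_lift_3:
  "of_nat m \<cdot>\<^sub>m conn_lift m n k l 3 = (conn4_3 ca cb cg ce (vy ^ (l - 1)) (vy ^ (n - l - 1))
      :: 'a::field_char_0 ps3 mat)"
proof -
  have c: "1/2 * of_nat (m * n) - of_nat (m * l) - of_nat (n * k) = (- (2 * coeff_a m n k l) :: 'a)"
    "of_nat (m * l) + of_nat (n * k) - 3/2 * of_nat (m * n) = (- (2 * coeff_b m n k l) :: 'a)"
    "1/2 * of_nat (m * n) + of_nat (m * l) - of_nat (n * k) = (2 * coeff_g m n k l :: 'a)"
    "1/2 * of_nat (m * n) - of_nat (m * l) + of_nat (n * k) = (2 * coeff_e m n k l :: 'a)"
    by (simp_all add: coeff_defs field_simps)
  show ?thesis
    unfolding conn_lift_def conn_terms_def Let_def c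
    using m by (simp add: mat4_map mat4_smult mat4_eq_iff nat_exponent cst_cancel flip: mult.assoc)
qed

lemma power_split:
  "(vx ^ k :: 'a::field_char_0 ps3) = vx * vx ^ (k - 1)" "(vy ^ l :: 'a ps3) = vy * vy ^ (l - 1)"
  "(vx ^ (m - 1) :: 'a ps3) = vx ^ (k - 1) * vx ^ (m - k)"
  "(vy ^ (n - 1) :: 'a ps3) = vy ^ (l - 1) * vy ^ (n - l)"
  using k l by (simp_all flip: power_add power_Suc)

lemma mf_phi_eq: "mf_phi m n k l = (phi4 vz (vx ^ k) (vx ^ (m - k)) (vy ^ l) (vy ^ (n - l))
    :: 'a::field_char_0 ps3 mat)"
  by (simp add: mf_phi_def)

lemma of_nat_coeff_mult:
  "of_nat n * (of_nat k * u) = (ca + ce) * (u :: 'a::field_char_0 ps3)"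
  "of_nat m * (of_nat l * u) = (ca + cg) * u"
  "of_nat n * (of_nat (m - k) * u) = (cb + cg) * u"
  "of_nat m * (of_nat (n - l) * u) = (cb + ce) * u"
  "of_nat m * (of_nat n * u) = (ca + cb + cg + ce) * u"
  unfolding of_nat_coeff[symmetric] of_nat_mult by (simp_all only: mult.assoc)

lemma delta_phi_0:
  "map_mat (delta_lift m n 0) (mf_phi m n k l) =
    (phi4_deriv (2*(ca+ce)*vx^k) (2*(cb+cg)*vx^(m-k)) (2*(ca+cg)*vy^l) (2*(cb+ce)*vy^(n-l))
        ((ca+cb+cg+ce)*vz)
      :: 'a::field_char_0 ps3 mat)"
proof -
  have px: "delta_lift m n 0 (vx ^ i) = 2 * (of_nat n * (of_nat i * vx ^ i))" for i
    unfolding delta_lift_simps partial_power euler_power[symmetric] by (simp add: ac_simps)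
  have py: "delta_lift m n 0 (vy ^ i) = 2 * (of_nat m * (of_nat i * vy ^ i))" for i
    unfolding delta_lift_simps partial_power euler_power[symmetric] by (simp add: ac_simps)
  have neg: "delta_lift m n 0 (- p) = - delta_lift m n 0 p" and zero: "delta_lift m n 0 0 = 0" for p
    unfolding delta_lift_simps by (simp_all add: partial_uminus partial_zero)
  have z: "delta_lift m n 0 vz = of_nat m * (of_nat n * vz)"
    unfolding delta_lift_simps by (simp add: mult.assoc)
  show ?thesis
    unfolding mf_phi_eq mat4_map neg px py zero z of_nat_coeff_mult by (simp only: mult.assoc)
qed

lemma delta_phi_1:
  "map_mat (delta_lift m n 1) (mf_phi m n k l) =
    (phi4_deriv (- ((ca+ce)*vy^(l-1)*vy^(n-l)*vx^(k-1))) (- ((cb+cg)*vy^(l-1)*vy^(n-l)*vx^(m-k-1)))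
      ((ca+cg)*vx^(k-1)*vx^(m-k)*vy^(l-1)) ((cb+ce)*vx^(k-1)*vx^(m-k)*vy^(n-l-1)) 0
          :: 'a::field_char_0 ps3 mat)"
proof -
  have px: "delta_lift m n 1 (vx ^ i) = - (of_nat n * (of_nat i *
      (vy^(l-1)*(vy^(n-l)*vx^(i-1)))))" for i
    unfolding delta_lift_simps partial_power power_split(4) by (simp add: ac_simps)
  have py: "delta_lift m n 1 (vy ^ i) = of_nat m * (of_nat i * (vx^(k-1)*(vx^(m-k)*vy^(i-1))))"
      for i
    unfolding delta_lift_simps partial_power power_split(3) by (simp add: ac_simps)
  have neg: "delta_lift m n 1 (- p) = - delta_lift m n 1 p" and zero: "delta_lift m n 1 0 = 0" for p
    unfolding delta_lift_simps by (simp_all add: partial_uminus partial_zero)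
  have z: "delta_lift m n 1 vz = 0"
    unfolding delta_lift_simps by simp
  show ?thesis
    unfolding mf_phi_eq mat4_map neg px py zero z of_nat_coeff_mult by (simp only: mult.assoc)
qed

lemma delta_phi_2:
  "of_nat n \<cdot>\<^sub>m map_mat (delta_lift m n 2) (mf_phi m n k l) =
    (phi4_deriv (- (2*vz*(ca+ce)*vx^(k-1))) (- (2*vz*(cb+cg)*vx^(m-k-1))) 0 0
      ((ca+cb+cg+ce)*vx^(k-1)*vx^(m-k)) :: 'a::field_char_0 ps3 mat)"
proof -
  have px: "of_nat n * delta_lift m n 2 (vx ^ i) = - (2 * (vz * (of_nat n * (of_nat i *
      vx^(i-1)))))" for i
    unfolding delta_lift_simps partial_power by (simp add: ac_simps)
  have py: "delta_lift m n 2 (vy ^ i) = 0" for i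
    unfolding delta_lift_simps partial_power by simp
  have neg: "delta_lift m n 2 (- p) = - delta_lift m n 2 p" and zero: "delta_lift m n 2 0 = 0" for p
    unfolding delta_lift_simps by (simp_all add: partial_uminus partial_zero)
  have z: "of_nat n * delta_lift m n 2 vz = of_nat m * (of_nat n * (vx^(k-1)*vx^(m-k)))"
    unfolding delta_lift_simps power_split(3) by (simp add: ac_simps)
  show ?thesis
    unfolding mf_phi_eq mat4_map mat4_smult neg mult_minus_right px py zero mult_zero_right z
        of_nat_coeff_mult
    by (simp only: mult.assoc minus_zero)
qed

lemma delta_phi_3:
  "of_nat m \<cdot>\<^sub>m map_mat (delta_lift m n 3) (mf_phi m n k l) =
    (phi4_deriv 0 0 (- (2*vz*(ca+cg)*vy^(l-1))) (- (2*vz*(cb+ce)*vy^(n-l-1)))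
      ((ca+cb+cg+ce)*vy^(l-1)*vy^(n-l)) :: 'a::field_char_0 ps3 mat)"
proof -
  have py: "of_nat m * delta_lift m n 3 (vy ^ i) = - (2 * (vz * (of_nat m * (of_nat i *
      vy^(i-1)))))" for i
    unfolding delta_lift_simps partial_power by (simp add: ac_simps)
  have px: "delta_lift m n 3 (vx ^ i) = 0" for i
    unfolding delta_lift_simps partial_power by simp
  have neg: "delta_lift m n 3 (- p) = - delta_lift m n 3 p" and zero: "delta_lift m n 3 0 = 0" for p
    unfolding delta_lift_simps by (simp_all add: partial_uminus partial_zero)
  have z: "of_nat m * delta_lift m n 3 vz = of_nat m * (of_nat n * (vy^(l-1)*vy^(n-l)))"
    unfolding delta_lift_simps power_split(4) by (simp add: ac_simps)
  show ?thesis
    unfolding mf_phi_eq mat4_map mat4_smult neg mult_minus_right px py zero mult_zero_right z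
        of_nat_coeff_mult
    by (simp only: mult.assoc minus_zero)
qed

text \<open>
  For \<open>k = m\<close> regularity forces \<open>n = 2l\<close>, and for \<open>l = n\<close> it forces \<open>m = 2k\<close>; in the first case \<open>b = g = 0\<close>, in
  the second \<open>b = e = 0\<close>.
\<close>

lemma regular_coeff:
  assumes "conn_entries_regular TYPE('a::field_char_0) m n k l"
  shows "cb * vx ^ (m - k) = (cb * (vx * vx ^ (m - k - 1)) :: 'a ps3)"
    "cg * vx ^ (m - k) = (cg * (vx * vx ^ (m - k - 1)) :: 'a ps3)"
    "cb * vy ^ (n - l) = (cb * (vy * vy ^ (n - l - 1)) :: 'a ps3)"
    "ce * vy ^ (n - l) = (ce * (vy * vy ^ (n - l - 1)) :: 'a ps3)"
proof -
  have reg: "(k < m \<or> n = 2 * l) \<and> (l < n \<or> m = 2 * k)"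
    using conn_entries_regular_iff[OF k l] assms by blast
  have "coeff_b m n k l = (0::'a)" "coeff_g m n k l = (0::'a)" if "\<not> k < m"
    using that reg k by (simp_all add: coeff_defs field_simps)
  moreover have "coeff_b m n k l = (0::'a)" "coeff_e m n k l = (0::'a)" if "\<not> l < n"
    using that reg l by (simp_all add: coeff_defs field_simps)
  moreover have "(vx ^ (m - k) :: 'a ps3) = vx * vx ^ (m - k - 1)" if "k < m"
    using that by (intro power_pred) simp
  moreover have "(vy ^ (n - l) :: 'a ps3) = vy * vy ^ (n - l - 1)" if "l < n"
    using that by (intro power_pred) simp
  ultimately show "cb * vx ^ (m - k) = (cb * (vx * vx ^ (m - k - 1)) :: 'a ps3)"
    "cg * vx ^ (m - k) = (cg * (vx * vx ^ (m - k - 1)) :: 'a ps3)"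
    "cb * vy ^ (n - l) = (cb * (vy * vy ^ (n - l - 1)) :: 'a ps3)"
    "ce * vy ^ (n - l) = (ce * (vy * vy ^ (n - l - 1)) :: 'a ps3)"
    by (metis cst_simps(5) mult_zero_left)+
qed

context
  assumes regular: "conn_entries_regular TYPE('a::field_char_0) m n k l"
begin

lemmas identity_hyps = regular_coeff[OF regular] of_nat_coeff(6)[where 'a = 'a]
  power_split(1,2)[where 'a = 'a]

text \<open>
  This is the condition for \<open>\<delta>_s + A_s\<close> to map the image of \<open>\<phi>\<close> into itself.
\<close>

lemma connection_compatible:
  assumes "s < 4"
  shows "\<exists>C\<in>carrier_mat 4 4. map_mat (delta_lift m n s) (mf_phi m n k l) + conn_lift m n k l s *
      mf_phi m n k l
    = (mf_phi m n k l * C :: 'a ps3 mat)"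
proof -
  note conn_carrier = conn_lift_carrier[OF assms, of m n k l, where 'a = 'a]
  have scaled: "of_nat i \<cdot>\<^sub>m (map_mat (delta_lift m n s) (mf_phi m n k l) + conn_lift m n k l s *
      mf_phi m n k l) =
      of_nat i \<cdot>\<^sub>m map_mat (delta_lift m n s) (mf_phi m n k l) + (of_nat i \<cdot>\<^sub>m conn_lift m n k l
          s) * (mf_phi m n k l :: 'a ps3 mat)"
    for i
    using mult_smult_assoc_mat[OF conn_carrier mf_carrier(1), of "of_nat i" m n k l]
      mult_carrier_mat[OF conn_carrier mf_carrier(1), of m n k l]
    by (simp add: add_smult_distrib_left_mat[where nr = 4 and nc = 4])
  have carrier: "map_mat (delta_lift m n s) (mf_phi m n k l) + conn_lift m n k l s * (mf_phi m n
      k l :: 'a ps3 mat) \<in> carrier_mat 4 4"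
    using mult_carrier_mat[OF conn_carrier mf_carrier(1), of m n k l] by simp
  consider "s = 0" | "s = 1" | "s = 2" | "s = 3"
    using less_4_cases[OF assms] by blast
  then show ?thesis
  proof cases
    case 1
    show ?thesis
      unfolding 1 delta_phi_0 conn_lift_0 unfolding mf_phi_eq matrix_compat_0[OF identity_hyps]
      by (rule bexI[OF refl mat4_carrier])
  next
    case 2
    show ?thesis
      unfolding 2 delta_phi_1 conn_lift_1 unfolding mf_phi_eq matrix_compat_1[OF identity_hyps]
      by (rule bexI[OF refl mat4_carrier])
  next
    case 3
    show ?thesis
    proof (rule unscale_multiple_of_phi[OF n carrier _ mat4_carrier])
      show "of_nat n \<cdot>\<^sub>m (map_mat (delta_lift m n s) (mf_phi m n k l) + conn_lift m n k l s *
          (mf_phi m n k l :: 'a ps3 mat)) =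
        mf_phi m n k l * mat_of_rows_list 4
            [[0,0,0,2*ce*vx^(k-1)],[0,0,-(2*cg*vx^(m-k-1)),0],[0,2*ca*vx^(k-1),0,0],[-(2*cb*vx^(m-k-1)),0,0,0]]"
        unfolding scaled unfolding 3 delta_phi_2 conn_lift_2 unfolding mf_phi_eq by (rule
            matrix_compat_2[OF identity_hyps])
    qed
  next
    case 4
    show ?thesis
    proof (rule unscale_multiple_of_phi[OF m carrier _ mat4_carrier])
      show "of_nat m \<cdot>\<^sub>m (map_mat (delta_lift m n s) (mf_phi m n k l) + conn_lift m n k l s *
          (mf_phi m n k l :: 'a ps3 mat)) =
        mf_phi m n k l * mat_of_rows_list 4
            [[0,0,2*ce*vy^(n-l-1),0],[0,0,0,2*cg*vy^(l-1)],[-(2*ca*vy^(l-1)),0,0,0],[0,-(2*cb*vy^(n-l-1)),0,0]]"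
        unfolding scaled unfolding 4 delta_phi_3 conn_lift_3 unfolding mf_phi_eq by (rule
            matrix_compat_3[OF identity_hyps])
    qed
  qed
qed

text \<open>
  On the generating relations between the derivations the matrix parts cancel modulo the image of \<open>\<phi>\<close>.
  The second, third and fourth relation appear divided by \<open>m\<close>, \<open>n\<close> and \<open>2\<close>.
\<close>

lemma syzygies_im:
  fixes v :: "'a ps3 vec"
  assumes v: "v \<in> carrier_vec 4"
  defines "B \<equiv> \<lambda>s. conn_lift m n k l s *\<^sub>v v"
  shows "2 * vz \<cdot>\<^sub>v B 1 + - (of_nat n * vy ^ (n - 1)) \<cdot>\<^sub>v B 2 + of_nat m * vx ^ (m - 1) \<cdot>\<^sub>v B 3 \<in>
      mf_im m n k l"
    and "vx ^ (m - 1) \<cdot>\<^sub>v B 0 + - (2 * vy) \<cdot>\<^sub>v B 1 + - (of_nat n * vz) \<cdot>\<^sub>v B 2 \<in> mf_im m n k l"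
    and "vy ^ (n - 1) \<cdot>\<^sub>v B 0 + 2 * vx \<cdot>\<^sub>v B 1 + - (of_nat m * vz) \<cdot>\<^sub>v B 3 \<in> mf_im m n k l"
    and "vz \<cdot>\<^sub>v B 0 + of_nat n * vx \<cdot>\<^sub>v B 2 + of_nat m * vy \<cdot>\<^sub>v B 3 \<in> mf_im m n k l"
proof -
  note cc = conn_lift_carrier[of _ m n k l, where 'a = 'a]
  have lin: "p \<cdot>\<^sub>v B i + q \<cdot>\<^sub>v B j + r \<cdot>\<^sub>v B h =
      (p \<cdot>\<^sub>m conn_lift m n k l i + q \<cdot>\<^sub>m conn_lift m n k l j + r \<cdot>\<^sub>m conn_lift m n k l h) *\<^sub>v v"
    if "i < 4" "j < 4" "h < 4" for p q r i j h
    using cc[OF that(1)] cc[OF that(2)] cc[OF that(3)] v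
    by (intro eq_vecI) (auto simp: B_def scalar_prod_def sum_distrib_left sum.distrib[symmetric]
        algebra_simps)
  have smult: "(p * q) \<cdot>\<^sub>m C = p \<cdot>\<^sub>m (q \<cdot>\<^sub>m C)" for p q and C :: "'a ps3 mat"
    by (intro eq_matI) (simp_all add: mult.assoc)
  have four: "0 < (4::nat)" "1 < (4::nat)" "2 < (4::nat)" "3 < (4::nat)" by simp_all
  have 2: "(of_nat n * p) \<cdot>\<^sub>m conn_lift m n k l 2 = p \<cdot>\<^sub>m conn4_2 ca cb cg ce (vx ^ (k - 1)) (vx
      ^ (m - k - 1))" for p :: "'a ps3"
    unfolding mult.commute[of "of_nat n" p] smult conn_lift_2 ..
  have 3: "(of_nat m * p) \<cdot>\<^sub>m conn_lift m n k l 3 = p \<cdot>\<^sub>m conn4_3 ca cb cg ce (vy ^ (l - 1)) (vy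
      ^ (n - l - 1))" for p :: "'a ps3"
    unfolding mult.commute[of "of_nat m" p] smult conn_lift_3 ..
  note syz = matrix_syzygy_koszul[where z = vz, OF identity_hyps] matrix_syzygy_x[where z = vz,
      OF identity_hyps] matrix_syzygy_y[where z = vz, OF identity_hyps] matrix_syzygy_z[where z =
          vz, OF identity_hyps]
  note syz = syz[folded mf_phi_eq]
  have "2 * vz \<cdot>\<^sub>v B 1 + (of_nat n * - (vy ^ (n - 1))) \<cdot>\<^sub>v B 2 + of_nat m * vx ^ (m - 1) \<cdot>\<^sub>v B 3
      \<in> mf_im m n k l"
    unfolding lin[OF four(2-4)] 2 3 power_split(3,4) conn_lift_1
    by (rule multiple_of_phi_im[OF syz(1) mat4_carrier v])
  then show "2 * vz \<cdot>\<^sub>v B 1 + - (of_nat n * vy ^ (n - 1)) \<cdot>\<^sub>v B 2 + of_nat m * vx ^ (m - 1) \<cdot>\<^sub>v B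
      3 \<in> mf_im m n k l"
    by simp
  have "vx ^ (m - 1) \<cdot>\<^sub>v B 0 + - (2 * vy) \<cdot>\<^sub>v B 1 + (of_nat n * - vz) \<cdot>\<^sub>v B 2 \<in> mf_im m n k l"
    unfolding lin[OF four(1-3)] 2 3 power_split(3,4) conn_lift_1 conn_lift_0
    by (rule multiple_of_phi_im[OF syz(2) mat4_carrier v])
  then show "vx ^ (m - 1) \<cdot>\<^sub>v B 0 + - (2 * vy) \<cdot>\<^sub>v B 1 + - (of_nat n * vz) \<cdot>\<^sub>v B 2 \<in> mf_im m n k l"
    by simp
  have "vy ^ (n - 1) \<cdot>\<^sub>v B 0 + 2 * vx \<cdot>\<^sub>v B 1 + (of_nat m * - vz) \<cdot>\<^sub>v B 3 \<in> mf_im m n k l"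
    unfolding lin[OF four(1,2,4)] 2 3 power_split(3,4) conn_lift_1 conn_lift_0
    by (rule multiple_of_phi_im[OF syz(3) mat4_carrier v])
  then show "vy ^ (n - 1) \<cdot>\<^sub>v B 0 + 2 * vx \<cdot>\<^sub>v B 1 + - (of_nat m * vz) \<cdot>\<^sub>v B 3 \<in> mf_im m n k l"
    by simp
  show "vz \<cdot>\<^sub>v B 0 + of_nat n * vx \<cdot>\<^sub>v B 2 + of_nat m * vy \<cdot>\<^sub>v B 3 \<in> mf_im m n k l"
    unfolding lin[OF four(1,3,4)] 2 3 conn_lift_0
    by (rule multiple_of_phi_im[OF syz(4) mat4_carrier v])
qed

end

end

section \<open>The connection\<close>

text \<open>
  The operator \<open>\<delta>_s + A_s\<close> on \<open>P^4\<close>.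
\<close>

definition nabla_gen :: "nat \<Rightarrow> nat \<Rightarrow> nat \<Rightarrow> nat \<Rightarrow> nat \<Rightarrow> 'a::field_char_0 ps3 vec \<Rightarrow> 'a ps3 vec"
  where "nabla_gen m n k l s v = map_vec (delta_lift m n s) v + conn_lift m n k l s *\<^sub>v v"

definition nabla_lift :: "nat \<Rightarrow> nat \<Rightarrow> nat \<Rightarrow> nat \<Rightarrow> (nat \<Rightarrow> 'a::field_char_0 ps3) \<Rightarrow> 'a ps3 vec \<Rightarrow> 'a
    ps3 vec"
  where "nabla_lift m n k l c v = vec 4 (\<lambda>i. \<Sum>s<4. c s * nabla_gen m n k l s v $ i)"

lemma conn_lift_dim: "s < 4 \<Longrightarrow> dim_row (conn_lift m n k l s) = 4" "s < 4 \<Longrightarrow> dim_col (conn_lift m n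
    k l s) = 4"
  using conn_lift_carrier by blast+

lemma nabla_gen_carrier: "s < 4 \<Longrightarrow> v \<in> carrier_vec 4 \<Longrightarrow> nabla_gen m n k l s v \<in> carrier_vec 4"
  unfolding nabla_gen_def by (intro add_carrier_vec mult_mat_vec_carrier[OF conn_lift_carrier])
      simp_all

lemma nabla_lift_dim [simp]: "dim_vec (nabla_lift m n k l c v) = 4"
  by (simp add: nabla_lift_def)

lemma nabla_lift_carrier [simp]: "nabla_lift m n k l c v \<in> carrier_vec 4"
  by (simp add: nabla_lift_def)

lemma nabla_lift_nth:
  assumes "v \<in> carrier_vec 4" "i < 4"
  shows "nabla_lift m n k l c v $ i = delta_comb m n c (v $ i) + (\<Sum>s<4. c s * (conn_lift m n k l
      s *\<^sub>v v) $ i)"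
  using assms by (simp add: nabla_lift_def nabla_gen_def delta_comb_def conn_lift_dim algebra_simps
      flip: sum.distrib)

lemma nabla_lift_add:
  assumes "v \<in> carrier_vec 4" "w \<in> carrier_vec 4"
  shows "nabla_lift m n k l c (v + w) = nabla_lift m n k l c v + nabla_lift m n k l c w"
proof (rule eq_vecI)
  fix i assume "i < dim_vec (nabla_lift m n k l c v + nabla_lift m n k l c w)"
  then have i: "i < 4" by (simp add: nabla_lift_def)
  have "(\<Sum>s<4. c s * (conn_lift m n k l s *\<^sub>v (v + w)) $ i) =
      (\<Sum>s<4. c s * (conn_lift m n k l s *\<^sub>v v) $ i + c s * (conn_lift m n k l s *\<^sub>v w) $ i)"
    using assms i
    by (intro sum.cong refl) (simp add: mult_add_distrib_mat_vec[OF conn_lift_carrier]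
        conn_lift_dim distrib_left)
  then show "nabla_lift m n k l c (v + w) $ i = (nabla_lift m n k l c v + nabla_lift m n k l c w)
      $ i"
    using assms i
    by (simp add: nabla_lift_nth delta_comb_add sum.distrib algebra_simps)
qed (simp add: nabla_lift_def)

lemma nabla_lift_smult:
  assumes "v \<in> carrier_vec 4"
  shows "nabla_lift m n k l c (p \<cdot>\<^sub>v v) = p \<cdot>\<^sub>v nabla_lift m n k l c v + delta_comb m n c p \<cdot>\<^sub>v v"
proof (rule eq_vecI)
  fix i assume "i < dim_vec (p \<cdot>\<^sub>v nabla_lift m n k l c v + delta_comb m n c p \<cdot>\<^sub>v v)"
  then have i: "i < 4" using assms by simp
  have "(\<Sum>s<4. c s * (conn_lift m n k l s *\<^sub>v (p \<cdot>\<^sub>v v)) $ i) =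
      (\<Sum>s<4. p * (c s * (conn_lift m n k l s *\<^sub>v v) $ i))"
    using assms i
    by (intro sum.cong refl) (simp add: conn_lift_dim scalar_prod_def sum_distrib_left ac_simps)
  then show "nabla_lift m n k l c (p \<cdot>\<^sub>v v) $ i = (p \<cdot>\<^sub>v nabla_lift m n k l c v + delta_comb m n
      c p \<cdot>\<^sub>v v) $ i"
    using assms i
    by (simp add: nabla_lift_nth delta_comb_mult sum_distrib_left algebra_simps)
qed (use assms in \<open>simp add: nabla_lift_def\<close>)

lemma nabla_lift_coeff:
  "nabla_lift m n k l (\<lambda>i. c i + c' i) v = nabla_lift m n k l c v + nabla_lift m n k l c' v"
  "nabla_lift m n k l (\<lambda>i. c i - c' i) v = nabla_lift m n k l c v - nabla_lift m n k l c' v"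
  "nabla_lift m n k l (\<lambda>i. p * c i) v = p \<cdot>\<^sub>v nabla_lift m n k l c v"
  by (auto simp: nabla_lift_def algebra_simps sum.distrib sum_subtractf sum_distrib_left
      intro!: eq_vecI)

lemma nabla_lift_unit:
  "s < 4 \<Longrightarrow> v \<in> carrier_vec 4 \<Longrightarrow> nabla_lift m n k l (unit_coeff s) v = nabla_gen m n k l s v"
  using nabla_gen_carrier[of s v m n k l]
  by (intro eq_vecI) (auto simp: nabla_lift_def of_bool_def mult_delta_left)

lemma mf_im_sum:
  assumes "finite S" and "\<And>s. s \<in> S \<Longrightarrow> w s \<in> mf_im m n k l"
  shows "vec 4 (\<lambda>i. \<Sum>s\<in>S. c s * w s $ i) \<in> mf_im m n k l"
  using assms
proof (induction S rule: finite_induct)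
  case empty
  have "vec 4 (\<lambda>i. \<Sum>s\<in>{}. c s * w s $ i) = 0\<^sub>v 4" by (intro eq_vecI) simp_all
  then show ?case using mf_im_zero by metis
next
  case (insert s S)
  have "vec 4 (\<lambda>i. \<Sum>s\<in>insert s S. c s * w s $ i) = c s \<cdot>\<^sub>v w s + vec 4 (\<lambda>i. \<Sum>s\<in>S. c s * w s $ i)"
    using insert.hyps mf_im_carrier[OF insert.prems[of s]] by (intro eq_vecI) auto
  then show ?case
    using insert by (simp add: mf_im_add mf_im_smult)
qed

lemma delta_lift_mult_mat_vec:
  assumes s: "s < 4" and B: "B \<in> carrier_mat 4 4" and u: "u \<in> carrier_vec 4"
  shows "map_vec (delta_lift m n s) (B *\<^sub>v u) =
    map_mat (delta_lift m n s) B *\<^sub>v u + B *\<^sub>v map_vec (delta_lift m n s) u"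
proof (rule eq_vecI)
  have zero: "delta_lift m n s 0 = 0"
    using delta_comb_0[of m n "unit_coeff s"] by (simp only: delta_comb_unit[OF s])
  have add: "delta_lift m n s (p + q) = delta_lift m n s p + delta_lift m n s q" for p q
    using delta_comb_add[of m n "unit_coeff s" p q] by (simp only: delta_comb_unit[OF s])
  have dsum: "delta_lift m n s (sum g S) = (\<Sum>j\<in>S. delta_lift m n s (g j))" if "finite S" for g
      and S :: "nat set"
    using that by (induction S) (simp_all add: zero add)
  have mult: "delta_lift m n s (p * q) = delta_lift m n s p * q + p * delta_lift m n s q" for p q
    using delta_comb_mult[of m n "unit_coeff s" p q] by (simp add: delta_comb_unit[OF s]
        mult.commute)
  fix i assume "i < dim_vec (map_mat (delta_lift m n s) B *\<^sub>v u + B *\<^sub>v map_vec (delta_lift m n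
      s) u)"
  then show "map_vec (delta_lift m n s) (B *\<^sub>v u) $ i =
      (map_mat (delta_lift m n s) B *\<^sub>v u + B *\<^sub>v map_vec (delta_lift m n s) u) $ i"
    using B u by (auto simp: scalar_prod_def dsum mult sum.distrib)
qed simp

context
  fixes m n k l :: nat
  assumes m: "0 < m" and n: "0 < n" and k: "1 \<le> k" "k \<le> m" and l: "1 \<le> l" "l \<le> n"
    and regular: "conn_entries_regular TYPE('a::field_char_0) m n k l"
begin

lemma nabla_gen_im:
  fixes v :: "'a ps3 vec"
  assumes s: "s < 4" and v: "v \<in> mf_im m n k l"
  shows "nabla_gen m n k l s v \<in> mf_im m n k l"
proof -
  obtain u where u: "u \<in> carrier_vec 4" "v = mf_phi m n k l *\<^sub>v u"
    using v unfolding mf_im_def by blast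
  obtain C where C: "C \<in> carrier_mat 4 4"
    "map_mat (delta_lift m n s) (mf_phi m n k l) + conn_lift m n k l s * mf_phi m n k l = (mf_phi
        m n k l * C :: 'a ps3 mat)"
    using connection_compatible[OF m n k l regular s] by blast
  note cc = conn_lift_carrier[OF s, of m n k l, where 'a = 'a]
  have du: "map_vec (delta_lift m n s) u \<in> carrier_vec 4" using u(1) by simp
  have dphi: "map_mat (delta_lift m n s) (mf_phi m n k l) \<in> carrier_mat 4 4" by simp
  have swap: "a + b + c = a + c + b"
    if "a \<in> carrier_vec 4" "b \<in> carrier_vec 4" "c \<in> carrier_vec 4" for a b c :: "'a ps3 vec"
    using that by (intro eq_vecI) auto
  have "nabla_gen m n k l s v =
      (map_mat (delta_lift m n s) (mf_phi m n k l) *\<^sub>v u + mf_phi m n k l *\<^sub>v map_vec (delta_lift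
          m n s) u)
      + (conn_lift m n k l s * mf_phi m n k l) *\<^sub>v u"
    unfolding nabla_gen_def u(2) delta_lift_mult_mat_vec[OF s mf_carrier(1) u(1)]
      assoc_mult_mat_vec[OF cc mf_carrier(1) u(1)] ..
  also have "\<dots> = (mf_phi m n k l * C) *\<^sub>v u + mf_phi m n k l *\<^sub>v map_vec (delta_lift m n s) u"
    unfolding C(2)[symmetric] add_mult_distrib_mat_vec[OF dphi mult_carrier_mat[OF cc
        mf_carrier(1)] u(1)]
    by (rule swap[OF mult_mat_vec_carrier[OF dphi u(1)] mult_mat_vec_carrier[OF mf_carrier(1) du]
      mult_mat_vec_carrier[OF mult_carrier_mat[OF cc mf_carrier(1)] u(1)]])
  also have "\<dots> \<in> mf_im m n k l"
  proof (rule mf_im_add)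
    show "(mf_phi m n k l * C) *\<^sub>v u \<in> mf_im m n k l"
      by (rule multiple_of_phi_im[OF refl C(1) u(1)])
    show "mf_phi m n k l *\<^sub>v map_vec (delta_lift m n s) u \<in> mf_im m n k l"
      unfolding mf_im_def using du by (rule imageI)
  qed
  finally show ?thesis .
qed

lemma nabla_lift_im:
  fixes v :: "'a ps3 vec"
  assumes "v \<in> mf_im m n k l"
  shows "nabla_lift m n k l c v \<in> mf_im m n k l"
  unfolding nabla_lift_def using nabla_gen_im[OF _ assms] by (intro mf_im_sum) auto

text \<open>
  A combination of the \<open>\<delta>_s\<close> that is zero on \<open>A\<close> acts as zero on \<open>W\<close>.  Subtracting the
  combination \<open>R\<close> of the four elements of \<open>syzygies_im\<close> removes the matrix part altogether and
  leaves a vector with entries divisible by \<open>f\<close>.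
\<close>

lemma nabla_lift_syzygy:
  fixes v :: "'a ps3 vec"
  assumes v: "v \<in> carrier_vec 4" and dvd: "\<And>p. hyp_eq m n dvd delta_comb m n c p"
  shows "nabla_lift m n k l c v \<in> mf_im m n k l"
proof -
  obtain u1 u2 u3 t where c:
    "c 0 = of_nat m * vx ^ (m - 1) * u1 + of_nat n * vy ^ (n - 1) * u2 + 2 * vz * u3"
    "c 1 = - (of_nat (2 * m) * vy * u1) + of_nat (2 * n) * vx * u2 + 2 * vz * t"
    "c 2 = - (of_nat (m * n) * vz * u1) + of_nat (2 * n) * vx * u3 - of_nat n * vy ^ (n - 1) * t"
    "c 3 = - (of_nat (m * n) * vz * u2) + of_nat (2 * m) * vy * u3 + of_nat m * vx ^ (m - 1) * t"
    by (rule delta_comb_syzygy[OF m n dvd])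
  define B where "B s = conn_lift m n k l s *\<^sub>v v" for s
  have B: "dim_vec (B s) = 4" if "s < 4" for s
    using that by (simp add: B_def conn_lift_dim)
  note Bd = B[of 0] B[of 1] B[of 2] B[of 3]
  define S0 where "S0 = 2 * vz \<cdot>\<^sub>v B 1 + - (of_nat n * vy ^ (n - 1)) \<cdot>\<^sub>v B 2 + of_nat m * vx ^ (m
      - 1) \<cdot>\<^sub>v B 3"
  define S1 where "S1 = vx ^ (m - 1) \<cdot>\<^sub>v B 0 + - (2 * vy) \<cdot>\<^sub>v B 1 + - (of_nat n * vz) \<cdot>\<^sub>v B 2"
  define S2 where "S2 = vy ^ (n - 1) \<cdot>\<^sub>v B 0 + 2 * vx \<cdot>\<^sub>v B 1 + - (of_nat m * vz) \<cdot>\<^sub>v B 3"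
  define S3 where "S3 = vz \<cdot>\<^sub>v B 0 + of_nat n * vx \<cdot>\<^sub>v B 2 + of_nat m * vy \<cdot>\<^sub>v B 3"
  have S: "S0 \<in> mf_im m n k l" "S1 \<in> mf_im m n k l" "S2 \<in> mf_im m n k l" "S3 \<in> mf_im m n k l"
    using syzygies_im[OF m n k l regular v] unfolding S0_def S1_def S2_def S3_def B_def by blast+
  define R where "R = t \<cdot>\<^sub>v S0 + (of_nat m * u1) \<cdot>\<^sub>v S1 + (of_nat n * u2) \<cdot>\<^sub>v S2 + (2 * u3) \<cdot>\<^sub>v S3"
  have R: "R \<in> mf_im m n k l"
    unfolding R_def by (intro mf_im_add mf_im_smult S)
  note Rc = mf_im_carrier[OF R]
  have "(nabla_lift m n k l c v - R) $ i = delta_comb m n c (v $ i)" if "i < 4" for i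
    using that v carrier_vecD[OF Rc] Bd
    by (simp add: nabla_lift_nth sum_less_4 flip: B_def)
      (simp add: c c(2)[unfolded One_nat_def] R_def S0_def S1_def S2_def S3_def algebra_simps)
  then have "nabla_lift m n k l c v - R \<in> mf_im m n k l"
    using dvd Rc by (intro mf_im_dvd k l) auto
  from mf_im_add[OF this R] have "nabla_lift m n k l c v - R + R \<in> mf_im m n k l" .
  also have "nabla_lift m n k l c v - R + R = nabla_lift m n k l c v"
    using carrier_vecD[OF Rc] by (intro eq_vecI) simp_all
  finally show ?thesis .
qed

definition nabla :: "(nat \<Rightarrow> 'a ps3) \<Rightarrow> 'a ps3 set vec set \<Rightarrow> 'a ps3 set vec set"
  where "nabla c = (\<lambda>w\<in>carrier (mf_module m n k l).
    coker_class m n k l (nabla_lift m n k l c (SOME v. v \<in> carrier_vec 4 \<and> w = coker_class m n k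
        l v)))"

lemma nabla_apply [simp]:
  assumes v: "v \<in> carrier_vec 4"
  shows "nabla c (coker_class m n k l v) = coker_class m n k l (nabla_lift m n k l c v)"
proof -
  define u where "u = (SOME u. u \<in> carrier_vec 4 \<and> coker_class m n k l v = coker_class m n k l u)"
  have u: "u \<in> carrier_vec 4" "coker_class m n k l v = coker_class m n k l u"
    unfolding u_def by (rule someI2[where a = v]; use v in simp)+
  have uv: "u - v \<in> mf_im m n k l"
    using u coker_class_eq_iff[OF k(2) l(2) u(1) v] by simp
  have uc: "u = (u - v) + v"
    using u v by (intro eq_vecI) auto
  have "nabla_lift m n k l c u = nabla_lift m n k l c (u - v) + nabla_lift m n k l c v"
    by (subst uc) (rule nabla_lift_add[OF mf_im_carrier[OF uv] v])
  then have "nabla_lift m n k l c u - nabla_lift m n k l c v = nabla_lift m n k l c (u - v)"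
    by (intro eq_vecI) simp_all
  then have "coker_class m n k l (nabla_lift m n k l c u) = coker_class m n k l (nabla_lift m n k
      l c v)"
    using nabla_lift_im[OF uv] by (simp add: coker_class_eq_iff[OF k(2) l(2)])
  then show ?thesis
    using v by (simp add: nabla_def u_def)
qed

lemma nabla_extensional: "nabla c \<in> extensional (carrier (mf_module m n k l))"
  by (simp add: nabla_def)

lemma mf_module_map_eqI:
  assumes "f \<in> extensional (carrier (mf_module m n k l))" "g \<in> extensional (carrier (mf_module m
      n k l))"
    and "\<And>v :: 'a ps3 vec. v \<in> carrier_vec 4 \<Longrightarrow> f (coker_class m n k l v) = g (coker_class m n k l
        v)"
  shows "f = g"
  using assms(1,2) by (rule extensionalityI) (auto elim!: mf_module_carrierE simp: assms(3))

abbreviation (input) "End_W \<equiv> End (ground_field m n) (hyp_ring m n) (mf_module m n k l :: ('a ps3 set, _)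
    module)"

lemma nabla_End: "nabla c \<in> carrier End_W"
proof -
  have "nabla c \<in> carrier (mf_module m n k l) \<rightarrow>\<^sub>E carrier (mf_module m n k l)"
    using nabla_extensional by (auto simp: PiE_def elim!: mf_module_carrierE)
  moreover have "nabla c (a \<odot>\<^bsub>mf_module m n k l\<^esub> w) = a \<odot>\<^bsub>mf_module m n k l\<^esub> nabla c w"
    if "a \<in> ground_field m n" "w \<in> carrier (mf_module m n k l)" for a w
  proof -
    obtain b v where "a = hyp_class m n (cst b)" "v \<in> carrier_vec 4" "w = coker_class m n k l v"
      using \<open>a \<in> _\<close> \<open>w \<in> _\<close> by (auto simp: ground_field_def elim!: mf_module_carrierE)
    moreover have "0 \<cdot>\<^sub>v v = (0\<^sub>v 4 :: 'a ps3 vec)" if "v \<in> carrier_vec 4" for v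
      using that by (intro eq_vecI) auto
    ultimately show ?thesis
      using k l by (simp add: nabla_lift_smult)
  qed
  ultimately show ?thesis
    by (auto simp: End_def nabla_lift_add elim!: mf_module_carrierE)
qed

lemma nabla_leibniz:
  assumes "a \<in> carrier (hyp_ring m n)" "w \<in> carrier (mf_module m n k l)"
  shows "nabla c (a \<odot>\<^bsub>mf_module m n k l\<^esub> w) =
    (a \<odot>\<^bsub>mf_module m n k l\<^esub> nabla c w) \<oplus>\<^bsub>mf_module m n k l\<^esub> (delta_class m n c a \<odot>\<^bsub>mf_module m n
        k l\<^esub> w)"
  using assms k l
  by (auto elim!: hyp_ring_carrierE mf_module_carrierE simp: nabla_lift_smult
      delta_class_apply[OF m n])

text \<open>
  The operator depends on the derivation only and not on the coefficients that express it; this is what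
  makes the connection well defined and linear over \<open>A\<close>.
\<close>

lemma nabla_cong:
  assumes "delta_class m n c = delta_class m n c'"
  shows "nabla c = nabla c'"
proof (rule mf_module_map_eqI[OF nabla_extensional nabla_extensional])
  fix v :: "'a ps3 vec" assume v: "v \<in> carrier_vec 4"
  have "nabla_lift m n k l (\<lambda>i. c i - c' i) v \<in> mf_im m n k l"
    using assms by (intro nabla_lift_syzygy v) (simp add: delta_class_eq_iff[OF m n])
  then show "nabla c (coker_class m n k l v) = nabla c' (coker_class m n k l v)"
    using v by (simp add: coker_class_eq_iff[OF k(2) l(2)] nabla_lift_coeff)
qed

lemma nabla_add: "nabla (\<lambda>i. c i + c' i) = nabla c \<oplus>\<^bsub>End_W\<^esub> nabla c'"
  by (rule mf_module_map_eqI[OF nabla_extensional]) (simp_all add: End_def nabla_lift_coeff)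

lemma nabla_smult: "nabla (\<lambda>i. p * c i) = hyp_class m n p \<odot>\<^bsub>End_W\<^esub> nabla c"
  by (rule mf_module_map_eqI[OF nabla_extensional]) (simp_all add: End_def nabla_lift_coeff k l)

lemma nabla_unit:
  assumes "s < 4" "v \<in> carrier_vec 4"
  shows "nabla (unit_coeff s) (coker_class m n k l v) = mf_submodule m n k l +>\<^bsub>free_module
      (hyp_ring m n) 4\<^esub>
    (map_vec (delta m n s) (vec_class m n v) \<oplus>\<^bsub>free_module (hyp_ring m n) 4\<^esub>
      mat_apply (hyp_ring m n) (conn_matrix m n k l s) (vec_class m n v))"
proof -
  have d: "delta m n s (hyp_class m n p) = hyp_class m n (delta_lift m n s p)" for p :: "'a ps3"
    using assms(1) by (simp add: delta_eq_delta_class[OF m n] delta_class_apply[OF m n]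
        delta_comb_unit)
  have "map_vec (delta m n s) (vec_class m n v) = vec_class m n (map_vec (delta_lift m n s) v)"
    by (intro eq_vecI) (simp_all add: d)
  moreover have "mat_apply (hyp_ring m n) (conn_matrix m n k l s) (vec_class m n v) = vec_class m
      n (conn_lift m n k l s *\<^sub>v v)"
    unfolding conn_matrix_eq using assms by (intro mat_apply_class) (simp add: conn_lift_dim)
  moreover have "conn_lift m n k l s *\<^sub>v v \<in> carrier_vec 4"
    by (rule mult_mat_vec_carrier[OF conn_lift_carrier[OF assms(1)] assms(2)])
  ultimately show ?thesis
    unfolding nabla_apply[OF assms(2)] nabla_lift_unit[OF assms] nabla_gen_def
    using assms(2) by (simp add: coker_class_def free_module_ops)
qed

lemma linear_Lie_Rinehart_eq:
  "linear_Lie_Rinehart (ground_field m n) (hyp_ring m n) (mf_module m n k l :: ('a ps3 set, _)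
      module) =
    derivations (ground_field m n) (hyp_ring m n)"
proof (rule module.linear_Lie_Rinehart_eq_derivations[OF mf_module_module[OF k(2) l(2)]
    ground_field_subset[OF m n]])
  fix d :: "'a ps3 set \<Rightarrow> 'a ps3 set"
  assume "d \<in> derivations (ground_field m n) (hyp_ring m n)"
  then obtain c where "d = delta_class m n c"
    by (rule derivation_eq_delta_class[OF m n])
  then show "\<exists>h\<in>carrier End_W. \<forall>a\<in>carrier (hyp_ring m n). \<forall>w\<in>carrier (mf_module m n k l).
      h (a \<odot>\<^bsub>mf_module m n k l\<^esub> w) =
      (a \<odot>\<^bsub>mf_module m n k l\<^esub> h w) \<oplus>\<^bsub>mf_module m n k l\<^esub> (d a \<odot>\<^bsub>mf_module m n k l\<^esub> w)"
    using nabla_End nabla_leibniz by blast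
qed

definition mf_connection :: "('a ps3 set \<Rightarrow> 'a ps3 set) \<Rightarrow> 'a ps3 set vec set \<Rightarrow> 'a ps3 set vec set"
  where "mf_connection = (\<lambda>d\<in>range (delta_class m n). nabla (SOME c. d = delta_class m n c))"

lemma mf_connection_apply: "mf_connection (delta_class m n c) = nabla c"
proof -
  have "mf_connection (delta_class m n c) = nabla (SOME c'. delta_class m n c = delta_class m n c')"
    unfolding mf_connection_def by simp
  also have "\<dots> = nabla c"
    by (rule nabla_cong[symmetric], rule someI[where x = c], rule refl)
  finally show ?thesis .
qed

lemma mf_connection_is_connection:
  "is_connection (ground_field m n) (hyp_ring m n) (mf_module m n k l) (range (delta_class m n))
      mf_connection"
  unfolding is_connection_def
proof (intro conjI ballI)
  show "mf_connection \<in> range (delta_class m n) \<rightarrow>\<^sub>E carrier End_W"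
  proof (rule PiE_I)
    show "mf_connection d \<in> carrier End_W" if "d \<in> range (delta_class m n)" for d
      using that nabla_End by (auto simp: mf_connection_apply)
  qed (simp add: mf_connection_def)
next
  fix d e :: "'a ps3 set \<Rightarrow> 'a ps3 set"
  assume "d \<in> range (delta_class m n)" "e \<in> range (delta_class m n)"
  then show "mf_connection (d \<oplus>\<^bsub>Der (ground_field m n) (hyp_ring m n)\<^esub> e) = mf_connection d
      \<oplus>\<^bsub>End_W\<^esub> mf_connection e"
    by (auto simp: Der_ops[OF m n] mf_connection_apply nabla_add)
next
  fix a :: "'a ps3 set" and d :: "'a ps3 set \<Rightarrow> 'a ps3 set"
  assume "a \<in> carrier (hyp_ring m n)" "d \<in> range (delta_class m n)"
  then show "mf_connection (a \<odot>\<^bsub>Der (ground_field m n) (hyp_ring m n)\<^esub> d) = a \<odot>\<^bsub>End_W\<^esub>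
      mf_connection d"
    by (auto elim!: hyp_ring_carrierE simp: Der_ops[OF m n] mf_connection_apply nabla_smult)
next
  fix d :: "'a ps3 set \<Rightarrow> 'a ps3 set" and a :: "'a ps3 set" and w :: "'a ps3 set vec set"
  assume "d \<in> range (delta_class m n)" "a \<in> carrier (hyp_ring m n)" "w \<in> carrier (mf_module m n k
      l)"
  then show "mf_connection d (a \<odot>\<^bsub>mf_module m n k l\<^esub> w) =
      (a \<odot>\<^bsub>mf_module m n k l\<^esub> mf_connection d w) \<oplus>\<^bsub>mf_module m n k l\<^esub> (d a \<odot>\<^bsub>mf_module m n k l\<^esub> w)"
    using nabla_leibniz by (auto simp: mf_connection_apply)
qed

lemma mf_connection_unique:
  assumes conn: "is_connection (ground_field m n) (hyp_ring m n) (mf_module m n k l) (range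
      (delta_class m n)) conn"
    and gen: "\<And>s v. s < 4 \<Longrightarrow> v \<in> carrier_vec 4 \<Longrightarrow>
      conn (delta m n s) (coker_class m n k l v) = nabla (unit_coeff s) (coker_class m n k l v)"
  shows "conn = mf_connection"
proof (rule extensionalityI)
  show "conn \<in> extensional (range (delta_class m n))" "mf_connection \<in> extensional (range
      (delta_class m n))"
    using conn mf_connection_is_connection by (simp_all add: is_connection_def PiE_def)
  have add: "conn (delta_class m n (\<lambda>i. c i + c' i)) = conn (delta_class m n c) \<oplus>\<^bsub>End_W\<^esub> conn
      (delta_class m n c')" for c c'
    using conn unfolding is_connection_def Der_ops(3)[OF m n, symmetric] by simp
  have smult: "conn (delta_class m n (\<lambda>i. p * c i)) = hyp_class m n p \<odot>\<^bsub>End_W\<^esub> conn (delta_class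
      m n c)" for p c
    using conn unfolding is_connection_def Der_ops(4)[OF m n, symmetric] by simp
  have unit: "conn (delta_class m n (unit_coeff s)) = nabla (unit_coeff s)" if s: "s < 4" for s
  proof (rule mf_module_map_eqI[OF _ nabla_extensional])
    have "conn (delta_class m n (unit_coeff s)) \<in> carrier End_W"
      using conn by (auto simp: is_connection_def)
    then show "conn (delta_class m n (unit_coeff s)) \<in> extensional (carrier (mf_module m n k l))"
      by (simp add: End_def PiE_def)
  qed (use gen[OF s] in \<open>simp add: delta_eq_delta_class[OF m n s]\<close>)
  have scaled: "conn (delta_class m n (\<lambda>i. c s * unit_coeff s i)) = nabla (\<lambda>i. c s * unit_coeff s
      i)" if "s < 4" for s and c :: "nat \<Rightarrow> 'a ps3"
    unfolding smult nabla_smult unit[OF that] ..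
  fix d :: "'a ps3 set \<Rightarrow> 'a ps3 set" assume "d \<in> range (delta_class m n)"
  then obtain c :: "nat \<Rightarrow> 'a ps3" where d: "d = delta_class m n c" by blast
  let ?c = "\<lambda>i :: nat. ((c 0 * unit_coeff 0 i + c 1 * unit_coeff 1 i) + c 2 * unit_coeff 2 i) + c
      3 * unit_coeff 3 i"
  have d': "d = delta_class m n ?c"
    unfolding d by (rule delta_class_cong[OF m n]) (drule less_4_cases, auto)
  have "conn (delta_class m n ?c) = nabla ?c"
    unfolding add nabla_add by (simp add: scaled)
  then show "conn d = mf_connection d"
    unfolding d' mf_connection_apply .
qed

end

theorem theorem2p1:
  fixes m n k l :: nat
    and A :: "'a::field_char_0 ps3 set ring"
    and F W N V
  defines "A \<equiv> hyp_ring m n"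
    and "F \<equiv> ground_field m n"
    and "W \<equiv> mf_module m n k l"
    and "N \<equiv> mf_submodule m n k l"
    and "V \<equiv> linear_Lie_Rinehart F A W"
  assumes "0 < m" and "0 < n"
    and "1 \<le> k" and "k \<le> m" and "1 \<le> l" and "l \<le> n"
    and "conn_entries_regular TYPE('a) m n k l"
  shows "V = derivations F A \<and>
    (\<forall>s<4. delta m n s \<in> V) \<and>
    (\<forall>d\<in>V. \<exists>c \<in> {..<4} \<rightarrow> carrier A.
       d = (\<Oplus>\<^bsub>Der F A\<^esub>s\<in>{..<4}. c s \<odot>\<^bsub>Der F A\<^esub> delta m n s)) \<and>
    (\<exists>!conn. is_connection F A W V conn \<and>
       (\<forall>s<4. \<forall>a\<in>carrier (free_module A 4).
          conn (delta m n s) (N +>\<^bsub>free_module A 4\<^esub> a) =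
          N +>\<^bsub>free_module A 4\<^esub>
            (map_vec (delta m n s) a \<oplus>\<^bsub>free_module A 4\<^esub> mat_apply A (conn_matrix m n k l s) a)))"
proof -
  note mn = \<open>0 < m\<close> \<open>0 < n\<close>
  note hyps = mn \<open>1 \<le> k\<close> \<open>k \<le> m\<close> \<open>1 \<le> l\<close> \<open>l \<le> n\<close> \<open>conn_entries_regular TYPE('a) m n k l\<close>
  have V: "V = derivations F A"
    unfolding V_def F_def A_def W_def by (rule linear_Lie_Rinehart_eq[OF hyps])
  have range: "V = range (delta_class m n)"
    unfolding V F_def A_def by (rule derivations_eq[OF mn])
  have delta: "\<forall>s<4. delta m n s \<in> V"
    unfolding range by (simp add: delta_eq_delta_class[OF mn])
  have generate: "\<forall>d\<in>V. \<exists>c \<in> {..<4} \<rightarrow> carrier A.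
       d = (\<Oplus>\<^bsub>Der F A\<^esub>s\<in>{..<4}. c s \<odot>\<^bsub>Der F A\<^esub> delta m n s)"
  proof
    fix d assume "d \<in> V"
    then obtain c where "d = delta_class m n c"
      unfolding range by blast
    then show "\<exists>c \<in> {..<4} \<rightarrow> carrier A. d = (\<Oplus>\<^bsub>Der F A\<^esub>s\<in>{..<4}. c s \<odot>\<^bsub>Der F A\<^esub> delta m n s)"
      unfolding F_def A_def
      by (intro bexI[of _ "\<lambda>s. hyp_class m n (c s)"]) (simp_all add: delta_class_expand[OF mn])
  qed
  let ?conn = "mf_connection m n k l :: ('a ps3 set \<Rightarrow> _) \<Rightarrow> _"
  have formula: "conn (delta m n s) (N +>\<^bsub>free_module A 4\<^esub> a) =
          N +>\<^bsub>free_module A 4\<^esub>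
            (map_vec (delta m n s) a \<oplus>\<^bsub>free_module A 4\<^esub> mat_apply A (conn_matrix m n k l s) a)
      \<longleftrightarrow> conn (delta m n s) (coker_class m n k l v) = nabla m n k l (unit_coeff s) (coker_class m
          n k l v)"
    if "s < 4" "v \<in> carrier_vec 4" "a = vec_class m n v" for s a conn v
  proof -
    have "N +>\<^bsub>free_module A 4\<^esub> a = coker_class m n k l v"
      unfolding N_def A_def that(3) coker_class_def ..
    moreover have "N +>\<^bsub>free_module A 4\<^esub> (map_vec (delta m n s) a \<oplus>\<^bsub>free_module A 4\<^esub>
        mat_apply A (conn_matrix m n k l s) a) = nabla m n k l (unit_coeff s) (coker_class m n k
            l v)"
      unfolding N_def A_def that(3) by (rule nabla_unit[OF hyps that(1,2), symmetric])
    ultimately show ?thesis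
      by (simp only:)
  qed
  have "\<exists>!conn. is_connection F A W V conn \<and>
       (\<forall>s<4. \<forall>a\<in>carrier (free_module A 4).
          conn (delta m n s) (N +>\<^bsub>free_module A 4\<^esub> a) =
          N +>\<^bsub>free_module A 4\<^esub>
            (map_vec (delta m n s) a \<oplus>\<^bsub>free_module A 4\<^esub> mat_apply A (conn_matrix m n k l s) a))"
  proof (rule ex1I[of _ ?conn], intro conjI allI impI ballI)
    show "is_connection F A W V ?conn"
      unfolding range F_def A_def W_def by (rule mf_connection_is_connection[OF hyps])
    fix s a assume s: "s < (4::nat)" and "a \<in> carrier (free_module A 4)"
    then obtain v where v: "v \<in> carrier_vec 4" "a = vec_class m n v"
      unfolding A_def free_module_carrier by blast
    show "?conn (delta m n s) (N +>\<^bsub>free_module A 4\<^esub> a) =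
          N +>\<^bsub>free_module A 4\<^esub>
            (map_vec (delta m n s) a \<oplus>\<^bsub>free_module A 4\<^esub> mat_apply A (conn_matrix m n k l s) a)"
      by (rule formula[OF s v, THEN iffD2])
        (simp only: delta_eq_delta_class[OF mn s] mf_connection_apply[OF hyps])
  next
    fix conn
    assume conn: "is_connection F A W V conn \<and>
       (\<forall>s<4. \<forall>a\<in>carrier (free_module A 4).
          conn (delta m n s) (N +>\<^bsub>free_module A 4\<^esub> a) =
          N +>\<^bsub>free_module A 4\<^esub>
            (map_vec (delta m n s) a \<oplus>\<^bsub>free_module A 4\<^esub> mat_apply A (conn_matrix m n k l s) a))"
    show "conn = ?conn"
    proof (rule mf_connection_unique[OF hyps])
      show "is_connection (ground_field m n) (hyp_ring m n) (mf_module m n k l) (range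
          (delta_class m n)) conn"
        using conn unfolding range F_def A_def W_def by blast
      fix s and v :: "'a ps3 vec" assume s: "s < (4::nat)" and v: "v \<in> carrier_vec 4"
      have "vec_class m n v \<in> carrier (free_module A 4)"
        unfolding A_def free_module_carrier using v by (rule imageI)
      then show "conn (delta m n s) (coker_class m n k l v) = nabla m n k l (unit_coeff s)
          (coker_class m n k l v)"
        using conn s formula[OF s v refl, of conn] by blast
    qed
  qed
  with V delta generate show ?thesis
    by blast
qed

end
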